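(* Let $d\ge1$ and let $(\mathbb Z^d,E,\mu,w)$ be the weighted nearest-neighbour lattice graph with vertex measure $\mu(x)=\sum_{y\sim x}w_{xy}$, satisfying $0<\mu_{\min}\le\mu_{\max}<\infty$ and $\inf_{x\sim y}w_{xy}>0$, with normalized Laplacian $\Delta$ and heat kernel $p(t,x,y)$. Let $$W(x,y)=\mu(x)\mu(y)\int_1^\infty p(t,x,y)\,\frac{dt}{t}.$$ Then there is a constant $C\ge1$, independent of $x,y$, such that $$C^{-1}d(x,y)^{-d}\le W(x,y)\le C\,d(x,y)^{-d}\quad\text{for all }x\neq y,\qquad C^{-1}\le W(x,x)\le C\quad\text{for all }x .$$
   Context: Weighted lattice graph: vertex set $\mathbb Z^d$, with $x\sim y$ iff $|x-y|_1=1$; symmetric weights $w_{xy}=w_{yx}>0$ if $x\sim y$ and $w_{xy}=0$ otherwise (in particular $w_{xx}=0$); $\mu(x)=\sum_{y\sim x}w_{xy}$; $\mu_{\min}=\inf_x\mu(x)$, $\mu_{\max}=\sup_x\mu(x)$. $d(x,y)$ is the graph distance (the exponent $d$ is the dimension). The normalized Laplacian is $\Delta u(x)=\frac1{\mu(x)}\sum_{y\sim x}w_{xy}(u(y)-u(x))$, a bounded self-adjoint operator on $\ell^2(\mathbb Z^d,\mu)$. The heat kernel $p(t,x,y)$, $t\ge0$, is defined by $e^{t\Delta}u(x)=\sum_{y}p(t,x,y)u(y)\mu(y)$, i.e. $p(t,x,y)=\mu(y)^{-1}(e^{t\Delta}\mathbf 1_{\{y\}})(x)$. *)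

theory Defs
  imports "HOL-Analysis.Analysis"
begin

definition adj :: "int ^ 'n::finite \<Rightarrow> int ^ 'n \<Rightarrow> bool" where
  "adj x y \<longleftrightarrow> (\<Sum>i\<in>UNIV. \<bar>x $ i - y $ i\<bar>) = 1"

definition graph_dist :: "int ^ 'n::finite \<Rightarrow> int ^ 'n \<Rightarrow> nat" where
  "graph_dist x y = (LEAST k. (x, y) \<in> {(a, b). adj a b} ^^ k)"

definition vertex_measure :: "(int ^ 'n::finite \<Rightarrow> int ^ 'n \<Rightarrow> real) \<Rightarrow> int ^ 'n \<Rightarrow> real" where
  "vertex_measure w x = (\<Sum>y | adj x y. w x y)"

definition laplacian ::
  "(int ^ 'n::finite \<Rightarrow> int ^ 'n \<Rightarrow> real) \<Rightarrow> (int ^ 'n \<Rightarrow> real) \<Rightarrow> int ^ 'n \<Rightarrow> real" where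
  "laplacian w u x = (\<Sum>y | adj x y. w x y * (u y - u x)) / vertex_measure w x"

definition l2_space :: "('a \<Rightarrow> real) \<Rightarrow> ('a \<Rightarrow> real) set" where
  "l2_space m = {u. (\<lambda>x. (u x)\<^sup>2 * m x) summable_on UNIV}"

definition l2_norm :: "('a \<Rightarrow> real) \<Rightarrow> ('a \<Rightarrow> real) \<Rightarrow> real" where
  "l2_norm m u = sqrt (\<Sum>\<^sub>\<infinity>x. (u x)\<^sup>2 * m x)"

text \<open>The exponential \<open>e\<^sup>A u = (\<Sum>k. A\<^sup>k u / k!)\<close> of a bounded operator \<open>A\<close> on
  \<open>\<ell>\<^sup>2(m)\<close>, the series being summed in the norm of \<open>\<ell>\<^sup>2(m)\<close>.  The limit exists and is unique
  if \<open>m > 0\<close> and \<open>A\<close> is bounded; see \<open>l2_exp_ex1\<close> and \<open>laplacian_bounded\<close> below.\<close>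

definition l2_exp ::
  "('a \<Rightarrow> real) \<Rightarrow> (('a \<Rightarrow> real) \<Rightarrow> 'a \<Rightarrow> real) \<Rightarrow> ('a \<Rightarrow> real) \<Rightarrow> 'a \<Rightarrow> real" where
  "l2_exp m A u = (THE v. v \<in> l2_space m \<and>
     (\<lambda>n. l2_norm m (\<lambda>x. v x - (\<Sum>k<n. (A ^^ k) u x / fact k))) \<longlonglongrightarrow> 0)"

definition heat_semigroup ::
  "(int ^ 'n::finite \<Rightarrow> int ^ 'n \<Rightarrow> real) \<Rightarrow> real \<Rightarrow> (int ^ 'n \<Rightarrow> real) \<Rightarrow> int ^ 'n \<Rightarrow> real" where
  "heat_semigroup w t = l2_exp (vertex_measure w) (\<lambda>u x. t * laplacian w u x)"

definition heat_kernel ::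
  "(int ^ 'n::finite \<Rightarrow> int ^ 'n \<Rightarrow> real) \<Rightarrow> real \<Rightarrow> int ^ 'n \<Rightarrow> int ^ 'n \<Rightarrow> real" where
  "heat_kernel w t x y = heat_semigroup w t (indicator {y}) x / vertex_measure w y"

text \<open>The integral is a Bochner integral, hence \<open>0\<close> if the integrand is not integrable; a
  positive lower bound on \<open>W_kernel\<close> therefore entails integrability.\<close>

definition W_kernel ::
  "(int ^ 'n::finite \<Rightarrow> int ^ 'n \<Rightarrow> real) \<Rightarrow> int ^ 'n \<Rightarrow> int ^ 'n \<Rightarrow> real" where
  "W_kernel w x y =
     vertex_measure w x * vertex_measure w y * (LINT t:{1..}|lborel. heat_kernel w t x y / t)"

lemma finite_neighbours: "finite {y :: int ^ 'n::finite. adj x y}"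
proof -
  have "{y. adj x y} \<subseteq> (\<lambda>f. \<chi> i. f i) ` (PiE UNIV (\<lambda>i. {x $ i - 1..x $ i + 1}))"
  proof
    fix y assume "y \<in> {y. adj x y}"
    then have s: "(\<Sum>i\<in>UNIV. \<bar>x $ i - y $ i\<bar>) = 1" by (simp add: adj_def)
    have "\<bar>x $ i - y $ i\<bar> \<le> 1" for i
      using member_le_sum[of i UNIV "\<lambda>i. \<bar>x $ i - y $ i\<bar>"] s by simp
    then have "(\<lambda>i. y $ i) \<in> PiE UNIV (\<lambda>i. {x $ i - 1..x $ i + 1})"
      by (auto simp: PiE_def Pi_def abs_le_iff) (smt (verit))+
    then show "y \<in> (\<lambda>f. \<chi> i. f i) ` (PiE UNIV (\<lambda>i. {x $ i - 1..x $ i + 1}))"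
      by (rule rev_image_eqI) (simp add: vec_eq_iff)
  qed
  then show ?thesis by (rule finite_subset) (intro finite_imageI finite_PiE, auto)
qed

lemma adj_commute: "adj x y \<longleftrightarrow> adj y x"
  by (simp add: adj_def abs_minus_commute)

lemma l2_finite_bound:
  assumes m: "\<And>x. m x > 0" and B: "B \<ge> 0"
    and F: "\<And>F. finite F \<Longrightarrow> (\<Sum>x\<in>F. (u x)\<^sup>2 * m x) \<le> B\<^sup>2"
  shows "u \<in> l2_space m" and "l2_norm m u \<le> B"
proof -
  have s: "(\<lambda>x. (u x)\<^sup>2 * m x) summable_on UNIV"
    by (rule nonneg_bdd_above_summable_on)
       (auto intro!: bdd_aboveI[of _ "B\<^sup>2"] F simp: m less_imp_le)
  then show "u \<in> l2_space m" by (simp add: l2_space_def)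
  have "(\<Sum>\<^sub>\<infinity>x. (u x)\<^sup>2 * m x) \<le> B\<^sup>2"
    by (rule infsum_le_finite_sums[OF s]) (auto intro: F)
  then show "l2_norm m u \<le> B"
    unfolding l2_norm_def using B by (simp add: real_le_lsqrt infsum_nonneg m less_imp_le)
qed

lemma l2_finite_le:
  assumes m: "\<And>x. m x > 0" and u: "u \<in> l2_space m" and F: "finite F"
  shows "(\<Sum>x\<in>F. (u x)\<^sup>2 * m x) \<le> (l2_norm m u)\<^sup>2"
proof -
  have "(\<Sum>x\<in>F. (u x)\<^sup>2 * m x) \<le> (\<Sum>\<^sub>\<infinity>x. (u x)\<^sup>2 * m x)"
    using u F by (intro finite_sum_le_infsum) (auto simp: l2_space_def m less_imp_le)
  moreover have "(\<Sum>\<^sub>\<infinity>x. (u x)\<^sup>2 * m x) \<ge> 0" by (simp add: infsum_nonneg m less_imp_le)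
  ultimately show ?thesis by (simp add: l2_norm_def)
qed

lemma l2_norm_nonneg:
  assumes m: "\<And>x. m x > 0"
  shows "l2_norm m u \<ge> 0"
  unfolding l2_norm_def by (simp add: infsum_nonneg m less_imp_le)

lemma l2_point:
  assumes m: "\<And>x. m x > 0" and u: "u \<in> l2_space m"
  shows "\<bar>u x\<bar> \<le> l2_norm m u / sqrt (m x)"
proof -
  have "(u x)\<^sup>2 * m x \<le> (l2_norm m u)\<^sup>2"
    using l2_finite_le[OF m u, of "{x}"] by simp
  then have "sqrt ((u x)\<^sup>2 * m x) \<le> l2_norm m u"
    using l2_norm_nonneg[of m u] m by (simp add: real_le_lsqrt)
  then show ?thesis using m[of x] by (simp add: real_sqrt_mult field_simps)
qed

lemma l2_set_le:
  assumes m: "\<And>x. m x > 0" and u: "u \<in> l2_space m" and F: "finite F"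
  shows "L2_set (\<lambda>x. u x * sqrt (m x)) F \<le> l2_norm m u"
proof -
  have "(\<Sum>x\<in>F. (u x * sqrt (m x))\<^sup>2) = (\<Sum>x\<in>F. (u x)\<^sup>2 * m x)"
    using m by (simp add: power_mult_distrib less_imp_le)
  then show ?thesis
    unfolding L2_set_def using l2_finite_le[of m u, OF m u F] l2_norm_nonneg[of m u, OF m]
    by (simp add: real_le_lsqrt)
qed

lemma l2_of_set_le:
  assumes m: "\<And>x. m x > 0" and B: "B \<ge> 0"
    and F: "\<And>F. finite F \<Longrightarrow> L2_set (\<lambda>x. u x * sqrt (m x)) F \<le> B"
  shows "u \<in> l2_space m" and "l2_norm m u \<le> B"
proof -
  have *: "(\<Sum>x\<in>F. (u x)\<^sup>2 * m x) \<le> B\<^sup>2" if "finite F" for F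
  proof -
    have "(\<Sum>x\<in>F. (u x)\<^sup>2 * m x) = (\<Sum>x\<in>F. (u x * sqrt (m x))\<^sup>2)"
      using m by (simp add: power_mult_distrib less_imp_le)
    also have "\<dots> = (L2_set (\<lambda>x. u x * sqrt (m x)) F)\<^sup>2"
      by (simp add: L2_set_def sum_nonneg)
    also have "\<dots> \<le> B\<^sup>2" using F[OF that] by (intro power_mono) auto
    finally show ?thesis .
  qed
  show "u \<in> l2_space m" using m B * by (rule l2_finite_bound(1))
  show "l2_norm m u \<le> B" using m B * by (rule l2_finite_bound(2))
qed

lemma l2_diff:
  assumes m: "\<And>x. m x > 0" and u: "u \<in> l2_space m" and v: "v \<in> l2_space m"
  shows "(\<lambda>x. u x - v x) \<in> l2_space m"
    and "l2_norm m (\<lambda>x. u x - v x) \<le> l2_norm m u + l2_norm m v"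
proof -
  have *: "L2_set (\<lambda>x. (u x - v x) * sqrt (m x)) F \<le> l2_norm m u + l2_norm m v"
    if F: "finite F" for F
  proof -
    have "L2_set (\<lambda>x. (u x - v x) * sqrt (m x)) F
        = L2_set (\<lambda>x. u x * sqrt (m x) + - (v x * sqrt (m x))) F"
      by (simp add: algebra_simps)
    also have "\<dots> \<le> L2_set (\<lambda>x. u x * sqrt (m x)) F + L2_set (\<lambda>x. - (v x * sqrt (m x))) F"
      by (rule L2_set_triangle_ineq)
    also have "L2_set (\<lambda>x. - (v x * sqrt (m x))) F = L2_set (\<lambda>x. v x * sqrt (m x)) F"
      by (simp add: L2_set_def)
    finally show ?thesis
      using l2_set_le[OF m u F] l2_set_le[OF m v F] by linarith
  qed
  have B: "0 \<le> l2_norm m u + l2_norm m v" by (simp add: l2_norm_nonneg[OF m])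
  show "(\<lambda>x. u x - v x) \<in> l2_space m" using m B * by (rule l2_of_set_le(1))
  show "l2_norm m (\<lambda>x. u x - v x) \<le> l2_norm m u + l2_norm m v"
    using m B * by (rule l2_of_set_le(2))
qed

lemma l2_exp_ex1:
  fixes A :: "('a \<Rightarrow> real) \<Rightarrow> 'a \<Rightarrow> real"
  assumes m: "\<And>x. m x > 0" and u: "u \<in> l2_space m" and K: "K \<ge> 0"
    and A: "\<And>u. u \<in> l2_space m \<Longrightarrow> A u \<in> l2_space m \<and> l2_norm m (A u) \<le> K * l2_norm m u"
  shows "\<exists>!v. v \<in> l2_space m \<and>
     (\<lambda>n. l2_norm m (\<lambda>x. v x - (\<Sum>k<n. (A ^^ k) u x / fact k))) \<longlonglongrightarrow> 0"
proof -
  define N where "N = l2_norm m u"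
  define a where "a = (\<lambda>k. (A ^^ k) u)"
  define b where "b = (\<lambda>k. N * (K ^ k / fact k))"
  define S where "S = (\<lambda>n x. \<Sum>k<n. a k x / fact k)"
  have N0: "N \<ge> 0" by (simp add: N_def l2_norm_nonneg m)
  have b0: "b k \<ge> 0" for k using N0 K by (simp add: b_def)
  have ak: "a k \<in> l2_space m \<and> l2_norm m (a k) \<le> K ^ k * N" for k
  proof (induction k)
    case 0 then show ?case using u by (simp add: a_def N_def)
  next
    case (Suc k)
    have "l2_norm m (A (a k)) \<le> K * l2_norm m (a k)" using A Suc by blast
    also have "\<dots> \<le> K * (K ^ k * N)" using Suc K by (intro mult_left_mono) auto
    finally show ?case using A[of "a k"] Suc by (simp add: a_def mult.assoc)
  qed
  have "summable (\<lambda>k. K ^ k /\<^sub>R fact k)" by (rule summable_exp_generic)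
  then have sb: "summable b"
    unfolding b_def by (intro summable_mult) (simp add: divide_inverse mult.commute)
  have pt: "\<bar>a k x / fact k\<bar> \<le> b k / sqrt (m x)" for k x
  proof -
    have "\<bar>a k x\<bar> \<le> l2_norm m (a k) / sqrt (m x)" using l2_point[of m "a k" x] m ak by blast
    also have "\<dots> \<le> K ^ k * N / sqrt (m x)" using ak by (intro divide_right_mono) (auto simp: m less_imp_le)
    finally have "\<bar>a k x\<bar> / fact k \<le> K ^ k * N / sqrt (m x) / fact k" by (intro divide_right_mono) auto
    then show ?thesis by (simp add: b_def field_simps)
  qed
  have sa: "summable (\<lambda>k. a k x / fact k)" for x
    using pt by (intro summable_comparison_test'[OF summable_divide[OF sb]]) simp
  define v where "v = (\<lambda>x. \<Sum>k. a k x / fact k)"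
  have Sv: "(\<lambda>n. S n x) \<longlonglongrightarrow> v x" for x
    unfolding S_def v_def using sa by (rule summable_LIMSEQ)
  have Sn: "(\<lambda>j. S (n + j) x) \<longlonglongrightarrow> v x" for n x
    using LIMSEQ_ignore_initial_segment[OF Sv[of x], of n] by (simp add: add.commute)
  define R where "R = (\<lambda>n. (\<Sum>k. b (k + n)))"
  have R0: "R n \<ge> 0" for n
    unfolding R_def by (rule suminf_nonneg) (auto simp: b0 sb summable_iff_shift)
  have SS: "L2_set (\<lambda>x. (S (n + j) x - S n x) * sqrt (m x)) F \<le> (\<Sum>k<j. b (k + n))"
    if F: "finite F" for n j F
  proof (induction j)
    case 0 show ?case by (simp add: L2_set_def)
  next
    case (Suc j)
    have "L2_set (\<lambda>x. (S (n + Suc j) x - S n x) * sqrt (m x)) F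
      = L2_set (\<lambda>x. (S (n + j) x - S n x) * sqrt (m x) + inverse (fact (n + j)) * (a (n + j) x * sqrt (m x))) F"
      by (simp add: S_def algebra_simps divide_inverse)
    also have "\<dots> \<le> L2_set (\<lambda>x. (S (n + j) x - S n x) * sqrt (m x)) F
        + L2_set (\<lambda>x. inverse (fact (n + j)) * (a (n + j) x * sqrt (m x))) F"
      by (rule L2_set_triangle_ineq)
    also have "L2_set (\<lambda>x. inverse (fact (n + j)) * (a (n + j) x * sqrt (m x))) F
       = inverse (fact (n + j)) * L2_set (\<lambda>x. a (n + j) x * sqrt (m x)) F"
      by (rule L2_set_right_distrib[symmetric]) simp
    also have "\<dots> \<le> inverse (fact (n + j)) * (K ^ (n + j) * N)"
      using l2_set_le[of m "a (n + j)" F] m F ak[of "n + j"] by (intro mult_left_mono) (auto intro: order_trans)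
    also have "\<dots> = b (j + n)" by (simp add: b_def divide_inverse add.commute mult_ac)
    finally show ?case using Suc by simp
  qed
  have vS: "L2_set (\<lambda>x. (v x - S n x) * sqrt (m x)) F \<le> R n" if F: "finite F" for n F
  proof (rule LIMSEQ_le_const2)
    show "(\<lambda>j. L2_set (\<lambda>x. (S (n + j) x - S n x) * sqrt (m x)) F)
        \<longlonglongrightarrow> L2_set (\<lambda>x. (v x - S n x) * sqrt (m x)) F"
      unfolding L2_set_def by (intro tendsto_intros Sn)
    show "\<exists>M. \<forall>j\<ge>M. L2_set (\<lambda>x. (S (n + j) x - S n x) * sqrt (m x)) F \<le> R n"
    proof (intro exI allI impI)
      fix j
      have "(\<Sum>k<j. b (k + n)) \<le> R n"
        unfolding R_def by (rule sum_le_suminf) (auto simp: b0 sb summable_iff_shift)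
      then show "L2_set (\<lambda>x. (S (n + j) x - S n x) * sqrt (m x)) F \<le> R n"
        using SS[OF F, of n j] by linarith
    qed
  qed
  have nv: "l2_norm m (\<lambda>x. v x - S n x) \<le> R n" for n
    using m R0[of n] vS[of _ n] by (rule l2_of_set_le(2))
  have vSl: "(\<lambda>x. v x - S n x) \<in> l2_space m" for n
    using m R0[of n] vS[of _ n] by (rule l2_of_set_le(1))
  have vl: "v \<in> l2_space m"
    using vSl[of 0] by (simp add: S_def)
  have Sl: "S n \<in> l2_space m" for n
    using l2_diff(1)[of m v "\<lambda>x. v x - S n x"] m vl vSl[of n] by simp
  have Rl: "R \<longlonglongrightarrow> 0"
    unfolding R_def using suminf_exist_split2[OF sb] .
  have lim: "(\<lambda>n. l2_norm m (\<lambda>x. v x - S n x)) \<longlonglongrightarrow> 0"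
    by (rule tendsto_sandwich[OF _ _ tendsto_const Rl]) (auto simp: nv l2_norm_nonneg m)
  show ?thesis
  proof (rule ex1I[of _ v])
    show "v \<in> l2_space m \<and>
     (\<lambda>n. l2_norm m (\<lambda>x. v x - (\<Sum>k<n. (A ^^ k) u x / fact k))) \<longlonglongrightarrow> 0"
      using vl lim by (simp add: S_def a_def)
  next
    fix v' assume *: "v' \<in> l2_space m \<and>
     (\<lambda>n. l2_norm m (\<lambda>x. v' x - (\<Sum>k<n. (A ^^ k) u x / fact k))) \<longlonglongrightarrow> 0"
    then have l': "(\<lambda>n. l2_norm m (\<lambda>x. v' x - S n x)) \<longlonglongrightarrow> 0" by (simp add: S_def a_def)
    show "v' = v"
    proof
      fix x
      have "(\<lambda>n. v' x - S n x) \<longlonglongrightarrow> 0"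
      proof (rule Lim_null_comparison)
        show "\<forall>\<^sub>F n in sequentially. norm (v' x - S n x) \<le> l2_norm m (\<lambda>x. v' x - S n x) / sqrt (m x)"
          using l2_point[of m "\<lambda>x. v' x - S n x" x for n] l2_diff(1)[of m v' "S n" for n] m * Sl by simp
        show "(\<lambda>n. l2_norm m (\<lambda>x. v' x - S n x) / sqrt (m x)) \<longlonglongrightarrow> 0"
          using tendsto_divide[OF l' tendsto_const, of "sqrt (m x)"] m[of x] by simp
      qed
      moreover have "(\<lambda>n. v' x - S n x) \<longlonglongrightarrow> v' x - v x" by (intro tendsto_intros Sv)
      ultimately have "v' x - v x = 0" using LIMSEQ_unique by blast
      then show "v' x = v x" by simp
    qed
  qed
qed

lemma laplacian_bounded:
  fixes w :: "int ^ 'n::finite \<Rightarrow> int ^ 'n \<Rightarrow> real"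
  assumes sym: "\<And>x y. w x y = w y x" and pos: "\<And>x y. adj x y \<Longrightarrow> w x y > 0"
    and m: "\<And>x. vertex_measure w x > 0" and u: "u \<in> l2_space (vertex_measure w)"
  shows "laplacian w u \<in> l2_space (vertex_measure w)"
    and "l2_norm (vertex_measure w) (laplacian w u) \<le> 2 * l2_norm (vertex_measure w) u"
proof -
  let ?m = "vertex_measure w"
  let ?N = "l2_norm ?m u"
  have cs: "(laplacian w u x)\<^sup>2 * ?m x \<le> 2 * (u x)\<^sup>2 * ?m x + 2 * (\<Sum>y | adj x y. w x y * (u y)\<^sup>2)" for x
  proof -
    have "(\<Sum>y | adj x y. w x y * (u y - u x))
        = (\<Sum>y | adj x y. sqrt (w x y) * (sqrt (w x y) * (u y - u x)))"
      by (rule sum.cong) (auto simp: pos less_imp_le mult.assoc[symmetric])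
    then have "(\<Sum>y | adj x y. w x y * (u y - u x))\<^sup>2
        \<le> (\<Sum>y | adj x y. (sqrt (w x y))\<^sup>2) * (\<Sum>y | adj x y. (sqrt (w x y) * (u y - u x))\<^sup>2)"
      by (simp only:) (rule Cauchy_Schwarz_ineq_sum)
    also have "(\<Sum>y | adj x y. (sqrt (w x y))\<^sup>2) = ?m x"
      unfolding vertex_measure_def by (rule sum.cong) (auto simp: pos less_imp_le)
    also have "(\<Sum>y | adj x y. (sqrt (w x y) * (u y - u x))\<^sup>2) = (\<Sum>y | adj x y. w x y * (u y - u x)\<^sup>2)"
      by (rule sum.cong) (auto simp: pos less_imp_le power_mult_distrib)
    finally have "(laplacian w u x)\<^sup>2 * ?m x \<le> (\<Sum>y | adj x y. w x y * (u y - u x)\<^sup>2)"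
      using m[of x] by (simp add: laplacian_def power_divide field_simps power2_eq_square)
    also have "\<dots> \<le> (\<Sum>y | adj x y. w x y * (2 * (u x)\<^sup>2 + 2 * (u y)\<^sup>2))"
    proof (rule sum_mono)
      fix y assume "y \<in> {y. adj x y}"
      moreover have "(u y - u x)\<^sup>2 \<le> 2 * (u x)\<^sup>2 + 2 * (u y)\<^sup>2"
        using zero_le_power2[of "u x + u y"] by (simp add: power2_eq_square algebra_simps)
      ultimately show "w x y * (u y - u x)\<^sup>2 \<le> w x y * (2 * (u x)\<^sup>2 + 2 * (u y)\<^sup>2)"
        using pos[of x y] by (intro mult_left_mono) auto
    qed
    also have "\<dots> = 2 * (u x)\<^sup>2 * ?m x + 2 * (\<Sum>y | adj x y. w x y * (u y)\<^sup>2)"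
      by (simp add: vertex_measure_def algebra_simps sum.distrib sum_distrib_left sum_distrib_right)
    finally show ?thesis .
  qed
  have *: "(\<Sum>x\<in>F. (laplacian w u x)\<^sup>2 * ?m x) \<le> (2 * ?N)\<^sup>2" if F: "finite F" for F
  proof -
    define G where "G = (\<Union>x\<in>F. {y. adj x y})"
    have G: "finite G" using F finite_neighbours by (auto simp: G_def)
    have "(\<Sum>x\<in>F. \<Sum>y | adj x y. w x y * (u y)\<^sup>2) = (\<Sum>x\<in>F. \<Sum>y | y \<in> G \<and> adj x y. w x y * (u y)\<^sup>2)"
      by (intro sum.cong) (auto simp: G_def)
    also have "\<dots> = (\<Sum>y\<in>G. \<Sum>x | x \<in> F \<and> adj x y. w x y * (u y)\<^sup>2)"
      by (rule sum.swap_restrict[OF F G])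
    also have "\<dots> \<le> (\<Sum>y\<in>G. (u y)\<^sup>2 * ?m y)"
    proof (rule sum_mono)
      fix y
      have "(\<Sum>x | x \<in> F \<and> adj x y. w x y * (u y)\<^sup>2) \<le> (\<Sum>x | adj y x. w y x * (u y)\<^sup>2)"
        unfolding sym[of _ y]
        by (rule sum_mono2[OF finite_neighbours]) (auto simp: adj_commute[of _ y] pos less_imp_le)
      then show "(\<Sum>x | x \<in> F \<and> adj x y. w x y * (u y)\<^sup>2) \<le> (u y)\<^sup>2 * ?m y"
        by (simp add: vertex_measure_def sum_distrib_right mult.commute sum_distrib_left)
    qed
    also have "\<dots> \<le> ?N\<^sup>2" using m u G by (rule l2_finite_le)
    finally have 1: "(\<Sum>x\<in>F. \<Sum>y | adj x y. w x y * (u y)\<^sup>2) \<le> ?N\<^sup>2" .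
    have "(\<Sum>x\<in>F. (laplacian w u x)\<^sup>2 * ?m x)
        \<le> (\<Sum>x\<in>F. 2 * (u x)\<^sup>2 * ?m x + 2 * (\<Sum>y | adj x y. w x y * (u y)\<^sup>2))"
      by (rule sum_mono) (rule cs)
    also have "\<dots> = 2 * (\<Sum>x\<in>F. (u x)\<^sup>2 * ?m x) + 2 * (\<Sum>x\<in>F. \<Sum>y | adj x y. w x y * (u y)\<^sup>2)"
      by (simp add: sum.distrib sum_distrib_left mult.assoc)
    also have "\<dots> \<le> 2 * ?N\<^sup>2 + 2 * ?N\<^sup>2"
      using 1 l2_finite_le[OF m u F] by linarith
    finally show ?thesis by (simp add: power_mult_distrib)
  qed
  have B: "0 \<le> 2 * ?N" using l2_norm_nonneg[OF m] by simp
  show "laplacian w u \<in> l2_space ?m" using m B * by (rule l2_finite_bound(1))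
  show "l2_norm ?m (laplacian w u) \<le> 2 * ?N" using m B * by (rule l2_finite_bound(2))
qed

end

theory Submission imports Defs begin

text \<open>
  Write \<open>p t x y\<close> for the heat kernel, \<open>d\<close> for the dimension and \<open>\<mu>\<close> for the vertex measure; since
  the Laplacian is \<open>P - 1\<close> with \<open>P\<close> the averaging operator, \<open>p\<close> is a Poisson mixture of the random
  walk kernels. A Poincare inequality on cubes gives a Nash inequality and hence
  \<open>p t x y \<le> K t\<^sup>-\<^sup>d\<^sup>/\<^sup>2\<close>. Since \<open>(v - u) (b\<^sup>2 v - a\<^sup>2 u) = (b v - a u)\<^sup>2 - u v (b - a)\<^sup>2\<close>, the weighted energy
  \<open>\<Sum>z. (1 + |z - y|)\<^sup>2\<^sup>d\<^sup>+\<^sup>2 p(t,z,y)\<^sup>2 \<mu>(z)\<close> satisfies a linear differential inequality, which gives the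
  off-diagonal bound \<open>(1 + |x - y|)\<^sup>d\<^sup>+\<^sup>1 p t x y \<le> K t\<^sup>1\<^sup>/\<^sup>2\<close>; the two bounds integrate to the upper estimate.
  For the lower estimate we follow Nash: the mean of \<open>ln p\<close> against a tent-shaped product weight at scale
  \<open>R = O(t\<^sup>1\<^sup>/\<^sup>2)\<close> satisfies a Riccati inequality, because its derivative dominates the weighted Dirichlet energy of
  \<open>ln p\<close>, which the weighted Poincare inequality compares with the variance of \<open>ln p\<close>, and the variance
  is large if the mean is very negative, because the mass is concentrated on a ball of radius \<open>O(t\<^sup>1\<^sup>/\<^sup>2)\<close>. The bound for this mean
  and Jensen's inequality in \<open>p (2 t) x y = \<Sum>z. p(t,x,z) p(t,z,y) \<mu>(z)\<close> give
  \<open>p t x y \<ge> a t\<^sup>-\<^sup>d\<^sup>/\<^sup>2\<close> for \<open>t \<ge> 8 max(1, |x - y|)\<^sup>2\<close>.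
\<close>

section \<open>The lattice\<close>

text \<open>Only powers of the distance are at stake, so polynomial moments replace Gaussian
  estimates, which fail on a lattice when t is small against the distance. The order d + 1 is the
  one for which the off-diagonal bound, integrated against dt/t up to t = |x - y|^2, gives |x -
  y|^(-d); beyond that time the on-diagonal bound integrates to the same order. From below, times
  comparable to |x - y|^2 already contribute |x - y|^(-d). Writing t as a multiple of s^2 keeps all
  powers integral for odd d. The discrete obstacle is the logarithm: p has no a priori bounded ratio
  across an edge, so the chain rule for ln p is replaced by the edge inequality
  \<open>log_edge\<close>. It asks that the squared increment of the weight be at most a constant
  times the smaller end value, except on edges leaving the support; a squared tent satisfies this.
  Nothing is known about the logarithmic mean at the start of the time interval, and only the
  quadratic damping of a Riccati inequality gives a bound free of the initial value.\<close>

definition l1 :: "int ^ 'n::finite \<Rightarrow> real" where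
  "l1 v = (\<Sum>i\<in>UNIV. \<bar>real_of_int (v $ i)\<bar>)"

lemma l1_nonneg [simp]: "0 \<le> l1 v"
  by (simp add: l1_def sum_nonneg)

lemma l1_zero [simp]: "l1 0 = 0"
  by (simp add: l1_def)

lemma l1_minus_commute: "l1 (x - y) = l1 (y - x)"
  by (simp add: l1_def abs_minus_commute)

lemma l1_triangle: "l1 (x - z) \<le> l1 (x - y) + l1 (y - z)"
  unfolding l1_def sum.distrib[symmetric] by (rule sum_mono) simp

lemma component_le_l1: "\<bar>real_of_int (v $ i)\<bar> \<le> l1 v"
  unfolding l1_def by (rule member_le_sum) auto

lemma adj_iff_l1: "adj x y \<longleftrightarrow> l1 (x - y) = 1"
proof -
  have "l1 (x - y) = real_of_int (\<Sum>i\<in>UNIV. \<bar>x $ i - y $ i\<bar>)"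
    by (simp add: l1_def)
  then show ?thesis by (simp only: adj_def of_int_eq_1_iff)
qed

lemma l1_eq_0_iff: "l1 (x - y) = 0 \<longleftrightarrow> x = y"
  by (auto simp: l1_def sum_nonneg_eq_0_iff vec_eq_iff)

lemma l1_neighbour:
  assumes "adj x y"
  shows "l1 (y - z) \<le> l1 (x - z) + 1"
  using l1_triangle[of y z x] assms by (simp add: adj_iff_l1 l1_minus_commute)

lemma adj_axis: "adj x (x + axis i 1)"
  by (simp add: adj_def axis_def if_distrib cong: if_cong)

lemma adj_imp_axis:
  assumes "adj x y"
  obtains i where "y = x + axis i 1 \<or> x = y + axis i 1"
proof -
  have s: "(\<Sum>i\<in>UNIV. \<bar>x $ i - y $ i\<bar>) = 1" using assms by (simp add: adj_def)
  then obtain i where i: "x $ i \<noteq> y $ i" by fastforce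
  have "(\<Sum>j\<in>UNIV. \<bar>x $ j - y $ j\<bar>) = \<bar>x $ i - y $ i\<bar> + (\<Sum>j\<in>UNIV - {i}. \<bar>x $ j - y $ j\<bar>)"
    by (rule sum.remove) auto
  moreover have "(\<Sum>j\<in>UNIV - {i}. \<bar>x $ j - y $ j\<bar>) \<ge> 0" by (simp add: sum_nonneg)
  ultimately have 1: "\<bar>x $ i - y $ i\<bar> = 1" and "(\<Sum>j\<in>UNIV - {i}. \<bar>x $ j - y $ j\<bar>) = 0"
    using i s by linarith+
  then have j: "x $ j = y $ j" if "j \<noteq> i" for j
    using that by (simp add: sum_nonneg_eq_0_iff)
  show thesis
  proof (cases "y $ i = x $ i + 1")
    case True
    then have "y = x + axis i 1" using j by (auto simp: vec_eq_iff axis_def)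
    then show thesis using that by blast
  next
    case False
    with 1 have "x $ i = y $ i + 1" by linarith
    then have "x = y + axis i 1" using j by (auto simp: vec_eq_iff axis_def)
    then show thesis using that by blast
  qed
qed

lemma path_l1_le: "(x, y) \<in> {(a, b). adj a b} ^^ k \<Longrightarrow> l1 (x - y) \<le> real k"
proof (induction k arbitrary: y)
  case (Suc k)
  then obtain z where z: "(x, z) \<in> {(a, b). adj a b} ^^ k" "adj z y" by auto
  then show ?case using Suc.IH[OF z(1)] l1_triangle[of x y z] by (simp add: adj_iff_l1)
qed simp

text \<open>One unit step towards \<open>y\<close> in a coordinate where the points differ is an
  edge and lowers \<open>l1\<close> by exactly one. Together with \<open>path_l1_le\<close> this
  makes \<open>l1\<close> the graph distance, so that all estimates can be stated with a real-valued
  sum.\<close>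

lemma path_exists: "l1 (x - y) = real k \<Longrightarrow> (x, y) \<in> {(a, b). adj a b} ^^ k"
proof (induction k arbitrary: x)
  case 0
  then show ?case by (simp add: l1_eq_0_iff)
next
  case (Suc k)
  then have "x \<noteq> y" by auto
  then obtain i where i: "x $ i \<noteq> y $ i" by (auto simp: vec_eq_iff)
  define z where "z = x + axis i (if x $ i < y $ i then 1 else - 1)"
  have "l1 (x - y) = \<bar>real_of_int ((x - y) $ i)\<bar> + (\<Sum>j\<in>UNIV - {i}. \<bar>real_of_int ((x - y) $ j)\<bar>)"
    unfolding l1_def by (rule sum.remove) auto
  moreover have "l1 (z - y) = \<bar>real_of_int ((z - y) $ i)\<bar> + (\<Sum>j\<in>UNIV - {i}. \<bar>real_of_int ((z - y) $ j)\<bar>)"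
    unfolding l1_def by (rule sum.remove) auto
  moreover have "(\<Sum>j\<in>UNIV - {i}. \<bar>real_of_int ((z - y) $ j)\<bar>)
      = (\<Sum>j\<in>UNIV - {i}. \<bar>real_of_int ((x - y) $ j)\<bar>)"
    by (rule sum.cong) (auto simp: z_def axis_def)
  moreover have "\<bar>real_of_int ((z - y) $ i)\<bar> = \<bar>real_of_int ((x - y) $ i)\<bar> - 1"
    using i by (auto simp: z_def axis_def)
  ultimately have "l1 (z - y) = real k" using Suc.prems by simp
  then have "(z, y) \<in> {(a, b). adj a b} ^^ k" by (rule Suc.IH)
  moreover have "adj x z"
    unfolding adj_def z_def by (simp add: axis_def if_distrib[of abs] if_distrib[of uminus] cong: if_cong)
  ultimately show ?case by (intro relpow_Suc_I2) auto
qed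

lemma l1_nat: "\<exists>k. l1 v = real k"
proof
  show "l1 v = real (nat (\<Sum>i\<in>UNIV. \<bar>v $ i\<bar>))"
    by (simp add: l1_def sum_nonneg)
qed

lemma graph_dist_l1: "real (graph_dist x y) = l1 (x - y)"
proof -
  obtain k where k: "l1 (x - y) = real k" using l1_nat by blast
  have "graph_dist x y = k"
    unfolding graph_dist_def
  proof (rule Least_equality)
    show "(x, y) \<in> {(a, b). adj a b} ^^ k" using k by (rule path_exists)
    show "k \<le> j" if "(x, y) \<in> {(a, b). adj a b} ^^ j" for j
      using path_l1_le[OF that] k by simp
  qed
  then show ?thesis using k by simp
qed

section \<open>Summable product weights on the lattice\<close>

lemma sum_prod_le_power:
  fixes h :: "int \<Rightarrow> real" and A :: "(int ^ 'n::finite) set"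
  assumes h: "\<And>k. h k \<ge> 0" and H: "\<And>K. finite K \<Longrightarrow> sum h K \<le> H" and A: "finite A"
  shows "(\<Sum>v\<in>A. \<Prod>i\<in>UNIV. h (v $ i)) \<le> H ^ CARD('n)"
proof -
  define K where "K = (\<Union>i. (\<lambda>v. v $ i) ` A)"
  have K: "finite K" using A by (auto simp: K_def)
  let ?P = "PiE (UNIV :: 'n set) (\<lambda>_. K)"
  have "(\<Sum>v\<in>A. \<Prod>i\<in>UNIV. h (v $ i)) = (\<Sum>g\<in>(\<lambda>v. ($) v) ` A. \<Prod>i\<in>UNIV. h (g i))"
    by (subst sum.reindex) (auto simp: inj_on_def vec_eq_iff fun_eq_iff)
  \<comment> \<open>\<open>A\<close> is enlarged to the box spanned by its coordinate projections,
    where the sum of products factors into one-dimensional sums.\<close>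
  also have "\<dots> \<le> (\<Sum>g\<in>?P. \<Prod>i\<in>UNIV. h (g i))"
    by (rule sum_mono2) (auto simp: K_def A h prod_nonneg intro!: finite_PiE)
  also have "\<dots> = (\<Prod>i\<in>(UNIV :: 'n set). \<Sum>k\<in>K. h k)"
    by (rule prod_sum_PiE[symmetric]) (auto simp: K)
  also have "\<dots> = (sum h K) ^ CARD('n)" by simp
  also have "\<dots> \<le> H ^ CARD('n)"
    by (rule power_mono[OF H[OF K]]) (simp add: h sum_nonneg)
  finally show ?thesis .
qed

text \<open>The subtracted term makes the induction close: each new summand 1/a^2 is at most 1/(a-1)
  - 1/a. It is switched off for the empty sum, where \<open>s + real n - 1\<close> could vanish or
  be negative.\<close>

lemma sum_inverse_square_nat:
  fixes s :: real assumes s: "s > 0"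
  shows "(\<Sum>k<n. 1 / (s + real k)\<^sup>2) \<le> 1 / s\<^sup>2 + 1 / s - (if n = 0 then 0 else 1 / (s + real n - 1))"
proof (induction n)
  case 0
  then show ?case using s by simp
next
  case (Suc n)
  show ?case
  proof (cases "n = 0")
    case False
    let ?a = "s + real n"
    have a: "?a > 1" using s False by (simp add: add_pos_nonneg)
    have "1 / ?a\<^sup>2 \<le> 1 / (?a - 1) - 1 / ?a"
    proof -
      have "1 / (?a - 1) - 1 / ?a = 1 / (?a * (?a - 1))"
        using a by (simp add: field_simps)
      moreover have "1 / ?a\<^sup>2 \<le> 1 / (?a * (?a - 1))"
        using a by (intro divide_left_mono) (auto simp: power2_eq_square)
      ultimately show ?thesis by simp
    qed
    then show ?thesis using Suc False by simp
  qed simp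
qed

text \<open>The two half-lines, both counted with 0, contribute at most 1/s^2 + 1/s each, and
  \<open>s \<ge> 1\<close> turns this into 2/s.\<close>

lemma sum_inverse_square_int:
  fixes s :: real assumes s: "s \<ge> 1" and K: "finite K"
  shows "(\<Sum>k\<in>K. 1 / (s + \<bar>real_of_int k\<bar>)\<^sup>2) \<le> 4 / s"
proof -
  define n where "n = Suc (nat (Max (insert 0 (abs ` K))))"
  have n: "nat \<bar>k\<bar> < n" if "k \<in> K" for k
    using K that Max_ge[of "insert 0 (abs ` K)" "\<bar>k\<bar>"] by (auto simp: n_def less_Suc_eq_le nat_le_iff)
  let ?f = "\<lambda>k. 1 / (s + \<bar>real_of_int k\<bar>)\<^sup>2"
  have "(\<Sum>k\<in>K. ?f k) \<le> (\<Sum>k\<in>int ` {..<n} \<union> (uminus \<circ> int) ` {..<n}. ?f k)"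
  proof (rule sum_mono2)
    show "K \<subseteq> int ` {..<n} \<union> (uminus \<circ> int) ` {..<n}"
    proof
      fix k assume k: "k \<in> K"
      have "k = int (nat \<bar>k\<bar>) \<or> k = (uminus \<circ> int) (nat \<bar>k\<bar>)" by auto
      then show "k \<in> int ` {..<n} \<union> (uminus \<circ> int) ` {..<n}" using n[OF k] by blast
    qed
  qed auto
  also have "\<dots> \<le> (\<Sum>k\<in>int ` {..<n}. ?f k) + (\<Sum>k\<in>(uminus \<circ> int) ` {..<n}. ?f k)"
    by (subst sum_Un) (auto intro!: sum_nonneg)
  also have "\<dots> = 2 * (\<Sum>k<n. 1 / (s + real k)\<^sup>2)"
    by (subst (1 2) sum.reindex) (auto simp: inj_on_def)
  also have "(\<Sum>k<n. 1 / (s + real k)\<^sup>2) \<le> 1 / s\<^sup>2 + 1 / s"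
    using sum_inverse_square_nat[of s n] s by (auto split: if_splits) (smt (verit) divide_nonneg_nonneg of_nat_0_le_iff One_nat_def Suc_leI of_nat_1 of_nat_le_iff neq0_conv)+
  also have "1 / s\<^sup>2 \<le> 1 / s"
    using s by (simp add: field_simps power2_eq_square)
  finally show ?thesis by simp
qed

lemma sum_lattice_decay:
  fixes A :: "(int ^ 'n::finite) set" and s :: real
  assumes s: "s \<ge> 1" and A: "finite A"
  shows "(\<Sum>v\<in>A. \<Prod>i\<in>UNIV. 1 / (s + \<bar>real_of_int (v $ i)\<bar>)\<^sup>2) \<le> (4 / s) ^ CARD('n)"
  using sum_prod_le_power[of "\<lambda>k. 1 / (s + \<bar>real_of_int k\<bar>)\<^sup>2" "4 / s" A]
    sum_inverse_square_int[OF s] A by simp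

lemma exp_ge_square:
  fixes a :: real assumes "a \<ge> 0"
  shows "(1 + a)\<^sup>2 \<le> 2 * exp a"
  using exp_lower_Taylor_quadratic[OF assms] by (simp add: power2_eq_square algebra_simps)

text \<open>The common majorant: at bounded times the kernel and its time derivative are at most a
  constant times this function, which justifies the interchanges of lattice sums with derivatives.
  The sum factors over the coordinates and is compared there with inverse squares.\<close>

lemma summable_exp_l1: "(\<lambda>x :: int ^ 'n::finite. exp (- l1 (x - y))) summable_on UNIV"
proof (rule nonneg_bdd_above_summable_on)
  show "bdd_above (sum (\<lambda>x. exp (- l1 (x - y))) ` {F. F \<subseteq> UNIV \<and> finite F})"
  proof (rule bdd_aboveI2)
    fix F :: "(int ^ 'n) set" assume "F \<in> {F. F \<subseteq> UNIV \<and> finite F}"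
    then have F: "finite F" by simp
    have "(\<Sum>x\<in>F. exp (- l1 (x - y))) = (\<Sum>v\<in>(\<lambda>x. x - y) ` F. exp (- l1 v))"
      by (subst sum.reindex) auto
    also have "\<dots> = (\<Sum>v\<in>(\<lambda>x. x - y) ` F. \<Prod>i\<in>UNIV. exp (- \<bar>real_of_int (v $ i)\<bar>))"
      by (simp add: l1_def exp_sum sum_negf[symmetric])
    also have "\<dots> \<le> 8 ^ CARD('n)"
    proof (rule sum_prod_le_power)
      fix K :: "int set" assume K: "finite K"
      have "(\<Sum>k\<in>K. exp (- \<bar>real_of_int k\<bar>)) \<le> (\<Sum>k\<in>K. 2 * (1 / (1 + \<bar>real_of_int k\<bar>)\<^sup>2))"
      proof (rule sum_mono)
        fix k
        have "(1 + \<bar>real_of_int k\<bar>)\<^sup>2 \<le> 2 * exp \<bar>real_of_int k\<bar>" by (rule exp_ge_square) simp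
        then show "exp (- \<bar>real_of_int k\<bar>) \<le> 2 * (1 / (1 + \<bar>real_of_int k\<bar>)\<^sup>2)"
          by (simp add: exp_minus field_simps)
      qed
      also have "\<dots> = 2 * (\<Sum>k\<in>K. 1 / (1 + \<bar>real_of_int k\<bar>)\<^sup>2)"
        by (rule sum_distrib_left[symmetric])
      also have "\<dots> \<le> 8"
        using sum_inverse_square_int[of 1 K] K by simp
      finally show "(\<Sum>k\<in>K. exp (- \<bar>real_of_int k\<bar>)) \<le> 8" .
    qed (use F in auto)
    finally show "(\<Sum>x\<in>F. exp (- l1 (x - y))) \<le> 8 ^ CARD('n)" .
  qed
qed auto

section \<open>The heat kernel as a power series\<close>

lemma summable_on_bound:
  fixes f :: "'a \<Rightarrow> real"
  assumes "g summable_on A" and "\<And>x. x \<in> A \<Longrightarrow> \<bar>f x\<bar> \<le> g x"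
  shows "f summable_on A"
  by (rule abs_summable_summable, rule Infinite_Sum.abs_summable_on_comparison_test'[OF assms(1)])
     (simp add: assms(2))

text \<open>Differentiation under the sum. By the mean value inequality \<open>B\<close> dominates
  the difference quotients, so their sum converges uniformly on the interval without
  \<open>t\<close> and the two limits can be exchanged.\<close>

lemma has_real_derivative_infsum:
  fixes g g' :: "'a \<Rightarrow> real \<Rightarrow> real"
  assumes d: "\<And>x s. s \<in> {a<..<b} \<Longrightarrow> (g x has_real_derivative g' x s) (at s)"
    and B: "\<And>x s. s \<in> {a<..<b} \<Longrightarrow> \<bar>g' x s\<bar> \<le> B x" and sB: "B summable_on UNIV"
    and sg: "\<And>s. s \<in> {a<..<b} \<Longrightarrow> (\<lambda>x. g x s) summable_on UNIV" and t: "t \<in> {a<..<b}"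
  shows "((\<lambda>s. \<Sum>\<^sub>\<infinity>x. g x s) has_real_derivative (\<Sum>\<^sub>\<infinity>x. g' x t)) (at t)"
proof -
  define Y where "Y = {a<..<b} - {t}"
  define q where "q = (\<lambda>x s. (g x s - g x t) / (s - t))"
  have Yev: "\<forall>\<^sub>F s in at t. s \<in> Y"
  proof -
    have "\<forall>\<^sub>F s in at t. s \<in> {a<..<b}" using t by (intro eventually_at_in_open') auto
    then show ?thesis using eventually_at_in_open[of UNIV t]
      by (simp add: Y_def eventually_conj_iff eventually_neq_at_within)
  qed
  have qB: "norm (q x s) \<le> B x" if "s \<in> Y" for x s
  proof -
    have "norm (g x s - g x t) \<le> B x * norm (s - t)"
    proof (rule field_differentiable_bound[of "{a<..<b}" "g x" "g' x"])
      show "(g x has_real_derivative g' x z) (at z within {a<..<b})" if "z \<in> {a<..<b}" for z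
        using d[OF that] has_field_derivative_at_within by blast
    qed (use that t B in \<open>auto simp: Y_def\<close>)
    then show ?thesis using that by (simp add: q_def Y_def field_simps)
  qed
  have g's: "(\<lambda>x. g' x t) summable_on UNIV"
    by (rule summable_on_bound[OF sB]) (rule B[OF t])
  have "((\<lambda>s. \<Sum>\<^sub>\<infinity>x. q x s) \<longlongrightarrow> (\<Sum>\<^sub>\<infinity>x. g' x t)) (at t)"
  proof (rule swap_uniform_limit')
    show "uniform_limit Y (\<lambda>X s. \<Sum>x\<in>X. q x s) (\<lambda>s. \<Sum>\<^sub>\<infinity>x. q x s) (finite_subsets_at_top UNIV)"
      using qB sB by (intro Weierstrass_m_test_general) auto
    show "((\<lambda>X. \<Sum>x\<in>X. g' x t) \<longlongrightarrow> (\<Sum>\<^sub>\<infinity>x. g' x t)) (finite_subsets_at_top UNIV)"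
      using g's by (rule infsum_tendsto)
    show "\<forall>\<^sub>F X in finite_subsets_at_top UNIV. ((\<lambda>s. \<Sum>x\<in>X. q x s) \<longlongrightarrow> (\<Sum>x\<in>X. g' x t)) (at t)"
      using d[OF t] by (intro always_eventually allI tendsto_sum) (simp add: q_def has_field_derivative_iff)
  qed (use Yev in auto)
  moreover have "\<forall>\<^sub>F s in at t. (\<Sum>\<^sub>\<infinity>x. q x s) = ((\<Sum>\<^sub>\<infinity>x. g x s) - (\<Sum>\<^sub>\<infinity>x. g x t)) / (s - t)"
    using Yev
  proof eventually_elim
    case (elim s)
    then have s: "(\<lambda>x. g x s) summable_on UNIV" using sg[of s] by (simp add: Y_def)
    have "(\<lambda>x. - g x t) summable_on UNIV" using sg[OF t] by (simp add: summable_on_uminus)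
    then have "(\<Sum>\<^sub>\<infinity>x. g x s + - g x t) = (\<Sum>\<^sub>\<infinity>x. g x s) + (\<Sum>\<^sub>\<infinity>x. - g x t)"
      by (rule infsum_add[OF s])
    moreover have "(\<Sum>\<^sub>\<infinity>x. q x s) = (\<Sum>\<^sub>\<infinity>x. g x s + - g x t) * inverse (s - t)"
      unfolding q_def divide_inverse diff_conv_add_uminus by (rule infsum_cmult_left')
    ultimately show ?case by (simp add: infsum_uminus divide_inverse)
  qed
  ultimately show ?thesis
    unfolding has_field_derivative_iff by (rule Lim_transform_eventually)
qed

text \<open>Two real constants replace the extended-real infimum and supremum of the theorem. The
  constants in the estimates below depend on \<open>w\<close> only through \<open>c\<close> and
  \<open>M\<close>, never on base points.\<close>

locale lattice =
  fixes w :: "int ^ 'n::finite \<Rightarrow> int ^ 'n \<Rightarrow> real" and c M :: real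
  assumes w_sym: "w x y = w y x" and c_pos: "0 < c"
    and w_ge: "adj x y \<Longrightarrow> c \<le> w x y" and m_le: "vertex_measure w x \<le> M"
begin

abbreviation m where "m \<equiv> vertex_measure w"

lemma w_pos: "adj x y \<Longrightarrow> 0 < w x y"
  using w_ge c_pos by (meson less_le_trans)

lemma w_le_m: "adj x y \<Longrightarrow> w x y \<le> m x"
  unfolding vertex_measure_def
  by (rule member_le_sum) (auto simp: finite_neighbours w_pos less_imp_le)

lemma m_ge: "c \<le> m x"
  using w_ge[OF adj_axis] w_le_m[OF adj_axis] by (meson order_trans)

lemma m_pos [simp]: "0 < m x"
  using m_ge c_pos by (meson less_le_trans)

lemma m_nonneg [simp]: "0 \<le> m x"
  using m_pos less_imp_le by blast

lemma m_nonzero [simp]: "m x \<noteq> 0"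
  using m_pos[of x] by linarith

lemma M_ge: "c \<le> M"
  using m_ge m_le by (meson order_trans)

lemma M_pos: "0 < M"
  using M_ge c_pos by linarith

section \<open>The averaging operator and its exponential\<close>

definition avg :: "(int ^ 'n \<Rightarrow> real) \<Rightarrow> int ^ 'n \<Rightarrow> real" where
  "avg u x = (\<Sum>y | adj x y. w x y * u y) / m x"

lemma laplacian_avg: "laplacian w u x = avg u x - u x"
proof -
  have "(\<Sum>y | adj x y. w x y * (u y - u x)) = (\<Sum>y | adj x y. w x y * u y) - m x * u x"
    by (simp add: vertex_measure_def sum_subtractf right_diff_distrib sum_distrib_right)
  then show ?thesis by (simp add: laplacian_def avg_def diff_divide_distrib)
qed

lemma avg_const: "avg (\<lambda>_. b) x = b"
  by (simp add: avg_def vertex_measure_def sum_distrib_right[symmetric])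
     (use m_nonzero[of x] in \<open>simp add: vertex_measure_def\<close>)

lemma avg_mono:
  assumes "\<And>y. adj x y \<Longrightarrow> u y \<le> v y"
  shows "avg u x \<le> avg v x"
  unfolding avg_def using assms
  by (intro divide_right_mono sum_mono mult_left_mono) (auto simp: w_pos less_imp_le)

lemma avg_le:
  assumes "\<And>y. adj x y \<Longrightarrow> u y \<le> b"
  shows "avg u x \<le> b"
  using avg_mono[of x u "\<lambda>_. b"] assms by (simp add: avg_const)

lemma avg_ge:
  assumes "\<And>y. adj x y \<Longrightarrow> b \<le> u y"
  shows "b \<le> avg u x"
  using avg_mono[of x "\<lambda>_. b" u] assms by (simp add: avg_const)

lemma avg_sum: "avg (\<lambda>x. \<Sum>i\<in>I. a i * u i x) x = (\<Sum>i\<in>I. a i * avg (u i) x)"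
proof -
  have "(\<Sum>y | adj x y. w x y * (\<Sum>i\<in>I. a i * u i y)) = (\<Sum>i\<in>I. a i * (\<Sum>y | adj x y. w x y * u i y))"
    unfolding sum_distrib_left by (subst sum.swap) (simp add: mult_ac)
  then have "avg (\<lambda>x. \<Sum>i\<in>I. a i * u i x) x = (\<Sum>i\<in>I. a i * (\<Sum>y | adj x y. w x y * u i y)) / m x"
    by (simp only: avg_def)
  also have "\<dots> = (\<Sum>i\<in>I. a i * avg (u i) x)"
    unfolding avg_def sum_divide_distrib[of _ I] by simp
  finally show ?thesis .
qed

text \<open>\<open>walk k y x\<close> is the probability that the walk with one-step probabilities
  \<open>w x z / m x\<close>, started at \<open>x\<close>, is at \<open>y\<close> after
  \<open>k\<close> steps. The target comes first because the operators act on the starting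
  point.\<close>

definition walk :: "nat \<Rightarrow> int ^ 'n \<Rightarrow> int ^ 'n \<Rightarrow> real" where
  "walk k y = (avg ^^ k) (indicator {y})"

lemma walk_0: "walk 0 y x = indicator {y} x"
  by (simp add: walk_def)

lemma walk_Suc: "walk (Suc k) y x = avg (walk k y) x"
  by (simp add: walk_def)

lemma walk_nonneg: "0 \<le> walk k y x"
  by (induction k arbitrary: x) (auto simp: walk_0 walk_Suc intro: avg_ge)

text \<open>A crude form of finite propagation speed: each step moves by one and costs a factor e.
  The exponential is a form that survives averaging over neighbours.\<close>

lemma walk_le: "walk k y x \<le> exp (real k - l1 (x - y))"
proof (induction k arbitrary: x)
  case 0
  show ?case by (cases "x = y") (auto simp: walk_0)
next
  case (Suc k)
  show ?case unfolding walk_Suc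
  proof (rule avg_le)
    fix z assume "adj x z"
    then have "l1 (x - y) \<le> l1 (z - y) + 1" using l1_neighbour adj_commute by blast
    then have "exp (real k - l1 (z - y)) \<le> exp (real (Suc k) - l1 (x - y))" by simp
    then show "walk k y z \<le> exp (real (Suc k) - l1 (x - y))" using Suc[of z] by linarith
  qed
qed

lemma walk_pos: "(x, y) \<in> {(a, b). adj a b} ^^ k \<Longrightarrow> 0 < walk k y x"
proof (induction k arbitrary: x)
  case 0
  then show ?case by (simp add: walk_0)
next
  case (Suc k)
  obtain z where z: "adj x z" "(z, y) \<in> {(a, b). adj a b} ^^ k"
    using relpow_Suc_D2[OF Suc.prems] by auto
  have "0 < (\<Sum>z | adj x z. w x z * walk k y z)"
  proof (rule sum_pos2)
    show "0 < w x z * walk k y z" using Suc.IH[OF z(2)] z(1) w_pos by simp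
  qed (use z finite_neighbours w_pos walk_nonneg in \<open>auto intro!: mult_nonneg_nonneg less_imp_le[OF w_pos]\<close>)
  then show ?case by (simp add: walk_Suc avg_def)
qed

text \<open>The kernel of e^(tP). Its series has nonnegative terms for t >= 0, unlike that of
  e^(t(P-1)), so positivity can be read off before the factor e^(-t) is attached in
  \<open>p\<close>.\<close>

definition exp_avg :: "real \<Rightarrow> int ^ 'n \<Rightarrow> int ^ 'n \<Rightarrow> real" where
  "exp_avg t y x = (\<Sum>k. walk k y x / fact k * t ^ k)"

lemma exp_avg_term_le: "norm (walk k y x / fact k * t ^ k) \<le> exp (- l1 (x - y)) * ((exp 1 * \<bar>t\<bar>) ^ k /\<^sub>R fact k)"
proof -
  have "walk k y x \<le> exp (- l1 (x - y)) * exp 1 ^ k"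
  proof -
    have "exp (real k - l1 (x - y)) = exp (- l1 (x - y)) * exp (real k * 1)"
      by (simp only: exp_add[symmetric]) simp
    also have "exp (real k * 1) = exp 1 ^ k" by (rule exp_of_nat_mult)
    finally show ?thesis using walk_le[of k y x] by simp
  qed
  then have "walk k y x * (\<bar>t\<bar> ^ k / fact k) \<le> exp (- l1 (x - y)) * exp 1 ^ k * (\<bar>t\<bar> ^ k / fact k)"
    by (rule mult_right_mono) simp
  moreover have "norm (walk k y x / fact k * t ^ k) = walk k y x * (\<bar>t\<bar> ^ k / fact k)"
    unfolding real_norm_def abs_mult abs_divide power_abs by (simp add: walk_nonneg)
  moreover have "exp (- l1 (x - y)) * ((exp 1 * \<bar>t\<bar>) ^ k /\<^sub>R fact k) = exp (- l1 (x - y)) * exp 1 ^ k * (\<bar>t\<bar> ^ k / fact k)"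
    by (simp add: power_mult_distrib field_simps)
  ultimately show ?thesis by (simp only:)
qed

lemma summable_exp_avg: "summable (\<lambda>k. norm (walk k y x / fact k * t ^ k))"
proof (rule summable_comparison_test')
  show "summable (\<lambda>k. exp (- l1 (x - y)) * ((exp 1 * \<bar>t\<bar>) ^ k /\<^sub>R fact k))"
    by (intro summable_mult summable_exp_generic)
qed (use exp_avg_term_le in simp)

lemma exp_avg_sums: "(\<lambda>k. walk k y x / fact k * t ^ k) sums exp_avg t y x"
  unfolding exp_avg_def using summable_norm_cancel[OF summable_exp_avg] by (rule summable_sums)

lemma exp_avg_bound: "\<bar>exp_avg t y x\<bar> \<le> exp (3 * \<bar>t\<bar>) * exp (- l1 (x - y))"
proof -
  let ?g = "\<lambda>k. exp (- l1 (x - y)) * ((exp 1 * \<bar>t\<bar>) ^ k /\<^sub>R fact k)"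
  have g: "?g sums (exp (- l1 (x - y)) * exp (exp 1 * \<bar>t\<bar>))"
    by (rule sums_mult) (rule exp_converges)
  have "norm (exp_avg t y x) \<le> (\<Sum>k. norm (walk k y x / fact k * t ^ k))"
    unfolding exp_avg_def by (rule summable_norm[OF summable_exp_avg])
  also have "\<dots> \<le> suminf ?g"
    by (rule suminf_le[OF exp_avg_term_le summable_exp_avg sums_summable[OF g]])
  also have "\<dots> = exp (- l1 (x - y)) * exp (exp 1 * \<bar>t\<bar>)" using sums_unique[OF g] by (rule sym)
  also have "exp (exp 1 * \<bar>t\<bar>) \<le> exp (3 * \<bar>t\<bar>)"
    using exp_le by (simp add: mult_right_mono)
  finally show ?thesis by (simp add: mult.commute)
qed

text \<open>Differentiating the power series shifts its coefficients by one, and this shift is an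
  application of \<open>avg\<close>.\<close>

lemma exp_avg_deriv: "((\<lambda>t. exp_avg t y x) has_real_derivative avg (exp_avg t y) x) (at t)"
proof -
  let ?c = "\<lambda>k. walk k y x / fact k"
  have "((\<lambda>t. \<Sum>k. ?c k * t ^ k) has_real_derivative (\<Sum>k. diffs ?c k * t ^ k)) (at t)"
    by (rule termdiffs_strong_converges_everywhere) (rule summable_norm_cancel[OF summable_exp_avg])
  moreover have "(\<Sum>k. diffs ?c k * t ^ k) = avg (exp_avg t y) x"
  proof -
    have "(\<lambda>k. \<Sum>z | adj x z. w x z / m x * (walk k y z / fact k * t ^ k))
        sums (\<Sum>z | adj x z. w x z / m x * exp_avg t y z)"
      by (intro sums_sum sums_mult exp_avg_sums)
    moreover have "(\<Sum>z | adj x z. w x z / m x * exp_avg t y z) = avg (exp_avg t y) x"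
      by (simp add: avg_def sum_divide_distrib)
    moreover have "(\<Sum>z | adj x z. w x z / m x * (walk k y z / fact k * t ^ k)) = diffs ?c k * t ^ k" for k
    proof -
      have "diffs ?c k = walk (Suc k) y x / fact k"
        by (simp add: diffs_def del: of_nat_Suc)
      then have "diffs ?c k * t ^ k = (\<Sum>z | adj x z. w x z * walk k y z) * (t ^ k / (fact k * m x))"
        by (simp add: walk_Suc avg_def)
      also have "\<dots> = (\<Sum>z | adj x z. w x z / m x * (walk k y z / fact k * t ^ k))"
        unfolding sum_distrib_right by (rule sum.cong) (auto simp: mult.commute)
      finally show ?thesis by simp
    qed
    ultimately show ?thesis by (simp add: sums_iff)
  qed
  ultimately show ?thesis by (simp add: exp_avg_def)
qed

section \<open>The kernel \<open>p\<close> and its agreement with the heat kernel\<close>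

definition p :: "real \<Rightarrow> int ^ 'n \<Rightarrow> int ^ 'n \<Rightarrow> real" where
  "p t x y = exp (- t) * exp_avg t y x / m y"

lemma p_0: "p 0 x y = indicator {y} x / m y"
proof -
  have "exp_avg 0 y x = walk 0 y x"
    using powser_zero[of "\<lambda>k. walk k y x / fact k"] by (simp add: exp_avg_def)
  then show ?thesis by (simp add: p_def walk_0)
qed

lemma p_nonneg:
  assumes "t \<ge> 0" shows "0 \<le> p t x y"
  unfolding p_def exp_avg_def using assms summable_norm_cancel[OF summable_exp_avg]
  by (intro divide_nonneg_nonneg mult_nonneg_nonneg suminf_nonneg) (auto simp: walk_nonneg)

lemma p_pos:
  assumes "t > 0" shows "0 < p t x y"
proof -
  obtain k where "l1 (x - y) = real k" using l1_nat by blast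
  then have "0 < walk k y x" by (intro walk_pos path_exists)
  then have "0 < exp_avg t y x"
    unfolding exp_avg_def using assms summable_norm_cancel[OF summable_exp_avg]
    by (intro suminf_pos2[where i = k]) (auto simp: walk_nonneg)
  then show ?thesis by (simp add: p_def)
qed

lemma p_deriv: "((\<lambda>t. p t x y) has_real_derivative laplacian w (\<lambda>x. p t x y) x) (at t)"
proof -
  have "((\<lambda>t. exp (- t) * exp_avg t y x / m y) has_real_derivative
      (exp (- t) * (- 1) * exp_avg t y x + avg (exp_avg t y) x * exp (- t)) / m y) (at t)"
    by (auto intro!: DERIV_cdivide derivative_eq_intros exp_avg_deriv simp: algebra_simps)
  moreover have "avg (\<lambda>x. p t x y) x = exp (- t) * avg (exp_avg t y) x / m y"
    by (simp add: avg_def p_def sum_distrib_left sum_divide_distrib mult_ac)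
  ultimately show ?thesis
    by (simp add: p_def[abs_def] laplacian_avg diff_divide_distrib algebra_simps)
qed

text \<open>The absolute values matter: negative times are covered as well, so that later
  derivatives can be taken on open intervals around 0. Of the 4, one comes from e^(-t) and three
  bound e.\<close>

lemma p_bound: "\<bar>p t x y\<bar> \<le> exp (4 * \<bar>t\<bar>) / c * exp (- l1 (x - y))"
proof -
  have "\<bar>p t x y\<bar> = exp (- t) * \<bar>exp_avg t y x\<bar> / m y" by (simp add: p_def abs_mult)
  also have "\<dots> \<le> exp \<bar>t\<bar> * (exp (3 * \<bar>t\<bar>) * exp (- l1 (x - y))) / c"
    using exp_avg_bound m_ge c_pos by (intro frac_le mult_mono) auto
  also have "\<dots> = exp (4 * \<bar>t\<bar>) / c * exp (- l1 (x - y))"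
    by (simp add: mult_exp_exp)
  finally show ?thesis .
qed

text \<open>Passing to a neighbour costs at most e <= 3; the fourth unit is the diagonal term of the
  Laplacian.\<close>

lemma laplacian_exp_bound:
  assumes u: "\<And>x. \<bar>u x\<bar> \<le> K * exp (- l1 (x - y))"
  shows "\<bar>laplacian w u x\<bar> \<le> 4 * K * exp (- l1 (x - y))"
proof -
  have K: "K \<ge> 0" using u[of y] by simp
  have "\<bar>u z\<bar> \<le> 3 * K * exp (- l1 (x - y))" if "adj x z" for z
  proof -
    have "l1 (x - y) \<le> l1 (z - y) + 1" using l1_neighbour that adj_commute by blast
    then have "exp (- l1 (z - y)) \<le> exp (1 - l1 (x - y))" by simp
    also have "\<dots> = exp 1 * exp (- l1 (x - y))" by (simp add: exp_diff exp_minus divide_inverse)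
    also have "\<dots> \<le> 3 * exp (- l1 (x - y))" using exp_le by (intro mult_right_mono) auto
    finally have "K * exp (- l1 (z - y)) \<le> K * (3 * exp (- l1 (x - y)))" using K by (rule mult_left_mono)
    then show ?thesis using u[of z] by simp
  qed
  then have b: "u z \<le> 3 * K * exp (- l1 (x - y))" "- (3 * K * exp (- l1 (x - y))) \<le> u z" if "adj x z" for z
    using that by (fastforce simp: abs_le_iff)+
  have "avg u x \<le> 3 * K * exp (- l1 (x - y))" by (rule avg_le) (rule b)
  moreover have "- (3 * K * exp (- l1 (x - y))) \<le> avg u x" by (rule avg_ge) (rule b)
  ultimately
  show ?thesis unfolding laplacian_avg using u[of x] by linarith
qed

text \<open>The binomial theorem for P - 1; it lets the series of the Laplacian be compared with
  that of e^(tP).\<close>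

lemma laplacian_pow_binomial:
  "(laplacian w ^^ k) u x = (\<Sum>i\<le>k. real (k choose i) * (- 1) ^ (k - i) * (avg ^^ i) u x)"
proof (induction k arbitrary: x)
  case (Suc k)
  let ?b = "\<lambda>k i. real (k choose i) * (- 1) ^ (k - i)"
  let ?W = "\<lambda>i. (avg ^^ i) u x"
  have "(laplacian w ^^ Suc k) u x
      = avg (\<lambda>x. \<Sum>i\<le>k. ?b k i * (avg ^^ i) u x) x - (\<Sum>i\<le>k. ?b k i * ?W i)"
    using Suc.IH by (simp add: laplacian_avg[abs_def]) presburger
  also have "\<dots> = (\<Sum>i\<le>k. ?b k i * ?W (Suc i)) - (\<Sum>i\<le>k. ?b k i * ?W i)"
    by (simp add: avg_sum)
  also have "(\<Sum>i\<le>k. ?b k i * ?W i) = (\<Sum>i\<le>Suc k. ?b k i * ?W i)"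
    by simp
  also have "\<dots> = ?b k 0 * ?W 0 + (\<Sum>i\<le>k. ?b k (Suc i) * ?W (Suc i))"
    by (rule sum.atMost_Suc_shift)
  also have "(\<Sum>i\<le>k. ?b k i * ?W (Suc i)) - (?b k 0 * ?W 0 + (\<Sum>i\<le>k. ?b k (Suc i) * ?W (Suc i)))
      = ?b (Suc k) 0 * ?W 0 + (\<Sum>i\<le>k. ?b (Suc k) (Suc i) * ?W (Suc i))"
  proof -
    have "?b (Suc k) (Suc i) = ?b k i - ?b k (Suc i)" if "i \<le> k" for i
    proof (cases "i = k")
      case False
      then have "k - i = Suc (k - Suc i)" using that by simp
      then show ?thesis by (simp add: algebra_simps)
    qed simp
    then show ?thesis by (simp add: sum_subtractf[symmetric] left_diff_distrib)
  qed
  also have "\<dots> = (\<Sum>i\<le>Suc k. ?b (Suc k) i * ?W i)"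
    by (rule sum.atMost_Suc_shift[symmetric])
  finally show ?case .
qed simp

text \<open>Cauchy product of the series of e^(tP) and e^(-t); the terms of total degree k assemble
  to (P - 1)^k.\<close>

lemma laplacian_series: "(\<lambda>k. t ^ k * (laplacian w ^^ k) (indicator {y}) x / fact k) sums (exp (- t) * exp_avg t y x)"
proof -
  let ?a = "\<lambda>k. walk k y x / fact k * t ^ k" and ?b = "\<lambda>k. (- t) ^ k /\<^sub>R fact k"
  have "(\<lambda>k. \<Sum>i\<le>k. ?a i * ?b (k - i)) sums (suminf ?a * suminf ?b)"
    using summable_exp_avg summable_norm_exp[of "- t"] by (intro Cauchy_product_sums) auto
  moreover have "suminf ?b = exp (- t)" by (simp add: exp_def)
  moreover have "(\<Sum>i\<le>k. ?a i * ?b (k - i)) = t ^ k * (laplacian w ^^ k) (indicator {y}) x / fact k" for k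
  proof -
    have "?a i * ?b (k - i) = t ^ k / fact k * (real (k choose i) * (- 1) ^ (k - i) * walk i y x)"
      if "i \<le> k" for i
    proof -
      have "(- t) ^ (k - i) = (- 1) ^ (k - i) * t ^ (k - i)" by (rule power_minus)
      moreover have "t ^ k = t ^ i * t ^ (k - i)" using that by (simp add: power_add[symmetric])
      moreover have "real (k choose i) = fact k / (fact i * fact (k - i))"
        using that by (rule binomial_fact)
      ultimately show ?thesis by (simp add: field_simps)
    qed
    then have "(\<Sum>i\<le>k. ?a i * ?b (k - i)) = (\<Sum>i\<le>k. t ^ k / fact k * (real (k choose i) * (- 1) ^ (k - i) * walk i y x))"
      by (intro sum.cong) auto
    then show ?thesis
      unfolding laplacian_pow_binomial walk_def[symmetric] sum_distrib_left[symmetric] by simp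
  qed
  ultimately show ?thesis by (simp add: exp_avg_def mult.commute)
qed

lemma scaled_laplacian_pow: "((\<lambda>u x. t * laplacian w u x) ^^ k) u x = t ^ k * (laplacian w ^^ k) u x"
proof (induction k arbitrary: x)
  case (Suc k)
  have "((\<lambda>u x. t * laplacian w u x) ^^ k) u = (\<lambda>x. t ^ k * (laplacian w ^^ k) u x)"
    using Suc by blast
  moreover have "laplacian w (\<lambda>x. b * v x) x = b * laplacian w v x" for b v x
    by (simp add: laplacian_def right_diff_distrib[symmetric] sum_distrib_left mult_ac)
  ultimately show ?case by (simp add: mult.assoc)
qed simp

text \<open>The exponential is defined as a limit in the norm of \<open>l2_space m\<close>. That
  norm controls point values, so the limit is also the pointwise sum of the series, which
  \<open>laplacian_series\<close> evaluates.\<close>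

lemma heat_kernel_eq_p: "heat_kernel w t x y = p t x y"
proof -
  let ?u = "indicator {y} :: int ^ 'n \<Rightarrow> real" and ?A = "\<lambda>u x. t * laplacian w u x"
  have u: "?u \<in> l2_space m"
  proof (rule l2_finite_bound(1)[of m "sqrt (m y)"])
    show "(\<Sum>x\<in>F. (indicator {y} x)\<^sup>2 * m x) \<le> (sqrt (m y))\<^sup>2" if "finite F" for F
    proof -
      have "(\<Sum>x\<in>F. (indicator {y} x)\<^sup>2 * m x) = (\<Sum>x\<in>F. if x = y then m y else 0)"
        by (rule sum.cong) auto
      then show ?thesis using that by simp
    qed
  qed auto
  have A: "?A u \<in> l2_space m \<and> l2_norm m (?A u) \<le> 2 * \<bar>t\<bar> * l2_norm m u" if "u \<in> l2_space m" for u
  proof -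
    note L = laplacian_bounded[OF w_sym w_pos m_pos that]
    have 1: "(t * laplacian w u x)\<^sup>2 * m x = t\<^sup>2 * ((laplacian w u x)\<^sup>2 * m x)" for x
      by (simp add: power_mult_distrib)
    have "?A u \<in> l2_space m"
      using L(1) by (simp add: l2_space_def 1 summable_on_cmult_right)
    moreover have "l2_norm m (?A u) = \<bar>t\<bar> * l2_norm m (laplacian w u)"
      by (simp add: l2_norm_def 1 infsum_cmult_right' real_sqrt_mult)
    moreover have "\<bar>t\<bar> * l2_norm m (laplacian w u) \<le> \<bar>t\<bar> * (2 * l2_norm m u)"
      using L(2) by (intro mult_left_mono) auto
    ultimately show ?thesis by simp
  qed
  define v where "v = l2_exp m ?A ?u"
  define S where "S = (\<lambda>n x. \<Sum>k<n. (?A ^^ k) ?u x / fact k)"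
  have v: "v \<in> l2_space m \<and> (\<lambda>n. l2_norm m (\<lambda>x. v x - S n x)) \<longlonglongrightarrow> 0"
    unfolding v_def l2_exp_def S_def
    by (rule theI'[OF l2_exp_ex1[of m ?u "2 * \<bar>t\<bar>"]]) (use u A in auto)
  have Ak: "(?A ^^ k) ?u \<in> l2_space m" for k
    by (induction k) (use u A in auto)
  have Sl: "S n \<in> l2_space m" for n
  proof (induction n)
    case 0
    then show ?case by (simp add: S_def l2_space_def)
  next
    case (Suc n)
    have "(\<lambda>x. - (?A ^^ n) ?u x / fact n) \<in> l2_space m"
      using Ak[of n] summable_on_cmult_right[of "\<lambda>x. ((?A ^^ n) ?u x)\<^sup>2 * m x" UNIV "1 / (fact n)\<^sup>2"]
      by (simp add: l2_space_def power_divide)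
    from l2_diff(1)[OF m_pos Suc this] show ?case by (simp add: S_def)
  qed
  have "(\<lambda>n. v x - S n x) \<longlonglongrightarrow> 0"
  proof (rule Lim_null_comparison)
    show "\<forall>\<^sub>F n in sequentially. norm (v x - S n x) \<le> l2_norm m (\<lambda>x. v x - S n x) / sqrt (m x)"
      using l2_point[OF m_pos l2_diff(1)[OF m_pos conjunct1[OF v] Sl]] by simp
    show "(\<lambda>n. l2_norm m (\<lambda>x. v x - S n x) / sqrt (m x)) \<longlonglongrightarrow> 0"
      using tendsto_divide[OF conjunct2[OF v] tendsto_const, of "sqrt (m x)"] m_pos[of x] by simp
  qed
  moreover have "(\<lambda>n. v x - S n x) \<longlonglongrightarrow> v x - exp (- t) * exp_avg t y x"
    using laplacian_series[of t y x]
    by (intro tendsto_diff tendsto_const) (simp add: S_def scaled_laplacian_pow sums_def)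
  ultimately have "v x = exp (- t) * exp_avg t y x" using LIMSEQ_unique by fastforce
  then show ?thesis by (simp add: heat_kernel_def heat_semigroup_def v_def p_def)
qed

end

section \<open>Summation by parts and the semigroup property\<close>

lemma infsum_indicator_single:
  fixes f :: "'a \<Rightarrow> real"
  shows "(\<Sum>\<^sub>\<infinity>x. indicator {y} x * f x) = f y"
proof -
  have "(\<Sum>\<^sub>\<infinity>x. indicator {y} x * f x) = (\<Sum>\<^sub>\<infinity>x\<in>{y}. indicator {y} x * f x)"
    by (rule infsum_cong_neutral) auto
  then show ?thesis by simp
qed

lemma summable_on_imp_bounded:
  fixes f :: "'a \<Rightarrow> real"
  assumes "f summable_on UNIV"
  obtains B where "\<And>x. \<bar>f x\<bar> \<le> B"
proof
  have s: "(\<lambda>x. \<bar>f x\<bar>) summable_on UNIV"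
    using assms summable_on_iff_abs_summable_on_real[of f UNIV] by simp
  show "\<bar>f x\<bar> \<le> (\<Sum>\<^sub>\<infinity>x. \<bar>f x\<bar>)" for x
    using finite_sum_le_infsum[OF s, of "{x}"] by simp
qed

lemma summable_on_abs:
  fixes f :: "'a \<Rightarrow> real"
  shows "f summable_on A \<Longrightarrow> (\<lambda>x. \<bar>f x\<bar>) summable_on A"
  using summable_on_iff_abs_summable_on_real[of f A] by simp

context lattice begin

text \<open>Oriented edges: every undirected edge occurs in both directions. This is the origin of
  the factor 1/2 in summation by parts and makes reversal of edges available as a bijection.\<close>

definition edges :: "((int ^ 'n) \<times> (int ^ 'n)) set" where
  "edges = Sigma UNIV (\<lambda>x. {y. adj x y})"

lemma edges_swap: "bij_betw prod.swap edges edges"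
  by (rule bij_betwI[of _ _ _ prod.swap]) (auto simp: edges_def adj_commute)

lemma edge_infsum_swap: "(\<Sum>\<^sub>\<infinity>(x, y)\<in>edges. h y x) = (\<Sum>\<^sub>\<infinity>(x, y)\<in>edges. h x y)"
  using infsum_reindex_bij_betw[OF edges_swap, of "\<lambda>(x, y). h x y"]
  by (simp add: prod.swap_def case_prod_unfold)

lemma edge_summable_swap: "(\<lambda>(x, y). h y x) summable_on edges \<longleftrightarrow> (\<lambda>(x, y). h x y) summable_on edges"
  using summable_on_reindex_bij_betw[OF edges_swap, of "\<lambda>(x, y). h x y"]
  by (simp add: prod.swap_def case_prod_unfold)

lemma edge_infsum:
  fixes h :: "int ^ 'n \<Rightarrow> int ^ 'n \<Rightarrow> real"
  assumes "(\<lambda>(x, y). h x y) summable_on edges"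
  shows "((\<lambda>x. \<Sum>y | adj x y. h x y) has_sum (\<Sum>\<^sub>\<infinity>(x, y)\<in>edges. h x y)) UNIV"
  using infsum_Sigma'_banach[of h UNIV "\<lambda>x. {y. adj x y}"]
    summable_on_Sigma_banach[of h UNIV "\<lambda>x. {y. adj x y}"] assms
  by (simp add: edges_def finite_neighbours has_sum_iff)

lemma edge_summable:
  assumes a: "a summable_on UNIV"
  shows "(\<lambda>(x, y). w x y * a x) summable_on edges"
proof -
  have "(\<lambda>(x, y). w x y * \<bar>a x\<bar>) summable_on edges"
    unfolding edges_def
  proof (rule summable_on_SigmaI)
    show "((\<lambda>y. case (x, y) of (x, y) \<Rightarrow> w x y * \<bar>a x\<bar>) has_sum m x * \<bar>a x\<bar>) {y. adj x y}" for x
      by (rule has_sum_finiteI) (simp_all add: finite_neighbours vertex_measure_def sum_distrib_right)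
    show "(\<lambda>x. m x * \<bar>a x\<bar>) summable_on UNIV"
      by (rule summable_on_bound[OF summable_on_cmult_right[OF summable_on_abs[OF a], of M]])
         (simp add: abs_mult m_le mult_right_mono)
  qed (auto simp: w_pos less_imp_le)
  then show ?thesis
    by (rule summable_on_bound) (auto simp: edges_def abs_mult w_pos less_imp_le)
qed

lemma edge_summable':
  assumes a: "a summable_on UNIV"
  shows "(\<lambda>(x, y). w x y * a y) summable_on edges"
  using edge_summable[OF a] edge_summable_swap[of "\<lambda>x y. w x y * a y"] w_sym by simp

lemma edge_infsum_vertex:
  assumes a: "a summable_on UNIV"
  shows "(\<Sum>\<^sub>\<infinity>(x, y)\<in>edges. w x y * a x) = (\<Sum>\<^sub>\<infinity>x. m x * a x)"
  using infsumI[OF edge_infsum[OF edge_summable[OF a]]]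
  by (simp add: vertex_measure_def sum_distrib_right)

text \<open>Reversing the edges shows that w (f y - f x) g x has the same sum as its mirror image,
  and the two add up to minus the symmetric expression. Boundedness of \<open>g\<close> suffices for
  absolute convergence; this admits both the constant 1, for the mass, and growing weights
  multiplied by the kernel.\<close>

lemma summation_by_parts:
  fixes f g :: "int ^ 'n \<Rightarrow> real"
  assumes f: "f summable_on UNIV" and g: "\<And>x. \<bar>g x\<bar> \<le> B"
  shows "(\<lambda>(x, y). w x y * (f y - f x) * (g y - g x)) summable_on edges"
    and "((\<lambda>x. laplacian w f x * g x * m x) has_sum
       - ((\<Sum>\<^sub>\<infinity>(x, y)\<in>edges. w x y * (f y - f x) * (g y - g x)) / 2)) UNIV"
proof -
  let ?h = "\<lambda>x y. w x y * (f y - f x) * g x"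
  let ?k = "\<lambda>x y. w x y * (f y - f x) * (g y - g x)"
  have s0: "(\<lambda>(x, y). B * (w x y * \<bar>f y\<bar> + w x y * \<bar>f x\<bar>)) summable_on edges"
    using edge_summable[OF summable_on_abs[OF f]] edge_summable'[OF summable_on_abs[OF f]]
    by (simp add: case_prod_unfold summable_on_cmult_right summable_on_add)
  have s: "(\<lambda>(x, y). ?h x y) summable_on edges"
  proof (rule summable_on_bound[OF s0], clarify)
    fix x y assume "(x, y) \<in> edges"
    then have w: "0 \<le> w x y" by (simp add: edges_def w_pos less_imp_le)
    have "\<bar>w x y * (f y - f x)\<bar> * \<bar>g x\<bar> \<le> (w x y * \<bar>f y\<bar> + w x y * \<bar>f x\<bar>) * B"
    proof (rule mult_mono)
      have "w x y * \<bar>f y - f x\<bar> \<le> w x y * (\<bar>f y\<bar> + \<bar>f x\<bar>)" using w by (intro mult_left_mono) auto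
      then show "\<bar>w x y * (f y - f x)\<bar> \<le> w x y * \<bar>f y\<bar> + w x y * \<bar>f x\<bar>"
        using w by (simp add: abs_mult distrib_left)
    qed (use g w in auto)
    then show "\<bar>?h x y\<bar> \<le> B * (w x y * \<bar>f y\<bar> + w x y * \<bar>f x\<bar>)" by (simp add: abs_mult mult_ac)
  qed
  have s': "(\<lambda>(x, y). ?h y x) summable_on edges" using s edge_summable_swap[of ?h] by simp
  have k: "?k x y = - (?h x y + ?h y x)" for x y
    by (simp add: w_sym[of y x] algebra_simps)
  have ss: "(\<lambda>(x, y). ?h x y + ?h y x) summable_on edges"
    using summable_on_add[OF s s'] by (simp add: case_prod_unfold)
  show "(\<lambda>(x, y). ?k x y) summable_on edges"
    using ss by (simp only: k case_prod_unfold summable_on_uminus)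
  have "(\<Sum>\<^sub>\<infinity>(x, y)\<in>edges. ?h x y + ?h y x) = (\<Sum>\<^sub>\<infinity>(x, y)\<in>edges. ?h x y) + (\<Sum>\<^sub>\<infinity>(x, y)\<in>edges. ?h y x)"
    using infsum_add[OF s s'] by (simp add: case_prod_unfold)
  also have "(\<Sum>\<^sub>\<infinity>(x, y)\<in>edges. ?h y x) = (\<Sum>\<^sub>\<infinity>(x, y)\<in>edges. ?h x y)"
    by (rule edge_infsum_swap)
  finally have "(\<Sum>\<^sub>\<infinity>(x, y)\<in>edges. ?h x y) = - ((\<Sum>\<^sub>\<infinity>(x, y)\<in>edges. ?k x y) / 2)"
    by (simp only: k case_prod_unfold infsum_uminus) simp
  moreover have "(\<Sum>y | adj x y. ?h x y) = laplacian w f x * g x * m x" for x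
    by (simp add: laplacian_def sum_distrib_right[symmetric])
  ultimately show "((\<lambda>x. laplacian w f x * g x * m x) has_sum - ((\<Sum>\<^sub>\<infinity>(x, y)\<in>edges. ?k x y) / 2)) UNIV"
    using edge_infsum[OF s] by simp
qed

lemma laplacian_self_adjoint:
  assumes f: "f summable_on UNIV" and g: "g summable_on UNIV"
  shows "((\<lambda>x. laplacian w f x * g x * m x - f x * laplacian w g x * m x) has_sum 0) UNIV"
proof -
  obtain A B where A: "\<And>x. \<bar>f x\<bar> \<le> A" and B: "\<And>x. \<bar>g x\<bar> \<le> B"
    using summable_on_imp_bounded f g by meson
  have "(\<Sum>\<^sub>\<infinity>(x, y)\<in>edges. w x y * (f y - f x) * (g y - g x)) = (\<Sum>\<^sub>\<infinity>(x, y)\<in>edges. w x y * (g y - g x) * (f y - f x))"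
    by (simp add: mult_ac)
  then show ?thesis
    using has_sum_add[OF summation_by_parts(2)[OF f, of g B, OF B] has_sum_uminus[THEN iffD2, OF summation_by_parts(2)[OF g, of f A, OF A]]]
    by (simp add: mult_ac)
qed

lemma laplacian_sum_zero:
  assumes f: "f summable_on UNIV"
  shows "((\<lambda>x. laplacian w f x * m x) has_sum 0) UNIV"
  using summation_by_parts(2)[OF f, of "\<lambda>_. 1" 1] by (simp add: case_prod_unfold)

section \<open>Majorants on bounded time intervals, conservation of mass and the semigroup
  law\<close>

definition bnd :: "real \<Rightarrow> real" where "bnd T = exp (4 * T) / c"

lemma bnd_pos: "0 < bnd T"
  using c_pos by (simp add: bnd_def)

lemma p_bnd:
  assumes "\<bar>s\<bar> \<le> T"
  shows "\<bar>p s z x\<bar> \<le> bnd T * exp (- l1 (z - x))"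
proof -
  have "exp (4 * \<bar>s\<bar>) / c * exp (- l1 (z - x)) \<le> bnd T * exp (- l1 (z - x))"
    unfolding bnd_def using assms c_pos by (intro mult_right_mono divide_right_mono) auto
  then show ?thesis using p_bound[of s z x] by linarith
qed

lemma p_deriv_bnd:
  assumes "\<bar>s\<bar> \<le> T"
  shows "\<bar>laplacian w (\<lambda>z. p s z x) z\<bar> \<le> 4 * bnd T * exp (- l1 (z - x))"
  by (rule laplacian_exp_bound) (rule p_bnd[OF assms])

lemma exp_l1_le_1: "0 \<le> b \<Longrightarrow> b * exp (- l1 v) \<le> b"
  using mult_left_mono[of "exp (- l1 v)" 1 b] by simp

lemma p_bnd':
  assumes "\<bar>s\<bar> \<le> T"
  shows "\<bar>p s z x\<bar> \<le> bnd T"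
  using p_bnd[OF assms] exp_l1_le_1[of "bnd T"] bnd_pos[of T] by (meson less_imp_le order_trans)

lemma p_deriv_bnd':
  assumes "\<bar>s\<bar> \<le> T"
  shows "\<bar>laplacian w (\<lambda>z. p s z x) z\<bar> \<le> 4 * bnd T"
proof -
  have "4 * bnd T * exp (- l1 (z - x)) \<le> 4 * bnd T"
    by (rule exp_l1_le_1) (use bnd_pos[of T] in simp)
  then show ?thesis using p_deriv_bnd[OF assms, of x z] by linarith
qed

lemma p_summable: "(\<lambda>z. p s z x) summable_on UNIV"
  by (rule summable_on_bound[OF summable_on_cmult_right[OF summable_exp_l1[of x], of "bnd \<bar>s\<bar>"]])
     (rule p_bnd, simp)

lemma p_prod_summable: "(\<lambda>z. p s z x * p t z y * m z) summable_on UNIV"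
proof (rule summable_on_bound[OF summable_on_cmult_right[OF summable_exp_l1[of x], of "bnd \<bar>s\<bar> * bnd \<bar>t\<bar> * M"]])
  fix z
  have "\<bar>p s z x\<bar> * \<bar>p t z y\<bar> * m z \<le> (bnd \<bar>s\<bar> * exp (- l1 (z - x))) * bnd \<bar>t\<bar> * M"
    using bnd_pos[THEN less_imp_le] m_le M_pos
    by (intro mult_mono p_bnd p_bnd' mult_nonneg_nonneg) auto
  then show "\<bar>p s z x * p t z y * m z\<bar> \<le> bnd \<bar>s\<bar> * bnd \<bar>t\<bar> * M * exp (- l1 (z - x))"
    by (simp add: abs_mult mult_ac)
qed

text \<open>The time derivative of the mass is the sum of a Laplacian, hence zero, and at time 0 the
  mass is 1. The open interval used contains both 0 and \<open>t\<close>.\<close>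

lemma p_mass: "((\<lambda>z. p t z y * m z) has_sum 1) UNIV"
proof -
  define T where "T = \<bar>t\<bar> + 1"
  have dom: "(\<lambda>z. 4 * bnd T * M * exp (- l1 (z - y))) summable_on UNIV"
    by (rule summable_on_cmult_right[OF summable_exp_l1])
  have sm: "(\<lambda>z. p s z y * m z) summable_on UNIV" for s
    by (rule summable_on_bound[OF summable_on_cmult_right[OF summable_on_abs[OF p_summable[of s y]], of M]])
       (simp add: abs_mult mult.commute[of _ "m _"] m_le mult_right_mono)
  have "((\<lambda>s. \<Sum>\<^sub>\<infinity>z. p s z y * m z) has_real_derivative (\<Sum>\<^sub>\<infinity>z. laplacian w (\<lambda>z. p s z y) z * m z)) (at s)"
    if "s \<in> {-T<..<T}" for s
  proof (rule has_real_derivative_infsum[OF _ _ dom _ that])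
    show "((\<lambda>s. p s z y * m z) has_real_derivative laplacian w (\<lambda>z. p s z y) z * m z) (at s)" for z s
      by (intro DERIV_cmult_right p_deriv)
    show "\<bar>laplacian w (\<lambda>z. p s z y) z * m z\<bar> \<le> 4 * bnd T * M * exp (- l1 (z - y))" if "s \<in> {-T<..<T}" for z s
    proof -
      have "\<bar>laplacian w (\<lambda>z. p s z y) z\<bar> * m z \<le> (4 * bnd T * exp (- l1 (z - y))) * M"
        using that bnd_pos[of T] m_le by (intro mult_mono p_deriv_bnd) auto
      then show ?thesis by (simp add: abs_mult mult_ac)
    qed
  qed (rule sm)
  then have "((\<lambda>s. \<Sum>\<^sub>\<infinity>z. p s z y * m z) has_real_derivative 0) (at s within {-T<..<T})"
    if "s \<in> {-T<..<T}" for s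
    using that infsumI[OF laplacian_sum_zero[OF p_summable[of s y]]] has_field_derivative_at_within by force
  then obtain k where k: "\<And>s. s \<in> {-T<..<T} \<Longrightarrow> (\<Sum>\<^sub>\<infinity>z. p s z y * m z) = k"
    using has_field_derivative_zero_constant[of "{-T<..<T}" "\<lambda>s. \<Sum>\<^sub>\<infinity>z. p s z y * m z"] by auto
  have "(\<Sum>\<^sub>\<infinity>z. p 0 z y * m z) = (\<Sum>\<^sub>\<infinity>z. indicator {y} z * (m z / m y))"
    by (simp add: p_0)
  also have "\<dots> = 1" by (simp only: infsum_indicator_single) simp
  finally have "(\<Sum>\<^sub>\<infinity>z. p 0 z y * m z) = 1" .
  moreover have "T > 0" unfolding T_def by linarith
  ultimately have "k = 1" using k[of 0] by simp
  moreover have "t \<in> {-T<..<T}" by (auto simp: T_def)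
  ultimately have "(\<Sum>\<^sub>\<infinity>z. p t z y * m z) = 1" using k by blast
  then show ?thesis using sm[of t] by (simp add: has_sum_iff)
qed

text \<open>Self-adjointness cancels the derivative in \<open>t\<close> of the left-hand side, and
  at \<open>t = 0\<close> the first kernel is a point mass at \<open>x\<close>. With
  \<open>z\<close> in the first slot of both kernels the formula already contains the symmetry of
  the kernel, by comparison with \<open>t = T\<close>.\<close>

lemma p_convolution_const:
  assumes "0 \<le> t"  and "0 \<le> T" and "t \<le> T"
  shows "(\<Sum>\<^sub>\<infinity>z. p t z x * p (T - t) z y * m z) = p T x y"
proof -
  \<comment> \<open>Bounds both |s| and |T - s| on the enlarged interval \<open>I\<close>.\<close>
  define S where "S = 2 * T + 1"
  define I where "I = {-1 - T<..<T + 1}"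
  let ?L = "\<lambda>s x z. laplacian w (\<lambda>z. p s z x) z"
  have dom: "(\<lambda>z. 8 * (bnd S)\<^sup>2 * M * exp (- l1 (z - x))) summable_on UNIV"
    by (rule summable_on_cmult_right[OF summable_exp_l1])
  have "((\<lambda>s. \<Sum>\<^sub>\<infinity>z. p s z x * p (T - s) z y * m z) has_real_derivative
      (\<Sum>\<^sub>\<infinity>z. ?L s x z * p (T - s) z y * m z - p s z x * ?L (T - s) y z * m z)) (at s)"
    if "s \<in> I" for s
  proof (rule has_real_derivative_infsum[OF _ _ dom _ that[unfolded I_def]])
    show "((\<lambda>s. p s z x * p (T - s) z y * m z) has_real_derivative
       ?L s x z * p (T - s) z y * m z - p s z x * ?L (T - s) y z * m z) (at s)" for z s
    proof -
      have "((\<lambda>s. p (T - s) z y) has_real_derivative ?L (T - s) y z * (- 1)) (at s)"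
        by (rule DERIV_chain2[OF p_deriv]) (auto intro!: derivative_eq_intros)
      from DERIV_cmult_right[OF DERIV_mult'[OF p_deriv[of z x s] this], of "m z"]
      show ?thesis by (simp add: algebra_simps)
    qed
    show "\<bar>?L s x z * p (T - s) z y * m z - p s z x * ?L (T - s) y z * m z\<bar>
        \<le> 8 * (bnd S)\<^sup>2 * M * exp (- l1 (z - x))" if "s \<in> {-1 - T<..<T + 1}" for z s
    proof -
      have s: "\<bar>s\<bar> \<le> S" "\<bar>T - s\<bar> \<le> S" using that assms by (auto simp: S_def)
      have 1: "\<bar>?L s x z\<bar> * \<bar>p (T - s) z y\<bar> * m z \<le> (4 * bnd S * exp (- l1 (z - x))) * bnd S * M"
        using bnd_pos[of S] m_le s by (intro mult_mono p_deriv_bnd p_bnd') auto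
      have 2: "\<bar>p s z x\<bar> * \<bar>?L (T - s) y z\<bar> * m z \<le> (bnd S * exp (- l1 (z - x))) * (4 * bnd S) * M"
        using bnd_pos[of S] m_le s by (intro mult_mono p_deriv_bnd' p_bnd) auto
      have "\<bar>?L s x z * p (T - s) z y * m z - p s z x * ?L (T - s) y z * m z\<bar>
          \<le> \<bar>?L s x z * p (T - s) z y * m z\<bar> + \<bar>p s z x * ?L (T - s) y z * m z\<bar>"
        by (rule abs_triangle_ineq4)
      also have "\<dots> = \<bar>?L s x z\<bar> * \<bar>p (T - s) z y\<bar> * m z + \<bar>p s z x\<bar> * \<bar>?L (T - s) y z\<bar> * m z"
        by (simp add: abs_mult)
      finally show ?thesis using 1 2 by (simp add: power2_eq_square algebra_simps)
    qed
  qed (rule p_prod_summable)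
  then have "((\<lambda>s. \<Sum>\<^sub>\<infinity>z. p s z x * p (T - s) z y * m z) has_real_derivative 0) (at s within I)"
    if "s \<in> I" for s
    using that infsumI[OF laplacian_self_adjoint[OF p_summable[of s x] p_summable[of "T - s" y]]]
      has_field_derivative_at_within by force
  then obtain k where k: "\<And>s. s \<in> I \<Longrightarrow> (\<Sum>\<^sub>\<infinity>z. p s z x * p (T - s) z y * m z) = k"
    using has_field_derivative_zero_constant[of I "\<lambda>s. \<Sum>\<^sub>\<infinity>z. p s z x * p (T - s) z y * m z"]
    by (auto simp: I_def)
  have "(\<Sum>\<^sub>\<infinity>z. p 0 z x * p (T - 0) z y * m z) = (\<Sum>\<^sub>\<infinity>z. indicator {x} z * (p T z y * m z / m x))"
    by (simp add: p_0 mult.assoc)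
  also have "\<dots> = p T x y" by (simp only: infsum_indicator_single) simp
  finally show ?thesis using k[of t] k[of 0] assms by (simp add: I_def)
qed

lemma p_semigroup:
  assumes "0 \<le> s" "0 \<le> t"
  shows "((\<lambda>z. p s z x * p t z y * m z) has_sum p (s + t) x y) UNIV"
  using p_convolution_const[of s "s + t" x y] assms p_prod_summable[of s x t y]
  by (simp add: has_sum_iff)

text \<open>The square of the kernel provides two exponentials: one pays for the growth of
  \<open>k\<close>, the other gives convergence.\<close>

lemma weighted_summable:
  assumes k: "\<And>z. \<bar>k z\<bar> * exp (- l1 (z - y)) \<le> B"
  shows "(\<lambda>z. k z * (p s z y)\<^sup>2 * m z) summable_on UNIV"
proof (rule summable_on_bound[OF summable_on_cmult_right[OF summable_exp_l1[of y], of "B * (bnd \<bar>s\<bar>)\<^sup>2 * M"]])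
  fix z
  have B: "B \<ge> 0" using k[of y] by (meson abs_ge_zero exp_ge_zero mult_nonneg_nonneg order_trans)
  have "\<bar>k z\<bar> * (\<bar>p s z y\<bar> * \<bar>p s z y\<bar>) * m z
      \<le> \<bar>k z\<bar> * ((bnd \<bar>s\<bar> * exp (- l1 (z - y))) * (bnd \<bar>s\<bar> * exp (- l1 (z - y)))) * M"
    using bnd_pos[of "\<bar>s\<bar>"] m_le M_pos
    by (intro mult_mono mult_left_mono p_bnd mult_nonneg_nonneg) auto
  also have "\<dots> = (\<bar>k z\<bar> * exp (- l1 (z - y))) * ((bnd \<bar>s\<bar>)\<^sup>2 * M * exp (- l1 (z - y)))"
    by (simp add: power2_eq_square)
  also have "\<dots> \<le> B * ((bnd \<bar>s\<bar>)\<^sup>2 * M * exp (- l1 (z - y)))"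
    using k M_pos by (intro mult_right_mono) auto
  finally show "\<bar>k z * (p s z y)\<^sup>2 * m z\<bar> \<le> B * (bnd \<bar>s\<bar>)\<^sup>2 * M * exp (- l1 (z - y))"
    by (simp add: abs_mult power2_eq_square mult_ac)
qed

text \<open>Summation by parts is applied with the bounded function \<open>k z * p s z y\<close>;
  the factor 2 from the square cancels the 1/2. The second claim allows the edge sum to be estimated
  term by term later.\<close>

lemma weighted_energy_deriv:
  assumes k: "\<And>z. \<bar>k z\<bar> * exp (- l1 (z - y)) \<le> B"
  shows "((\<lambda>s. \<Sum>\<^sub>\<infinity>z. k z * (p s z y)\<^sup>2 * m z) has_real_derivative
     - (\<Sum>\<^sub>\<infinity>(x, z)\<in>edges. w x z * (p s z y - p s x y) * (k z * p s z y - k x * p s x y))) (at s)"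
    and "(\<lambda>(x, z). w x z * (p s z y - p s x y) * (k z * p s z y - k x * p s x y)) summable_on edges"
proof -
  define T where "T = \<bar>s\<bar> + 1"
  let ?L = "\<lambda>s z. laplacian w (\<lambda>z. p s z y) z"
  have B: "B \<ge> 0" using k[of y] by (meson abs_ge_zero exp_ge_zero mult_nonneg_nonneg order_trans)
  have kp: "\<bar>k z * p s z y\<bar> \<le> B * bnd T" if "\<bar>s\<bar> \<le> T" for z s
  proof -
    have "\<bar>k z\<bar> * \<bar>p s z y\<bar> \<le> \<bar>k z\<bar> * (bnd T * exp (- l1 (z - y)))"
      by (intro mult_left_mono p_bnd that) auto
    also have "\<dots> = bnd T * (\<bar>k z\<bar> * exp (- l1 (z - y)))" by simp
    also have "\<dots> \<le> bnd T * B" using k bnd_pos[of T] by (intro mult_left_mono) auto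
    finally show ?thesis by (simp add: abs_mult mult.commute)
  qed
  have dom: "(\<lambda>z. 8 * B * (bnd T)\<^sup>2 * M * exp (- l1 (z - y))) summable_on UNIV"
    by (rule summable_on_cmult_right[OF summable_exp_l1])
  have "((\<lambda>s. \<Sum>\<^sub>\<infinity>z. k z * (p s z y)\<^sup>2 * m z) has_real_derivative
      (\<Sum>\<^sub>\<infinity>z. 2 * (?L s z * (k z * p s z y) * m z))) (at s)"
  proof (rule has_real_derivative_infsum[OF _ _ dom, where a = "-T" and b = T])
    show "((\<lambda>s. k z * (p s z y)\<^sup>2 * m z) has_real_derivative 2 * (?L s z * (k z * p s z y) * m z)) (at s)" for z s
      by (auto intro!: derivative_eq_intros p_deriv)
    show "\<bar>2 * (?L s z * (k z * p s z y) * m z)\<bar> \<le> 8 * B * (bnd T)\<^sup>2 * M * exp (- l1 (z - y))"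
      if "s \<in> {-T<..<T}" for z s
    proof -
      have "\<bar>?L s z\<bar> * \<bar>k z * p s z y\<bar> * m z \<le> (4 * bnd T * exp (- l1 (z - y))) * (B * bnd T) * M"
        using bnd_pos[of T] m_le that B by (intro mult_mono p_deriv_bnd kp) auto
      then show ?thesis by (simp add: abs_mult power2_eq_square mult_ac)
    qed
  qed (use weighted_summable[OF k] in \<open>auto simp: T_def\<close>)
  moreover have s: "\<bar>k z * p s z y\<bar> \<le> B * bnd T" for z by (rule kp) (simp add: T_def)
  moreover have "(\<Sum>\<^sub>\<infinity>z. 2 * (?L s z * (k z * p s z y) * m z))
      = - (\<Sum>\<^sub>\<infinity>(x, z)\<in>edges. w x z * (p s z y - p s x y) * (k z * p s z y - k x * p s x y))"
    unfolding infsum_cmult_right' infsumI[OF summation_by_parts(2)[OF p_summable, of "\<lambda>z. k z * p s z y" "B * bnd T", OF s]] by simp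
  ultimately show "((\<lambda>s. \<Sum>\<^sub>\<infinity>z. k z * (p s z y)\<^sup>2 * m z) has_real_derivative
     - (\<Sum>\<^sub>\<infinity>(x, z)\<in>edges. w x z * (p s z y - p s x y) * (k z * p s z y - k x * p s x y))) (at s)"
    by simp
  show "(\<lambda>(x, z). w x z * (p s z y - p s x y) * (k z * p s z y - k x * p s x y)) summable_on edges"
    by (rule summation_by_parts(1)[OF p_summable, of "\<lambda>z. k z * p s z y" "B * bnd T", OF s])
qed

end

section \<open>The weighted Poincare inequality\<close>

definition cube :: "int \<Rightarrow> (int ^ 'n::finite) set" where
  "cube R = {v. \<forall>i. - R < v $ i \<and> v $ i < R}"

lemma cube_bij: "bij_betw (\<lambda>g. \<chi> i. g i) (PiE UNIV (\<lambda>_. {-R<..<R})) (cube R :: (int ^ 'n::finite) set)"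
  by (rule bij_betwI[of _ _ _ "\<lambda>v i. v $ i"]) (auto simp: cube_def PiE_iff)

lemma finite_cube [simp]: "finite (cube R)"
  using bij_betw_finite[OF cube_bij[of R]] by (simp add: finite_PiE)

lemma card_cube:
  assumes "R \<ge> 1"
  shows "real (card (cube R :: (int ^ 'n::finite) set)) = (2 * real_of_int R - 1) ^ CARD('n)"
proof -
  have "card (cube R :: (int ^ 'n) set) = card {-R<..<R} ^ CARD('n)"
    using bij_betw_same_card[OF cube_bij[of R, where 'n = 'n]]
    by (simp only: card_PiE finite prod_constant finite_greaterThanLessThan_int)
  moreover have "real (card {-R<..<R}) = 2 * real_of_int R - 1" using assms by simp
  ultimately show ?thesis by (simp only: of_nat_power)
qed

text \<open>The device that reduces the Poincare inequality to lines: passing from (x, y) to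
  (\<open>mix S x y\<close>, \<open>mix S y x\<close>) is an involution on pairs in the cube and
  preserves every product weight (\<open>\<phi>_mix\<close>).\<close>

definition mix :: "'n::finite set \<Rightarrow> int ^ 'n \<Rightarrow> int ^ 'n \<Rightarrow> int ^ 'n" where
  "mix S x y = (\<chi> i. if i \<in> S then y $ i else x $ i)"

definition upd :: "int ^ 'n::finite \<Rightarrow> 'n \<Rightarrow> int \<Rightarrow> int ^ 'n" where
  "upd x i k = (\<chi> j. if j = i then k else x $ j)"

lemma mix_nth [simp]: "mix S x y $ i = (if i \<in> S then y $ i else x $ i)"
  by (simp add: mix_def)

lemma upd_nth [simp]: "upd x i k $ j = (if j = i then k else x $ j)"
  by (simp add: upd_def)

lemma mix_single: "mix {i} x y = upd x i (y $ i)"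
  by (simp add: vec_eq_iff)

lemma sum_cube_mix:
  "(\<Sum>(x, y)\<in>cube R \<times> cube R. F (mix S x y) (mix S y x)) = (\<Sum>(x, y)\<in>cube R \<times> cube R. F x y)"
  by (rule sum.reindex_bij_witness[of _ "\<lambda>(x, y). (mix S x y, mix S y x)" "\<lambda>(x, y). (mix S x y, mix S y x)"])
     (auto simp: cube_def vec_eq_iff)

text \<open>Exchanging the new value \<open>k\<close> with the old i-th coordinate is an involution
  of the index set.\<close>

lemma sum_cube_upd:
  fixes H :: "int ^ 'n::finite \<Rightarrow> real"
  shows "(\<Sum>x\<in>cube R. \<Sum>k\<in>{-R<..<R}. H (upd x i k)) = real (card {-R<..<R}) * (\<Sum>x\<in>cube R. H x)"
proof -
  have "(\<Sum>x\<in>cube R. \<Sum>k\<in>{-R<..<R}. H (upd x i k)) = (\<Sum>(x, k)\<in>cube R \<times> {-R<..<R}. H (upd x i k))"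
    by (simp add: sum.cartesian_product)
  also have "\<dots> = (\<Sum>(x, k)\<in>cube R \<times> {-R<..<R}. H x)"
    by (rule sum.reindex_bij_witness[of _ "\<lambda>(x, k). (upd x i k, x $ i)" "\<lambda>(x, k). (upd x i k, x $ i)"])
       (auto simp: cube_def vec_eq_iff)
  also have "\<dots> = (\<Sum>x\<in>cube R. \<Sum>k\<in>{-R<..<R}. H x)"
    by (simp only: sum.cartesian_product)
  finally show ?thesis by (simp add: sum_distrib_left)
qed

lemma square_telescope:
  fixes F :: "int \<Rightarrow> real"
  assumes "a \<le> b"
  shows "(F b - F a)\<^sup>2 \<le> real_of_int (b - a) * (\<Sum>k\<in>{a..<b}. (F (k + 1) - F k)\<^sup>2)"
proof -
  have "F b - F a = (\<Sum>k\<in>{a..<b}. F (k + 1) - F k)"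
    using assms
  proof (induction b rule: int_ge_induct)
    case (step i)
    then have "{a..<i + 1} = insert i {a..<i}" by auto
    then show ?case using step by simp
  qed simp
  also have "(\<dots>)\<^sup>2 \<le> (\<Sum>k\<in>{a..<b}. (F (k + 1) - F k)\<^sup>2) * (\<Sum>k\<in>{a..<b}. 1\<^sup>2)"
    using Cauchy_Schwarz_ineq_sum[of "\<lambda>k. F (k + 1) - F k" "\<lambda>_. 1" "{a..<b}"] by simp
  finally show ?thesis using assms by (simp add: mult.commute)
qed

text \<open>Unimodality keeps the weight along a segment at least as large as the smaller end value,
  which is what a weighted inequality on a line needs. Two instances occur: the indicator of an
  interval, for Nash's inequality, and the squared tent, for the logarithm.\<close>

locale profile =
  fixes \<theta> :: "int \<Rightarrow> real" and R :: int
  assumes R: "R \<ge> 1" and \<theta>_nonneg: "0 \<le> \<theta> k"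
    and \<theta>_supp: "R \<le> \<bar>k\<bar> \<Longrightarrow> \<theta> k = 0"
    and \<theta>_unimodal: "a \<le> k \<Longrightarrow> k \<le> b \<Longrightarrow> min (\<theta> a) (\<theta> b) \<le> \<theta> k"
begin

definition \<phi> :: "int ^ 'n::finite \<Rightarrow> real" where
  "\<phi> v = (\<Prod>i\<in>UNIV. \<theta> (v $ i))"

definition \<phi>' :: "'n::finite \<Rightarrow> int ^ 'n \<Rightarrow> real" where
  "\<phi>' i v = (\<Prod>j\<in>UNIV - {i}. \<theta> (v $ j))"

lemma \<phi>_nonneg: "0 \<le> \<phi> v"
  by (simp add: \<phi>_def prod_nonneg \<theta>_nonneg)

lemma \<phi>'_nonneg: "0 \<le> \<phi>' i v"
  by (simp add: \<phi>'_def prod_nonneg \<theta>_nonneg)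

lemma \<phi>_split: "\<phi> v = \<theta> (v $ i) * \<phi>' i v"
  unfolding \<phi>_def \<phi>'_def by (rule prod.remove) auto

lemma \<phi>'_upd [simp]: "\<phi>' i (upd v i k) = \<phi>' i v"
  unfolding \<phi>'_def by (rule prod.cong) auto

lemma \<phi>_upd: "\<phi> (upd v i k) = \<theta> k * \<phi>' i v"
  using \<phi>_split[of "upd v i k" i] by simp

lemma \<phi>_supp: "v \<notin> cube R \<Longrightarrow> \<phi> v = 0"
proof -
  assume "v \<notin> cube R"
  then obtain i where "\<not> (- R < v $ i \<and> v $ i < R)" by (auto simp: cube_def)
  then have "R \<le> \<bar>v $ i\<bar>" by linarith
  then show ?thesis using \<theta>_supp unfolding \<phi>_def by (intro prod_zero) auto
qed

lemma \<phi>_mix: "\<phi> (mix S x y) * \<phi> (mix S y x) = \<phi> x * \<phi> y"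
  unfolding \<phi>_def prod.distrib[symmetric] by (rule prod.cong) auto

text \<open>The product of the end weights is their maximum times their minimum. Unimodality moves
  the minimum under the sum of squared increments; the maximum is relaxed to
  \<open>\<theta> a + \<theta> b\<close> so that the bound splits when summed over pairs.\<close>

lemma line_poincare:
  fixes F :: "int \<Rightarrow> real"
  assumes a: "- R < a \<and> a < R" and b: "- R < b \<and> b < R"
  shows "\<theta> a * \<theta> b * (F a - F b)\<^sup>2
    \<le> (\<theta> a + \<theta> b) * (2 * real_of_int R) * (\<Sum>k\<in>{-R<..<R}. min (\<theta> k) (\<theta> (k + 1)) * (F (k + 1) - F k)\<^sup>2)"
  using a b
proof (induction a b rule: linorder_wlog)
  case (le a b)
  let ?d = "\<lambda>k. (F (k + 1) - F k)\<^sup>2"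
  have "(F a - F b)\<^sup>2 \<le> 2 * real_of_int R * (\<Sum>k\<in>{a..<b}. ?d k)"
  proof -
    have "(F a - F b)\<^sup>2 \<le> real_of_int (b - a) * (\<Sum>k\<in>{a..<b}. ?d k)"
      using square_telescope[OF le(1), of F] by (simp add: power2_commute)
    also have "\<dots> \<le> 2 * real_of_int R * (\<Sum>k\<in>{a..<b}. ?d k)"
      using le by (intro mult_right_mono sum_nonneg) auto
    finally show ?thesis .
  qed
  then have "min (\<theta> a) (\<theta> b) * (F a - F b)\<^sup>2 \<le> min (\<theta> a) (\<theta> b) * (2 * real_of_int R * (\<Sum>k\<in>{a..<b}. ?d k))"
    by (rule mult_left_mono) (simp add: \<theta>_nonneg)
  also have "\<dots> = 2 * real_of_int R * (\<Sum>k\<in>{a..<b}. min (\<theta> a) (\<theta> b) * ?d k)"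
    by (simp add: sum_distrib_left mult_ac)
  also have "(\<Sum>k\<in>{a..<b}. min (\<theta> a) (\<theta> b) * ?d k) \<le> (\<Sum>k\<in>{a..<b}. min (\<theta> k) (\<theta> (k + 1)) * ?d k)"
  proof (intro sum_mono mult_right_mono)
    fix k assume "k \<in> {a..<b}"
    then show "min (\<theta> a) (\<theta> b) \<le> min (\<theta> k) (\<theta> (k + 1))"
      using \<theta>_unimodal[of a k b] \<theta>_unimodal[of a "k + 1" b] by auto
  qed simp
  also have "\<dots> \<le> (\<Sum>k\<in>{-R<..<R}. min (\<theta> k) (\<theta> (k + 1)) * ?d k)"
    using le by (intro sum_mono2) (auto simp: \<theta>_nonneg)
  finally have *: "min (\<theta> a) (\<theta> b) * (F a - F b)\<^sup>2
      \<le> 2 * real_of_int R * (\<Sum>k\<in>{-R<..<R}. min (\<theta> k) (\<theta> (k + 1)) * ?d k)"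
    using R by (simp add: mult_left_mono)
  have "\<theta> a * \<theta> b = max (\<theta> a) (\<theta> b) * min (\<theta> a) (\<theta> b)" by (simp add: max_def min_def)
  also have "\<dots> * (F a - F b)\<^sup>2 \<le> (\<theta> a + \<theta> b) * (min (\<theta> a) (\<theta> b) * (F a - F b)\<^sup>2)"
    unfolding mult.assoc by (rule mult_right_mono) (auto simp: max_def \<theta>_nonneg)
  also have "\<dots> \<le> (\<theta> a + \<theta> b) * (2 * real_of_int R * (\<Sum>k\<in>{-R<..<R}. min (\<theta> k) (\<theta> (k + 1)) * ?d k))"
    using * by (rule mult_left_mono) (simp add: \<theta>_nonneg)
  finally show ?case by (simp add: mult.assoc)
next
  case (sym a b)
  then show ?case by (simp add: power2_commute mult.commute add.commute)
qed

text \<open>An edge carries the smaller of its two end weights, because this is the quantity that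
  the edge inequality for logarithms gives back.\<close>

definition grad_energy :: "(int ^ 'n::finite \<Rightarrow> real) \<Rightarrow> 'n \<Rightarrow> int ^ 'n \<Rightarrow> real" where
  "grad_energy f i x = min (\<phi> x) (\<phi> (x + axis i 1)) * (f (x + axis i 1) - f x)\<^sup>2"

lemma grad_energy_nonneg: "0 \<le> grad_energy f i x"
  by (simp add: grad_energy_def \<phi>_nonneg)

lemma grad_energy_upd:
  "grad_energy f i (upd x i k)
    = \<phi>' i x * (min (\<theta> k) (\<theta> (k + 1)) * (f (upd x i (k + 1)) - f (upd x i k))\<^sup>2)"
proof -
  have "upd x i k + axis i 1 = upd x i (k + 1)" by (simp add: vec_eq_iff axis_def)
  then show ?thesis
    by (simp add: grad_energy_def \<phi>_upd min_mult_distrib_left[symmetric] mult.commute[of "\<theta> _"] \<phi>'_nonneg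
        min_mult_distrib_left mult.assoc)
qed

text \<open>The line inequality is summed over all pairs. The line energy \<open>D\<close> ignores
  the i-th coordinate, so exchanging that coordinate makes both halves equal; 8 R^2 comes from the
  factor 2 R of the line, the two halves, and at most 2 R points on the line.\<close>

lemma coordinate_variation:
  fixes f :: "int ^ 'n::finite \<Rightarrow> real"
  shows "(\<Sum>(x, y)\<in>cube R \<times> cube R. \<phi> x * \<phi> y * (f x - f (upd x i (y $ i)))\<^sup>2)
    \<le> 8 * (real_of_int R)\<^sup>2 * sum \<phi> (cube R :: (int ^ 'n) set) * (\<Sum>x\<in>cube R. grad_energy f i x)"
proof -
  define D where "D = (\<lambda>x. \<Sum>k\<in>{-R<..<R}. grad_energy f i (upd x i k))"
  let ?B = "cube R \<times> cube R :: ((int ^ 'n) \<times> (int ^ 'n)) set"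
  have D_upd: "D (upd x i k) = D x" for x k
  proof -
    have "upd (upd x i k) i l = upd x i l" for l by (simp add: vec_eq_iff)
    then show ?thesis by (simp add: D_def)
  qed
  have 1: "\<phi> x * \<phi> y * (f x - f (upd x i (y $ i)))\<^sup>2
      \<le> 2 * real_of_int R * (\<theta> (x $ i) * \<phi>' i y * D x + \<theta> (y $ i) * \<phi>' i y * D x)"
    if "x \<in> cube R" "y \<in> cube R" for x y
  proof -
    have ux: "upd x i (x $ i) = x" by (simp add: vec_eq_iff)
    have "\<theta> (x $ i) * \<theta> (y $ i) * (f x - f (upd x i (y $ i)))\<^sup>2 \<le> (\<theta> (x $ i) + \<theta> (y $ i)) * (2 * real_of_int R) *
      (\<Sum>k\<in>{-R<..<R}. min (\<theta> k) (\<theta> (k + 1)) * (f (upd x i (k + 1)) - f (upd x i k))\<^sup>2)"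
      using line_poincare[of "x $ i" "y $ i" "\<lambda>k. f (upd x i k)"] that by (simp add: ux cube_def)
    then have "\<phi>' i x * \<phi>' i y * (\<theta> (x $ i) * \<theta> (y $ i) * (f x - f (upd x i (y $ i)))\<^sup>2)
      \<le> \<phi>' i x * \<phi>' i y * ((\<theta> (x $ i) + \<theta> (y $ i)) * (2 * real_of_int R) *
      (\<Sum>k\<in>{-R<..<R}. min (\<theta> k) (\<theta> (k + 1)) * (f (upd x i (k + 1)) - f (upd x i k))\<^sup>2))"
      by (rule mult_left_mono) (simp add: \<phi>'_nonneg)
    also have "\<dots> = 2 * real_of_int R * (\<theta> (x $ i) + \<theta> (y $ i)) * \<phi>' i y * D x"
      by (simp add: D_def grad_energy_upd sum_distrib_left[symmetric])
    finally show ?thesis by (simp add: \<phi>_split[of _ i] algebra_simps)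
  qed
  have "(\<Sum>(x, y)\<in>?B. \<phi> x * \<phi> y * (f x - f (upd x i (y $ i)))\<^sup>2)
      \<le> (\<Sum>(x, y)\<in>?B. 2 * real_of_int R * (\<theta> (x $ i) * \<phi>' i y * D x + \<theta> (y $ i) * \<phi>' i y * D x))"
    by (rule sum_mono) (auto intro: 1)
  also have "\<dots> = 2 * real_of_int R * ((\<Sum>(x, y)\<in>?B. \<theta> (x $ i) * \<phi>' i y * D x)
      + (\<Sum>(x, y)\<in>?B. \<theta> (y $ i) * \<phi>' i y * D x))"
    by (simp add: case_prod_unfold sum.distrib sum_distrib_left[symmetric])
  also have "(\<Sum>(x, y)\<in>?B. \<theta> (x $ i) * \<phi>' i y * D x) = (\<Sum>(x, y)\<in>?B. \<theta> (y $ i) * \<phi>' i y * D x)"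
    using sum_cube_mix[of "\<lambda>x y. \<theta> (x $ i) * \<phi>' i y * D x" "{i}" R]
    by (simp add: mix_single D_upd)
  also have "(\<Sum>(x, y)\<in>?B. \<theta> (y $ i) * \<phi>' i y * D x) = sum \<phi> (cube R :: (int ^ 'n) set) * (\<Sum>x\<in>cube R. D x)"
    by (simp add: sum.cartesian_product[symmetric] \<phi>_split[of _ i] sum_distrib_left[symmetric] sum_distrib_right[symmetric] mult.commute)
  also have "(\<Sum>x\<in>cube R. D x) = real (card {-R<..<R}) * (\<Sum>x\<in>cube R. grad_energy f i x)"
    unfolding D_def by (rule sum_cube_upd)
  also have "2 * real_of_int R * (sum \<phi> (cube R :: (int ^ 'n) set) * (real (card {-R<..<R}) * (\<Sum>x\<in>cube R. grad_energy f i x))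
        + sum \<phi> (cube R :: (int ^ 'n) set) * (real (card {-R<..<R}) * (\<Sum>x\<in>cube R. grad_energy f i x)))
     \<le> 2 * real_of_int R * (sum \<phi> (cube R :: (int ^ 'n) set) * (2 * real_of_int R * (\<Sum>x\<in>cube R. grad_energy f i x))
        + sum \<phi> (cube R :: (int ^ 'n) set) * (2 * real_of_int R * (\<Sum>x\<in>cube R. grad_energy f i x)))"
    using R by (intro mult_left_mono add_mono mult_right_mono sum_nonneg) (auto simp: \<phi>_nonneg grad_energy_nonneg)
  finally show ?thesis by (simp add: power2_eq_square algebra_simps)
qed

text \<open>Coordinates are exchanged one at a time. Each exchange costs a factor 2 from (a - c)^2
  <= 2 (a - b)^2 + 2 (b - c)^2, and the involution of \<open>sum_cube_mix\<close> brings the last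
  move back to the original pair.\<close>

lemma mix_variation:
  fixes f :: "int ^ 'n::finite \<Rightarrow> real"
  assumes "finite S"
  shows "(\<Sum>(x, y)\<in>cube R \<times> cube R. \<phi> x * \<phi> y * (f x - f (mix S x y))\<^sup>2)
    \<le> 2 ^ card S * (\<Sum>i\<in>S. \<Sum>(x, y)\<in>cube R \<times> cube R. \<phi> x * \<phi> y * (f x - f (upd x i (y $ i)))\<^sup>2)"
  using assms
proof (induction S)
  case empty
  have "mix {} x y = x" for x y :: "int ^ 'n" by (simp add: vec_eq_iff)
  then show ?case by simp
next
  case (insert i S)
  let ?B = "cube R \<times> cube R :: ((int ^ 'n) \<times> (int ^ 'n)) set"
  let ?V = "\<lambda>S. \<Sum>(x, y)\<in>?B. \<phi> x * \<phi> y * (f x - f (mix S x y))\<^sup>2"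
  let ?U = "\<lambda>i. \<Sum>(x, y)\<in>?B. \<phi> x * \<phi> y * (f x - f (upd x i (y $ i)))\<^sup>2"
  have U: "0 \<le> ?U j" for j by (intro sum_nonneg) (auto simp: \<phi>_nonneg)
  have mix: "mix (insert i S) x y = upd (mix S x y) i (mix S y x $ i)" for x y
    using insert.hyps by (auto simp: vec_eq_iff)
  have "?V (insert i S) \<le> (\<Sum>(x, y)\<in>?B. 2 * (\<phi> x * \<phi> y * (f x - f (mix S x y))\<^sup>2)
     + 2 * (\<phi> (mix S x y) * \<phi> (mix S y x) * (f (mix S x y) - f (upd (mix S x y) i (mix S y x $ i)))\<^sup>2))"
  proof (rule sum_mono, clarify)
    fix x y :: "int ^ 'n"
    let ?a = "f x" and ?b = "f (mix S x y)" and ?c = "f (mix (insert i S) x y)"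
    have "(?a - ?c)\<^sup>2 \<le> 2 * (?a - ?b)\<^sup>2 + 2 * (?b - ?c)\<^sup>2"
      using zero_le_power2[of "(?a - ?b) - (?b - ?c)"] by (simp add: power2_eq_square algebra_simps)
    then have "\<phi> x * \<phi> y * (?a - ?c)\<^sup>2 \<le> \<phi> x * \<phi> y * (2 * (?a - ?b)\<^sup>2 + 2 * (?b - ?c)\<^sup>2)"
      by (rule mult_left_mono) (simp add: \<phi>_nonneg)
    then show "\<phi> x * \<phi> y * (?a - ?c)\<^sup>2 \<le> 2 * (\<phi> x * \<phi> y * (?a - ?b)\<^sup>2)
        + 2 * (\<phi> (mix S x y) * \<phi> (mix S y x) * (?b - f (upd (mix S x y) i (mix S y x $ i)))\<^sup>2)"
      unfolding \<phi>_mix mix by (simp add: algebra_simps)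
  qed
  also have "\<dots> = 2 * ?V S + 2 * ?U i"
    using sum_cube_mix[of "\<lambda>x y. \<phi> x * \<phi> y * (f x - f (upd x i (y $ i)))\<^sup>2" S R]
    by (simp add: case_prod_unfold sum.distrib sum_distrib_left[symmetric])
  also have "\<dots> \<le> 2 * (2 ^ card S * (\<Sum>i\<in>S. ?U i)) + 2 ^ Suc (card S) * ?U i"
  proof (rule add_mono)
    have "(2 :: real) ^ 1 \<le> 2 ^ Suc (card S)" by (rule power_increasing) auto
    then show "2 * ?U i \<le> 2 ^ Suc (card S) * ?U i" using U[of i] by (intro mult_right_mono) auto
  qed (use insert.IH in simp)
  also have "\<dots> = 2 ^ card (insert i S) * (\<Sum>i\<in>insert i S. ?U i)"
    using insert.hyps by (simp add: algebra_simps)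
  finally show ?case .
qed

lemma weighted_poincare:
  fixes f :: "int ^ 'n::finite \<Rightarrow> real"
  shows "sum \<phi> (cube R :: (int ^ 'n) set) * (\<Sum>x\<in>cube R. \<phi> x * (f x)\<^sup>2) - (\<Sum>x\<in>cube R. \<phi> x * f x)\<^sup>2
    \<le> 2 ^ CARD('n) * 4 * (real_of_int R)\<^sup>2 * sum \<phi> (cube R :: (int ^ 'n) set)
      * (\<Sum>x\<in>cube R. \<Sum>i\<in>UNIV. grad_energy f i x)"
proof -
  let ?b = "cube R :: (int ^ 'n) set"
  let ?V = "\<Sum>(x, y)\<in>?b \<times> ?b. \<phi> x * \<phi> y * (f x - f y)\<^sup>2"
  have "mix UNIV x y = y" for x y :: "int ^ 'n" by (simp add: vec_eq_iff)
  then have "?V \<le> 2 ^ CARD('n) * (\<Sum>i\<in>UNIV. \<Sum>(x, y)\<in>?b \<times> ?b. \<phi> x * \<phi> y * (f x - f (upd x i (y $ i)))\<^sup>2)"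
    using mix_variation[of "UNIV :: 'n set" f] by simp
  also have "\<dots> \<le> 2 ^ CARD('n) * (\<Sum>i\<in>UNIV. 8 * (real_of_int R)\<^sup>2 * sum \<phi> ?b * (\<Sum>x\<in>?b. grad_energy f i x))"
    by (intro mult_left_mono sum_mono coordinate_variation) auto
  also have "\<dots> = 2 * (2 ^ CARD('n) * 4 * (real_of_int R)\<^sup>2 * sum \<phi> ?b * (\<Sum>x\<in>?b. \<Sum>i\<in>UNIV. grad_energy f i x))"
    by (subst sum.swap) (simp add: sum_distrib_left[symmetric])
  \<comment> \<open>Expanding the square turns the double sum into twice the left-hand side of the
    claim.\<close>
  also have "?V = 2 * (sum \<phi> ?b * (\<Sum>x\<in>?b. \<phi> x * (f x)\<^sup>2) - (\<Sum>x\<in>?b. \<phi> x * f x)\<^sup>2)"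
  proof -
    have "?V = (\<Sum>x\<in>?b. \<Sum>y\<in>?b. (\<phi> x * (f x)\<^sup>2) * \<phi> y + \<phi> x * (\<phi> y * (f y)\<^sup>2) - 2 * ((\<phi> x * f x) * (\<phi> y * f y)))"
      unfolding sum.cartesian_product[symmetric]
      by (intro sum.cong refl) (simp add: power2_eq_square algebra_simps)
    also have "\<dots> = 2 * (sum \<phi> ?b * (\<Sum>x\<in>?b. \<phi> x * (f x)\<^sup>2) - (\<Sum>x\<in>?b. \<phi> x * f x)\<^sup>2)"
      by (simp add: sum.distrib sum_subtractf sum_distrib_left[symmetric] sum_distrib_right[symmetric] power2_eq_square)
    finally show ?thesis .
  qed
  finally show ?thesis by simp
qed

end

section \<open>Upper bounds\<close>

lemma has_sum_finite_sum:
  fixes f :: "'b \<Rightarrow> 'a \<Rightarrow> real"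
  assumes "finite S" and "\<And>v. v \<in> S \<Longrightarrow> (f v has_sum s v) A"
  shows "((\<lambda>z. \<Sum>v\<in>S. f v z) has_sum (\<Sum>v\<in>S. s v)) A"
  using assms by (induction S) (auto intro!: has_sum_add)

lemma has_sum_translates:
  fixes a :: "int ^ 'n::finite \<Rightarrow> real"
  assumes "a summable_on UNIV"
  shows "((\<lambda>z. \<Sum>v\<in>cube R. a (z + v)) has_sum real (card (cube R :: (int ^ 'n) set)) * infsum a UNIV) UNIV"
proof -
  have "((\<lambda>z. a (z + v)) has_sum infsum a UNIV) UNIV" for v
  proof -
    have "bij_betw (\<lambda>z. z + v) UNIV UNIV"
      by (rule bij_betwI[of _ _ _ "\<lambda>z. z - v"]) auto
    from has_sum_reindex_bij_betw[OF this, of a] show ?thesis using assms by simp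
  qed
  from has_sum_finite_sum[OF finite_cube this] show ?thesis by simp
qed

lemma summable_on_square:
  fixes f :: "'a \<Rightarrow> real"
  assumes "f summable_on UNIV"
  shows "(\<lambda>x. (f x)\<^sup>2) summable_on UNIV"
proof -
  obtain B where B: "\<And>x. \<bar>f x\<bar> \<le> B" using summable_on_imp_bounded[OF assms] by blast
  show ?thesis
  proof (rule summable_on_bound[OF summable_on_cmult_right[OF summable_on_abs[OF assms], of B]])
    show "\<bar>(f x)\<^sup>2\<bar> \<le> B * \<bar>f x\<bar>" for x
      using mult_right_mono[OF B[of x], of "\<bar>f x\<bar>"] by (simp add: power2_eq_square abs_mult[symmetric])
  qed
qed

lemma power_over_fact_le_exp:
  fixes x :: real assumes "x \<ge> 0"
  shows "x ^ n \<le> fact n * exp x"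
proof -
  have "x ^ n /\<^sub>R fact n \<le> (\<Sum>k. x ^ k /\<^sub>R fact k)"
    using sum_le_suminf[OF summable_exp_generic[of x], of "{n}"] assms by simp
  then have "x ^ n /\<^sub>R fact n \<le> exp x" by (simp add: exp_def)
  then show ?thesis by (simp add: field_simps)
qed

text \<open>Used across an edge, where the weight rho^(n+1) thus changes by O(rho^n). The induction
  uses \<open>b \<le> 2 * a\<close>, and the minus one in the constant absorbs the extra
  term.\<close>

lemma power_diff_le:
  fixes a b :: real
  assumes a: "1 \<le> a" and b: "0 \<le> b" and ab: "\<bar>b - a\<bar> \<le> 1"
  shows "\<bar>b ^ Suc n - a ^ Suc n\<bar> \<le> (2 ^ Suc n - 1) * a ^ n"
proof (induction n)
  case (Suc n)
  have "b ^ Suc (Suc n) - a ^ Suc (Suc n) = b * (b ^ Suc n - a ^ Suc n) + a ^ Suc n * (b - a)"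
    by (simp add: algebra_simps)
  then have "\<bar>b ^ Suc (Suc n) - a ^ Suc (Suc n)\<bar> \<le> \<bar>b * (b ^ Suc n - a ^ Suc n)\<bar> + \<bar>a ^ Suc n * (b - a)\<bar>"
    by simp
  also have "\<dots> = b * \<bar>b ^ Suc n - a ^ Suc n\<bar> + a ^ Suc n * \<bar>b - a\<bar>"
    unfolding abs_mult using a b by simp
  also have "\<dots> \<le> (2 * a) * ((2 ^ Suc n - 1) * a ^ n) + a ^ Suc n * 1"
    using a b ab Suc.IH by (intro add_mono mult_mono) auto
  also have "\<dots> = (2 ^ Suc (Suc n) - 1) * a ^ Suc n"
    by (simp add: algebra_simps)
  finally show ?case .
qed (use ab in simp)

lemma nonincreasing_if_deriv_nonpos:
  fixes f f' :: "real \<Rightarrow> real"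
  assumes "a \<le> b" and "\<And>x. a \<le> x \<Longrightarrow> x \<le> b \<Longrightarrow> (f has_real_derivative f' x) (at x)"
    and "\<And>x. a \<le> x \<Longrightarrow> x \<le> b \<Longrightarrow> f' x \<le> 0"
  shows "f b \<le> f a"
  using assms by (intro DERIV_nonpos_imp_nonincreasing[of a b f]) auto

context lattice begin

lemma axis_sum_le:
  assumes g: "\<And>y. adj x y \<Longrightarrow> 0 \<le> g y"
  shows "(\<Sum>i\<in>UNIV. g (x + axis i 1)) \<le> (\<Sum>y | adj x y. w x y * g y) / c"
proof -
  have "(\<Sum>i\<in>UNIV. g (x + axis i 1)) = (\<Sum>y\<in>(\<lambda>i. x + axis i 1) ` UNIV. g y)"
    by (subst sum.reindex) (auto simp: inj_on_def axis_eq_axis)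
  also have "\<dots> \<le> (\<Sum>y | adj x y. g y)"
    by (rule sum_mono2) (auto simp: finite_neighbours adj_axis g)
  also have "\<dots> \<le> (\<Sum>y | adj x y. w x y * g y / c)"
  proof (rule sum_mono)
    fix y assume "y \<in> {y. adj x y}"
    then have "c * g y \<le> w x y * g y" using w_ge g by (intro mult_right_mono) auto
    then show "g y \<le> w x y * g y / c" using c_pos by (simp add: field_simps)
  qed
  finally show ?thesis by (simp add: sum_divide_distrib)
qed

text \<open>Averaging the Poincare inequality over all translates of a cube.\<close>

lemma nash:
  fixes f :: "int ^ 'n \<Rightarrow> real"
  assumes f: "f summable_on UNIV" and R: "R \<ge> 1"
  shows "(\<Sum>\<^sub>\<infinity>x. (f x)\<^sup>2) \<le> 2 ^ CARD('n) * 4 / c * (real_of_int R)\<^sup>2 * (\<Sum>\<^sub>\<infinity>(x, y)\<in>edges. w x y * (f y - f x)\<^sup>2)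
     + (\<Sum>\<^sub>\<infinity>x. \<bar>f x\<bar>)\<^sup>2 / real_of_int R ^ CARD('n)"
proof -
  interpret profile "\<lambda>k. if - R < k \<and> k < R then 1 else 0" R
    using R by unfold_locales (auto simp: abs_less_iff)
  define V where "V = real (card (cube R :: (int ^ 'n) set))"
  define A where "A = (\<Sum>\<^sub>\<infinity>x. \<bar>f x\<bar>)"
  define \<Gamma> where "\<Gamma> = (\<lambda>x. \<Sum>y | adj x y. w x y * (f y - f x)\<^sup>2)"
  define E where "E = (\<Sum>\<^sub>\<infinity>(x, y)\<in>edges. w x y * (f y - f x)\<^sup>2)"
  define b where "b = 2 ^ CARD('n) * 4 / c * (real_of_int R)\<^sup>2"
  have R0: "real_of_int R ^ CARD('n) > 0" using R by simp
  have "real_of_int R ^ CARD('n) \<le> V"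
    unfolding V_def card_cube[OF R] using R by (intro power_mono) auto
  then have V: "0 < V" "real_of_int R ^ CARD('n) \<le> V" using R0 by linarith+
  have \<phi>1: "\<phi> v = 1" if "v \<in> cube R" for v :: "int ^ 'n"
    using that by (auto simp: \<phi>_def cube_def intro!: prod.neutral)
  have \<phi>_le: "\<phi> v \<le> 1" for v :: "int ^ 'n"
    by (cases "v \<in> cube R") (simp_all add: \<phi>1 \<phi>_supp)
  have sf2: "(\<lambda>x. (f x)\<^sup>2) summable_on UNIV" using f by (rule summable_on_square)
  have sE: "(\<lambda>(x, y). w x y * (f y - f x)\<^sup>2) summable_on edges"
  proof -
    obtain B where B: "\<And>x. \<bar>f x\<bar> \<le> B" using summable_on_imp_bounded[OF f] by blast
    show ?thesis using summation_by_parts(1)[OF f, of f B, OF B]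
      by (simp add: power2_eq_square mult.assoc)
  qed
  have \<Gamma>: "(\<Gamma> has_sum E) UNIV"
    unfolding \<Gamma>_def E_def by (rule edge_infsum[OF sE])
  have A_le: "(\<Sum>v\<in>cube R. \<bar>f (z + v)\<bar>) \<le> A" for z
  proof -
    have "(\<Sum>v\<in>cube R. \<bar>f (z + v)\<bar>) = (\<Sum>x\<in>(\<lambda>v. z + v) ` cube R. \<bar>f x\<bar>)"
      by (subst sum.reindex) auto
    also have "\<dots> \<le> A"
      unfolding A_def by (rule finite_sum_le_infsum[OF summable_on_abs[OF f]]) auto
    finally show ?thesis .
  qed
  have "V * (\<Sum>v\<in>cube R. (f (z + v))\<^sup>2) \<le> A * (\<Sum>v\<in>cube R. \<bar>f (z + v)\<bar>) + b * V * (\<Sum>v\<in>cube R. \<Gamma> (z + v))" for z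
  proof -
    have 1: "V * (\<Sum>v\<in>cube R. (f (z + v))\<^sup>2) - (\<Sum>v\<in>cube R. f (z + v))\<^sup>2
      \<le> 2 ^ CARD('n) * 4 * (real_of_int R)\<^sup>2 * V * (\<Sum>v\<in>cube R. \<Sum>i\<in>UNIV. grad_energy (\<lambda>v. f (z + v)) i v)"
      using weighted_poincare[of "\<lambda>v. f (z + v)"] by (simp add: \<phi>1 V_def)
    have 2: "(\<Sum>v\<in>cube R. \<Sum>i\<in>UNIV. grad_energy (\<lambda>v. f (z + v)) i v) \<le> (\<Sum>v\<in>cube R. \<Gamma> (z + v) / c)"
    proof (rule sum_mono)
      fix v :: "int ^ 'n" assume "v \<in> cube R"
      have "(\<Sum>i\<in>UNIV. grad_energy (\<lambda>v. f (z + v)) i v) \<le> (\<Sum>i\<in>UNIV. (f (z + v + axis i 1) - f (z + v))\<^sup>2)"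
        unfolding grad_energy_def add.assoc
        by (intro sum_mono mult_left_le_one_le) (auto simp: \<phi>_nonneg \<phi>_le min_le_iff_disj)
      also have "\<dots> \<le> \<Gamma> (z + v) / c"
        unfolding \<Gamma>_def by (rule axis_sum_le) simp
      finally show "(\<Sum>i\<in>UNIV. grad_energy (\<lambda>v. f (z + v)) i v) \<le> \<Gamma> (z + v) / c" .
    qed
    \<comment> \<open>The square of a local sum is bounded by the global l1 norm times the local sum
      of |f|; after summation over \<open>z\<close> this gives \<open>A * (V * A)\<close>.\<close>
    have 3: "(\<Sum>v\<in>cube R. f (z + v))\<^sup>2 \<le> A * (\<Sum>v\<in>cube R. \<bar>f (z + v)\<bar>)"
    proof -
      have "(\<Sum>v\<in>cube R. f (z + v))\<^sup>2 = \<bar>\<Sum>v\<in>cube R. f (z + v)\<bar> * \<bar>\<Sum>v\<in>cube R. f (z + v)\<bar>"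
        by (simp add: power2_eq_square)
      also have "\<dots> \<le> A * (\<Sum>v\<in>cube R. \<bar>f (z + v)\<bar>)"
        by (rule mult_mono) (auto intro: order_trans[OF sum_abs A_le] order_trans[OF sum_nonneg A_le])
      finally show ?thesis .
    qed
    have "2 ^ CARD('n) * 4 * (real_of_int R)\<^sup>2 * V * (\<Sum>v\<in>cube R. \<Sum>i\<in>UNIV. grad_energy (\<lambda>v. f (z + v)) i v)
        \<le> 2 ^ CARD('n) * 4 * (real_of_int R)\<^sup>2 * V * (\<Sum>v\<in>cube R. \<Gamma> (z + v) / c)"
      using 2 V(1) by (intro mult_left_mono) auto
    also have "\<dots> = b * V * (\<Sum>v\<in>cube R. \<Gamma> (z + v))"
      by (simp add: b_def sum_divide_distrib[symmetric])
    finally show ?thesis using 1 3 by linarith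
  qed
  \<comment> \<open>Summation over all \<open>z\<close>: every vertex is covered by exactly
    \<open>V\<close> translates, so each local sum becomes \<open>V\<close> times a global
    one.\<close>
  then have "V * (V * (\<Sum>\<^sub>\<infinity>x. (f x)\<^sup>2)) \<le> A * (V * A) + b * V * (V * E)"
    using has_sum_mono[OF has_sum_cmult_right[OF has_sum_translates[OF sf2, of R], of V]
        has_sum_add[OF has_sum_cmult_right[OF has_sum_translates[OF summable_on_abs[OF f], of R], of A]
          has_sum_cmult_right[OF has_sum_translates[OF has_sum_imp_summable[OF \<Gamma>], of R], of "b * V"]]]
      infsumI[OF \<Gamma>]
    by (simp add: V_def A_def)
  then have "V * (V * (\<Sum>\<^sub>\<infinity>x. (f x)\<^sup>2)) \<le> V * (A\<^sup>2 + V * (b * E))"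
    by (simp add: power2_eq_square algebra_simps)
  then have "V * (\<Sum>\<^sub>\<infinity>x. (f x)\<^sup>2) \<le> A\<^sup>2 + V * (b * E)"
    using V(1) by (simp only: mult_le_cancel_left_pos)
  then have "(\<Sum>\<^sub>\<infinity>x. (f x)\<^sup>2) \<le> A\<^sup>2 / V + b * E"
    using V(1) by (simp add: field_simps)
  also have "A\<^sup>2 / V \<le> A\<^sup>2 / real_of_int R ^ CARD('n)"
    using V R0 by (intro divide_left_mono) auto
  finally show ?thesis by (simp add: A_def b_def E_def)
qed

section \<open>On-diagonal decay\<close>

definition energy :: "int ^ 'n \<Rightarrow> real \<Rightarrow> real" where
  "energy y s = (\<Sum>\<^sub>\<infinity>z. (p s z y)\<^sup>2 * m z)"

definition dirichlet :: "int ^ 'n \<Rightarrow> real \<Rightarrow> real" where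
  "dirichlet y s = (\<Sum>\<^sub>\<infinity>(x, z)\<in>edges. w x z * (p s z y - p s x y)\<^sup>2)"

lemma energy_summable: "(\<lambda>z. (p s z y)\<^sup>2 * m z) summable_on UNIV"
  using weighted_summable[of "\<lambda>_. 1" y 1 s] by simp

lemma energy_deriv: "(energy y has_real_derivative - dirichlet y s) (at s)"
  using weighted_energy_deriv(1)[of "\<lambda>_. 1" y 1 s]
  by (simp add: energy_def[abs_def] dirichlet_def power2_eq_square mult.assoc)

lemma energy_eq: "0 \<le> s \<Longrightarrow> energy y s = p (s + s) y y"
  using p_semigroup[of s s y y] by (simp add: energy_def power2_eq_square has_sum_iff)

lemma dirichlet_nonneg: "0 \<le> dirichlet y s"
  unfolding dirichlet_def
  by (rule infsum_nonneg) (auto simp: edges_def w_pos less_imp_le)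

lemma energy_antimono: "s \<le> t \<Longrightarrow> energy y t \<le> energy y s"
  by (rule nonincreasing_if_deriv_nonpos[OF _ energy_deriv]) (simp_all add: dirichlet_nonneg)

lemma energy_0: "energy y 0 \<le> 1 / c"
  using m_ge[of y] c_pos by (simp add: energy_eq p_0 frac_le)

lemma energy_nash:
  assumes s: "0 \<le> s" and R: "R \<ge> 1"
  shows "energy y s \<le> (M * 2 ^ CARD('n) * 4 / c) * (real_of_int R)\<^sup>2 * dirichlet y s + M / c\<^sup>2 / real_of_int R ^ CARD('n)"
proof -
  have sq: "(\<lambda>x. (p s x y)\<^sup>2) summable_on UNIV" using p_summable by (rule summable_on_square)
  have "energy y s \<le> (\<Sum>\<^sub>\<infinity>x. M * (p s x y)\<^sup>2)"
    unfolding energy_def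
    by (rule infsum_mono[OF energy_summable summable_on_cmult_right[OF sq]])
       (simp add: m_le mult_right_mono mult.commute)
  also have "\<dots> = M * (\<Sum>\<^sub>\<infinity>x. (p s x y)\<^sup>2)" by (rule infsum_cmult_right')
  also have "\<dots> \<le> M * (2 ^ CARD('n) * 4 / c * (real_of_int R)\<^sup>2 * dirichlet y s
      + (\<Sum>\<^sub>\<infinity>x. \<bar>p s x y\<bar>)\<^sup>2 / real_of_int R ^ CARD('n))"
    unfolding dirichlet_def using M_pos by (intro mult_left_mono nash[OF p_summable R]) auto
  also have "\<dots> \<le> M * (2 ^ CARD('n) * 4 / c * (real_of_int R)\<^sup>2 * dirichlet y s + (1 / c)\<^sup>2 / real_of_int R ^ CARD('n))"
  proof -
    have "(\<Sum>\<^sub>\<infinity>x. \<bar>p s x y\<bar>) \<le> (\<Sum>\<^sub>\<infinity>x. p s x y * m x / c)"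
    proof (rule infsum_mono[OF summable_on_abs[OF p_summable]])
      show "(\<lambda>x. p s x y * m x / c) summable_on UNIV"
        using summable_on_cmult_left[OF has_sum_imp_summable[OF p_mass[of s y]], of "1 / c"] by simp
      show "\<bar>p s x y\<bar> \<le> p s x y * m x / c" for x
        using mult_left_mono[OF m_ge[of x] p_nonneg[OF s, of x y]] p_nonneg[OF s, of x y] c_pos
        by (simp add: field_simps)
    qed
    also have "\<dots> = 1 / c"
      using infsum_cmult_left'[of "\<lambda>x. p s x y * m x" "1 / c" UNIV] infsumI[OF p_mass[of s y]] by simp
    finally have "(\<Sum>\<^sub>\<infinity>x. \<bar>p s x y\<bar>)\<^sup>2 \<le> (1 / c)\<^sup>2" by (rule power_mono) (simp add: infsum_nonneg)
    then show ?thesis using M_pos R by (intro mult_left_mono add_left_mono divide_right_mono) auto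
  qed
  finally show ?thesis by (simp add: power_divide algebra_simps)
qed

text \<open>With \<open>t = s\<^sup>2\<close> and \<open>R\<close> a small multiple of \<open>s\<close>, the Nash inequality is linear in the energy,
  and \<open>s ^ (d + 1)\<close> is an integrating factor.\<close>

lemma energy_upper: "\<exists>K>0. \<forall>s>0. \<forall>y. energy y (s\<^sup>2) \<le> K / s ^ CARD('n)"
proof -
  define a b where "a = M * 2 ^ CARD('n) * 4 / c" and "b = M / c\<^sup>2"
  have a: "a > 0" and b: "b > 0" using M_pos c_pos by (auto simp: a_def b_def)
  \<comment> \<open>Chosen so that a \<delta>^2 (d + 1) = 2: with the radius at most \<delta> s, the
    Dirichlet term then has exactly the coefficient 2 s that occurs in the derivative of
    \<open>energy y (s\<^sup>2)\<close>.\<close>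
  define \<delta> where "\<delta> = sqrt (2 / (a * (CARD('n) + 1)))"
  have \<delta>: "\<delta> > 0" using a by (simp add: \<delta>_def)
  have \<delta>2: "a * \<delta>\<^sup>2 * (CARD('n) + 1) = 2"
  proof -
    define X where "X = real (CARD('n) + 1)"
    have X: "X > 0" by (simp add: X_def)
    then have "\<delta>\<^sup>2 = 2 / (a * X)" unfolding \<delta>_def X_def[symmetric] using a by simp
    then have "a * \<delta>\<^sup>2 * X = 2" using a X by simp
    then show ?thesis by (simp add: X_def)
  qed
  \<comment> \<open>For s >= s0 the radius floor(\<delta> s) is at least 1; for smaller s the
    trivial bound 1/c is used.\<close>
  define s0 where "s0 = 1 / \<delta>"
  have s0: "s0 > 0" using \<delta> by (simp add: s0_def)
  define C where "C = (CARD('n) + 1) * b * (2 / \<delta>) ^ CARD('n)"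
  have C: "C > 0" using b \<delta> by (simp add: C_def)
  define K where "K = s0 ^ CARD('n) / c + C"
  have K: "K > 0" using s0 c_pos C by (simp add: K_def add_pos_pos)
  have small: "energy y (s\<^sup>2) \<le> 1 / c" for s y
    using energy_antimono[of 0 "s\<^sup>2" y] energy_0[of y] by simp
  have diff: "- (2 * s * dirichlet y (s\<^sup>2)) \<le> - (real (CARD('n) + 1) / s) * energy y (s\<^sup>2) + C / s ^ Suc CARD('n)"
    if s: "s \<ge> s0" for s y
  proof -
    have sp: "s > 0" using s s0 by linarith
    have \<delta>s: "1 \<le> \<delta> * s" using s \<delta> by (simp add: s0_def field_simps)
    define R where "R = \<lfloor>\<delta> * s\<rfloor>"
    have R: "R \<ge> 1" using \<delta>s by (simp add: R_def le_floor_iff)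
    have R1: "real_of_int R \<le> \<delta> * s" by (simp add: R_def)
    have "\<delta> * s < real_of_int R + 1" unfolding R_def by linarith
    moreover have "1 \<le> real_of_int R" using R by simp
    ultimately have R2: "\<delta> * s / 2 \<le> real_of_int R" by linarith
    let ?D = "dirichlet y (s\<^sup>2)"
    have e1: "energy y (s\<^sup>2) \<le> a * (real_of_int R)\<^sup>2 * ?D + b / real_of_int R ^ CARD('n)"
      using energy_nash[OF _ R, of "s\<^sup>2" y] by (simp add: a_def b_def)
    have e2: "a * (real_of_int R)\<^sup>2 * ?D \<le> a * (\<delta> * s)\<^sup>2 * ?D"
      using a R R1 dirichlet_nonneg by (intro mult_right_mono mult_left_mono power_mono) auto
    have e3: "b / real_of_int R ^ CARD('n) \<le> b / (\<delta> * s / 2) ^ CARD('n)"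
      using b R2 \<delta> sp R by (intro divide_left_mono power_mono mult_pos_pos zero_less_power) auto
    from e1 e2 e3 have *: "energy y (s\<^sup>2) \<le> a * (\<delta> * s)\<^sup>2 * ?D + b / (\<delta> * s / 2) ^ CARD('n)"
      by linarith
    have "real (CARD('n) + 1) / s * energy y (s\<^sup>2) \<le> real (CARD('n) + 1) / s * (a * (\<delta> * s)\<^sup>2 * ?D + b / (\<delta> * s / 2) ^ CARD('n))"
      using * sp by (intro mult_left_mono) auto
    also have "\<dots> = (a * \<delta>\<^sup>2 * (CARD('n) + 1)) * s * ?D + C / s ^ Suc CARD('n)"
      using sp \<delta> by (simp add: C_def power_mult_distrib power_divide power2_eq_square field_simps)
    finally show ?thesis unfolding \<delta>2 by simp
  qed
  have "energy y (s\<^sup>2) \<le> K / s ^ CARD('n)" if s: "s > 0" for s y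
  proof (cases "s \<le> s0")
    case True
    have "energy y (s\<^sup>2) \<le> 1 / c * 1" using small by simp
    also have "\<dots> \<le> 1 / c * (s0 ^ CARD('n) / s ^ CARD('n))"
      using True s c_pos by (intro mult_left_mono) (auto simp: power_mono)
    also have "\<dots> \<le> K / s ^ CARD('n)" using C s by (simp add: K_def add_divide_distrib)
    finally show ?thesis .
  next
    case False
    define h where "h = (\<lambda>s. s ^ Suc CARD('n) * energy y (s\<^sup>2) - C * s)"
    have "h s \<le> h s0"
    proof (rule DERIV_nonpos_imp_nonincreasing[of s0 s h])
      fix r assume r: "s0 \<le> r" "r \<le> s"
      have d: "((\<lambda>s. energy y (s\<^sup>2)) has_real_derivative - (2 * r * dirichlet y (r\<^sup>2))) (at r)"
      proof -
        have "((\<lambda>s. s\<^sup>2) has_real_derivative 2 * r) (at r)" by (auto intro!: derivative_eq_intros)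
        from DERIV_chain2[where f = "energy y" and g = "\<lambda>s. s\<^sup>2", OF energy_deriv this]
        show ?thesis by (simp add: mult_ac)
      qed
      have "(h has_real_derivative (real (Suc CARD('n)) * r ^ CARD('n) * energy y (r\<^sup>2)
          + r ^ Suc CARD('n) * (- (2 * r * dirichlet y (r\<^sup>2))) - C)) (at r)"
      proof -
        have "((\<lambda>s. s ^ Suc CARD('n)) has_real_derivative real (Suc CARD('n)) * r ^ CARD('n)) (at r)"
          using DERIV_pow[of "Suc CARD('n)" r] by simp
        from DERIV_diff[OF DERIV_mult'[OF this d] DERIV_cmult[OF DERIV_ident, of C]]
        show ?thesis unfolding h_def by (simp add: add.commute)
      qed
      moreover have "r ^ Suc CARD('n) * (- (2 * r * dirichlet y (r\<^sup>2)))
          \<le> r ^ Suc CARD('n) * (- (real (CARD('n) + 1) / r) * energy y (r\<^sup>2) + C / r ^ Suc CARD('n))"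
        using diff[OF r(1)] r s0 by (intro mult_left_mono) auto
      moreover have "r ^ Suc CARD('n) * (- (real (CARD('n) + 1) / r) * energy y (r\<^sup>2) + C / r ^ Suc CARD('n))
          = - (real (Suc CARD('n)) * r ^ CARD('n) * energy y (r\<^sup>2)) + C"
        using r s0 by (simp add: field_simps)
      ultimately show "\<exists>D. (h has_real_derivative D) (at r) \<and> D \<le> 0"
        by (intro exI conjI) (assumption, linarith)
    qed (use False in simp)
    then have "s ^ Suc CARD('n) * energy y (s\<^sup>2) \<le> s0 ^ Suc CARD('n) * energy y (s0\<^sup>2) + C * (s - s0)"
      by (simp add: h_def algebra_simps)
    also have "\<dots> \<le> s0 ^ Suc CARD('n) * (1 / c) + C * s"
      using small[of y s0] s0 C by (intro add_mono mult_left_mono) auto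
    also have "s0 ^ Suc CARD('n) * (1 / c) \<le> s * s0 ^ CARD('n) * (1 / c)"
      using False s0 c_pos by (simp add: divide_right_mono mult_right_mono)
    finally have "s * (s ^ CARD('n) * energy y (s\<^sup>2)) \<le> s * K" by (simp add: K_def algebra_simps)
    then have "s ^ CARD('n) * energy y (s\<^sup>2) \<le> K" using s by simp
    then show ?thesis using s by (simp add: field_simps)
  qed
  then show ?thesis using K by blast
qed

section \<open>Polynomial moments of the kernel\<close>

definition rho :: "int ^ 'n \<Rightarrow> int ^ 'n \<Rightarrow> real" where
  "rho y z = 1 + l1 (z - y)"

lemma rho_ge_1: "1 \<le> rho y z"
  by (simp add: rho_def)

lemma rho_power_nonneg: "0 \<le> rho y z ^ n"
  using rho_ge_1[of y z] by simp

lemma rho_adj: "adj x z \<Longrightarrow> \<bar>rho y z - rho y x\<bar> \<le> 1"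
  using l1_neighbour[of x z y] l1_neighbour[of z x y] adj_commute by (fastforce simp: rho_def abs_le_iff)

text \<open>Supplies the growth condition of \<open>weighted_summable\<close> and
  \<open>weighted_energy_deriv\<close> for powers of \<open>rho\<close>.\<close>

lemma rho_power_exp: "\<bar>rho y z ^ n\<bar> * exp (- l1 (z - y)) \<le> fact n * exp 1"
proof -
  have "rho y z ^ n \<le> fact n * exp (rho y z)"
    by (rule power_over_fact_le_exp) (simp add: rho_def)
  then have "rho y z ^ n * exp (- l1 (z - y)) \<le> fact n * exp (rho y z) * exp (- l1 (z - y))"
    by (rule mult_right_mono) simp
  also have "\<dots> = fact n * exp 1" by (simp add: rho_def exp_add exp_minus field_simps)
  finally show ?thesis using rho_ge_1[of y z] by simp
qed

lemmas moment_summable = weighted_summable[OF rho_power_exp]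

text \<open>The weight is the square of rho^(d+1), the factor that one kernel has to carry when two
  kernels are paired by the semigroup law.\<close>

definition moment :: "int ^ 'n \<Rightarrow> real \<Rightarrow> real" where
  "moment y s = (\<Sum>\<^sub>\<infinity>z. rho y z ^ (2 * Suc CARD('n)) * (p s z y)\<^sup>2 * m z)"

lemma moment_nonneg: "0 \<le> moment y s"
  unfolding moment_def
proof (rule infsum_nonneg)
  show "0 \<le> rho y z ^ (2 * Suc CARD('n)) * (p s z y)\<^sup>2 * m z" for z
    by (intro mult_nonneg_nonneg rho_power_nonneg zero_le_power2 m_nonneg)
qed

lemma moment_0: "moment y 0 \<le> 1 / c"
proof -
  have "moment y 0 = (\<Sum>\<^sub>\<infinity>z. indicator {y} z * (rho y z ^ (2 * Suc CARD('n)) * p 0 z y * m z / m y))"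
    unfolding moment_def by (rule infsum_cong) (simp add: p_0 power2_eq_square)
  also have "\<dots> = 1 / m y" by (simp only: infsum_indicator_single) (simp add: rho_def p_0)
  also have "\<dots> \<le> 1 / c" using m_ge c_pos by (intro divide_left_mono) auto
  finally show ?thesis .
qed

text \<open>With weights a^2 and b^2 at the ends of an edge only u v (b - a)^2 can increase the
  moment. The product u v is split by the arithmetic-geometric inequality, and (b - a)^2 is of order
  rho^(2d), two powers below the weight itself.\<close>

lemma moment_deriv:
  obtains D where "(moment y has_real_derivative D) (at s)"
    and "0 \<le> s \<Longrightarrow> D \<le> 4 ^ Suc CARD('n) * (\<Sum>\<^sub>\<infinity>z. rho y z ^ (2 * CARD('n)) * (p s z y)\<^sup>2 * m z)"
proof
  let ?N = "Suc CARD('n)"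
  let ?k = "\<lambda>z. rho y z ^ (2 * ?N)" and ?u = "\<lambda>z. p s z y"
  let ?F = "\<lambda>x z. w x z * (?u z - ?u x) * (?k z * ?u z - ?k x * ?u x)"
  let ?g = "\<lambda>z. rho y z ^ (2 * CARD('n)) * (?u z)\<^sup>2"
  show "(moment y has_real_derivative - (\<Sum>\<^sub>\<infinity>(x, z)\<in>edges. ?F x z)) (at s)"
    unfolding moment_def[abs_def] by (rule weighted_energy_deriv(1)[OF rho_power_exp])
  assume s: "0 \<le> s"
  have sg: "?g summable_on UNIV"
  proof (rule summable_on_bound[OF summable_on_cmult_left[OF moment_summable[of y "2 * CARD('n)" s], of "1 / c"]])
    fix z
    have "?g z * c \<le> ?g z * m z" using rho_power_nonneg by (intro mult_left_mono m_ge) simp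
    moreover have "0 \<le> ?g z" using rho_power_nonneg by simp
    ultimately show "\<bar>?g z\<bar> \<le> ?g z * m z * (1 / c)" using c_pos by (simp add: field_simps)
  qed
  have sF: "(\<lambda>(x, z). - ?F x z) summable_on edges"
    using weighted_energy_deriv(2)[of ?k y _ s, OF rho_power_exp]
    by (simp only: case_prod_unfold summable_on_uminus)
  let ?H = "\<lambda>x z. 4 ^ ?N / 2 * (w x z * ?g x + w x z * ?g z)"
  have s1: "(\<lambda>(x, z). w x z * ?g x) summable_on edges" by (rule edge_summable[OF sg])
  have s2: "(\<lambda>(x, z). w x z * ?g z) summable_on edges" by (rule edge_summable'[OF sg])
  have s12: "(\<lambda>(x, z). w x z * ?g x + w x z * ?g z) summable_on edges"
    using summable_on_add[OF s1 s2] by (simp add: case_prod_unfold)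
  have "- (\<Sum>\<^sub>\<infinity>(x, z)\<in>edges. ?F x z) = (\<Sum>\<^sub>\<infinity>(x, z)\<in>edges. - ?F x z)"
    by (simp add: case_prod_unfold infsum_uminus)
  also have "\<dots> \<le> (\<Sum>\<^sub>\<infinity>(x, z)\<in>edges. ?H x z)"
  proof (rule infsum_mono[OF sF])
    show "(\<lambda>(x, z). ?H x z) summable_on edges"
      using summable_on_cmult_right[OF s12] by (simp add: case_prod_unfold)
    fix e assume "e \<in> edges"
    then obtain x z where e: "e = (x, z)" and xz: "adj x z" by (auto simp: edges_def)
    have zx: "adj z x" using xz adj_commute by blast
    let ?a = "rho y x ^ ?N" and ?b = "rho y z ^ ?N"
    \<comment> \<open>Available from either end, so that each squared kernel value meets the weight
      at its own vertex.\<close>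
    have sq: "(rho y z' ^ ?N - rho y x' ^ ?N)\<^sup>2 \<le> 4 ^ ?N * rho y x' ^ (2 * CARD('n))" if "adj x' z'" for x' z'
    proof -
      have "\<bar>rho y z' ^ ?N - rho y x' ^ ?N\<bar> \<le> (2 ^ ?N - 1) * rho y x' ^ CARD('n)"
        using rho_ge_1[of y x'] rho_ge_1[of y z'] rho_adj[OF that] by (intro power_diff_le) auto
      also have "\<dots> \<le> 2 ^ ?N * rho y x' ^ CARD('n)"
        using rho_ge_1[of y x'] by (intro mult_right_mono) auto
      finally have "\<bar>rho y z' ^ ?N - rho y x' ^ ?N\<bar>\<^sup>2 \<le> (2 ^ ?N * rho y x' ^ CARD('n))\<^sup>2"
        by (rule power_mono) simp
      also have "\<dots> = 4 ^ ?N * rho y x' ^ (2 * CARD('n))"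
        by (simp only: power_mult_distrib power_mult[symmetric] mult.commute[of _ 2]) (simp only: power_mult, simp)
      finally show ?thesis by simp
    qed
    have "- ((?u z - ?u x) * (?b\<^sup>2 * ?u z - ?a\<^sup>2 * ?u x))
        = ?u z * ?u x * (?b - ?a)\<^sup>2 - (?b * ?u z - ?a * ?u x)\<^sup>2"
      by (simp add: power2_eq_square algebra_simps)
    also have "\<dots> \<le> ?u z * ?u x * (?b - ?a)\<^sup>2" by simp
    also have "\<dots> \<le> ((?u x)\<^sup>2 / 2 + (?u z)\<^sup>2 / 2) * (?b - ?a)\<^sup>2"
    proof (rule mult_right_mono)
      show "?u z * ?u x \<le> (?u x)\<^sup>2 / 2 + (?u z)\<^sup>2 / 2"
        using zero_le_power2[of "?u x - ?u z"] by (simp add: power2_eq_square algebra_simps)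
    qed simp
    also have "\<dots> = (?u x)\<^sup>2 / 2 * (?b - ?a)\<^sup>2 + (?u z)\<^sup>2 / 2 * (?a - ?b)\<^sup>2"
      by (simp add: distrib_right power2_commute)
    also have "\<dots> \<le> (?u x)\<^sup>2 / 2 * (4 ^ ?N * rho y x ^ (2 * CARD('n))) + (?u z)\<^sup>2 / 2 * (4 ^ ?N * rho y z ^ (2 * CARD('n)))"
      using sq[OF xz] sq[OF zx] by (intro add_mono mult_left_mono) auto
    also have "\<dots> = 4 ^ ?N / 2 * (?g x + ?g z)" by (simp add: algebra_simps)
    finally have "w x z * - ((?u z - ?u x) * (?b\<^sup>2 * ?u z - ?a\<^sup>2 * ?u x)) \<le> w x z * (4 ^ ?N / 2 * (?g x + ?g z))"
      by (rule mult_left_mono) (simp add: w_pos xz less_imp_le)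
    moreover have "?b\<^sup>2 = ?k z" "?a\<^sup>2 = ?k x" by (simp_all only: power_mult[symmetric] mult.commute[of _ 2])
    ultimately have "- ?F x z \<le> ?H x z" by (simp add: algebra_simps)
    then show "(case e of (x, z) \<Rightarrow> - ?F x z) \<le> (case e of (x, z) \<Rightarrow> ?H x z)" using e by simp
  qed
  also have "\<dots> = 4 ^ ?N / 2 * (\<Sum>\<^sub>\<infinity>(x, z)\<in>edges. w x z * ?g x + w x z * ?g z)"
    by (simp add: case_prod_unfold infsum_cmult_right')
  also have "(\<Sum>\<^sub>\<infinity>(x, z)\<in>edges. w x z * ?g x + w x z * ?g z)
      = (\<Sum>\<^sub>\<infinity>(x, z)\<in>edges. w x z * ?g x) + (\<Sum>\<^sub>\<infinity>(x, z)\<in>edges. w x z * ?g z)"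
    using infsum_add[OF s1 s2] by (simp add: case_prod_unfold)
  also have "(\<Sum>\<^sub>\<infinity>(x, z)\<in>edges. w x z * ?g z) = (\<Sum>\<^sub>\<infinity>(x, z)\<in>edges. w x z * ?g x)"
    using edge_infsum_swap[of "\<lambda>x z. w x z * ?g x"] w_sym by simp
  also have "(\<Sum>\<^sub>\<infinity>(x, z)\<in>edges. w x z * ?g x) = (\<Sum>\<^sub>\<infinity>z. ?g z * m z)"
    using edge_infsum_vertex[OF sg] by (simp add: mult.commute)
  finally show "- (\<Sum>\<^sub>\<infinity>(x, z)\<in>edges. ?F x z) \<le> 4 ^ ?N * (\<Sum>\<^sub>\<infinity>z. ?g z * m z)"
    by (simp add: field_simps)
qed

text \<open>Where rho <= \<sigma> the weight is at most \<sigma>^(2d); elsewhere two extra powers of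
  rho are paid for by \<sigma>^(-2). This closes the differential inequality in terms of the moment
  and the energy.\<close>

lemma moment_young:
  assumes \<sigma>: "\<sigma> > 0"
  shows "(\<Sum>\<^sub>\<infinity>z. rho y z ^ (2 * CARD('n)) * (p s z y)\<^sup>2 * m z) \<le> moment y s / \<sigma>\<^sup>2 + \<sigma> ^ (2 * CARD('n)) * energy y s"
proof -
  have s1: "(\<lambda>z. 1 / \<sigma>\<^sup>2 * (rho y z ^ (2 * Suc CARD('n)) * (p s z y)\<^sup>2 * m z)) summable_on UNIV"
    by (rule summable_on_cmult_right[OF moment_summable])
  have s2: "(\<lambda>z. \<sigma> ^ (2 * CARD('n)) * ((p s z y)\<^sup>2 * m z)) summable_on UNIV"
    by (rule summable_on_cmult_right[OF energy_summable])
  have "(\<Sum>\<^sub>\<infinity>z. rho y z ^ (2 * CARD('n)) * (p s z y)\<^sup>2 * m z)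
     \<le> (\<Sum>\<^sub>\<infinity>z. 1 / \<sigma>\<^sup>2 * (rho y z ^ (2 * Suc CARD('n)) * (p s z y)\<^sup>2 * m z) + \<sigma> ^ (2 * CARD('n)) * ((p s z y)\<^sup>2 * m z))"
  proof (rule infsum_mono[OF moment_summable summable_on_add[OF s1 s2]])
    fix z
    have r: "rho y z ^ (2 * CARD('n)) \<le> rho y z ^ (2 * Suc CARD('n)) / \<sigma>\<^sup>2 + \<sigma> ^ (2 * CARD('n))"
    proof (cases "rho y z \<le> \<sigma>")
      case True
      then have "rho y z ^ (2 * CARD('n)) \<le> \<sigma> ^ (2 * CARD('n))" using rho_ge_1[of y z] by (intro power_mono) auto
      moreover have "0 \<le> rho y z ^ (2 * Suc CARD('n)) / \<sigma>\<^sup>2" using rho_ge_1[of y z] by simp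
      ultimately show ?thesis by linarith
    next
      case False
      then have "\<sigma>\<^sup>2 \<le> (rho y z)\<^sup>2" using \<sigma> by (intro power_mono) auto
      then have "rho y z ^ (2 * CARD('n)) * \<sigma>\<^sup>2 \<le> rho y z ^ (2 * CARD('n)) * (rho y z)\<^sup>2"
        using rho_ge_1[of y z] by (intro mult_left_mono) auto
      then have "rho y z ^ (2 * CARD('n)) \<le> rho y z ^ (2 * Suc CARD('n)) / \<sigma>\<^sup>2"
        using \<sigma> by (simp add: field_simps power2_eq_square)
      moreover have "0 \<le> \<sigma> ^ (2 * CARD('n))" using \<sigma> by simp
      ultimately show ?thesis by linarith
    qed
    have "rho y z ^ (2 * CARD('n)) * ((p s z y)\<^sup>2 * m z)
        \<le> (rho y z ^ (2 * Suc CARD('n)) / \<sigma>\<^sup>2 + \<sigma> ^ (2 * CARD('n))) * ((p s z y)\<^sup>2 * m z)"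
      using r by (rule mult_right_mono) simp
    then show "rho y z ^ (2 * CARD('n)) * (p s z y)\<^sup>2 * m z
      \<le> 1 / \<sigma>\<^sup>2 * (rho y z ^ (2 * Suc CARD('n)) * (p s z y)\<^sup>2 * m z) + \<sigma> ^ (2 * CARD('n)) * ((p s z y)\<^sup>2 * m z)"
      by (simp add: algebra_simps)
  qed
  also have "\<dots> = 1 / \<sigma>\<^sup>2 * moment y s + \<sigma> ^ (2 * CARD('n)) * energy y s"
    by (simp only: infsum_add[OF s1 s2] infsum_cmult_right' moment_def energy_def)
  finally show ?thesis by simp
qed

text \<open>A Gronwall estimate on a short initial interval, with rho^(2d) <= rho^(2d+2). It
  provides a starting value away from time 0, where the energy bound K / s^d blows up.\<close>

lemma moment_initial: "moment y (1 / 4) \<le> exp (4 ^ Suc CARD('n)) / c"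
proof -
  let ?a = "(4 :: real) ^ Suc CARD('n)"
  have "exp (- ?a * (1 / 4)) * moment y (1 / 4) \<le> exp (- ?a * 0) * moment y 0"
  proof (rule DERIV_nonpos_imp_nonincreasing[of 0 "1 / 4" "\<lambda>s. exp (- ?a * s) * moment y s"])
    fix s :: real assume s: "0 \<le> s" "s \<le> 1 / 4"
    obtain D where D: "(moment y has_real_derivative D) (at s)"
      and Dle: "D \<le> ?a * (\<Sum>\<^sub>\<infinity>z. rho y z ^ (2 * CARD('n)) * (p s z y)\<^sup>2 * m z)"
      using moment_deriv[of y s] s by blast
    have "(\<Sum>\<^sub>\<infinity>z. rho y z ^ (2 * CARD('n)) * (p s z y)\<^sup>2 * m z) \<le> moment y s"
      unfolding moment_def using rho_ge_1
      by (intro infsum_mono[OF moment_summable moment_summable] mult_right_mono power_increasing) auto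
    then have "?a * (\<Sum>\<^sub>\<infinity>z. rho y z ^ (2 * CARD('n)) * (p s z y)\<^sup>2 * m z) \<le> ?a * moment y s"
      by (rule mult_left_mono) simp
    then have "D - ?a * moment y s \<le> 0" using Dle by linarith
    then have "exp (- ?a * s) * (D - ?a * moment y s) \<le> 0" by (simp add: mult_nonneg_nonpos)
    moreover have "((\<lambda>s. exp (- ?a * s) * moment y s) has_real_derivative
        exp (- ?a * s) * (D - ?a * moment y s)) (at s)"
      by (auto intro!: derivative_eq_intros D simp: algebra_simps)
    ultimately show "\<exists>D. ((\<lambda>s. exp (- ?a * s) * moment y s) has_real_derivative D) (at s) \<and> D \<le> 0" by blast
  qed simp
  also have "\<dots> \<le> 1 / c" using moment_0 by simp
  finally have "moment y (1 / 4) \<le> exp (?a / 4) * (1 / c)"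
    by (simp add: exp_minus field_simps)
  also have "\<dots> \<le> exp ?a * (1 / c)" using c_pos by (intro mult_right_mono) auto
  finally show ?thesis by simp
qed

lemma moment_upper: "\<exists>B>0. \<forall>s\<ge>1/2. \<forall>y. moment y (s\<^sup>2) \<le> B * s ^ (CARD('n) + 2)"
proof -
  obtain K where K: "K > 0" and KD: "\<And>s y. s > 0 \<Longrightarrow> energy y (s\<^sup>2) \<le> K / s ^ CARD('n)"
    using energy_upper by blast
  let ?N = "Suc CARD('n)"
  \<comment> \<open>In \<open>moment_young\<close> with \<sigma> = q s this turns the factor 4^(d+1)
    into 1/4, small enough for the division by s in \<open>h\<close> below to absorb the moment
    term.\<close>
  define q :: real where "q = 2 * 2 ^ ?N"
  have q: "q > 0" by (simp add: q_def)
  have q2: "q\<^sup>2 = 4 * 4 ^ ?N"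
  proof -
    have "(2 ^ ?N :: real)\<^sup>2 = 4 ^ ?N" by (simp only: power_mult[symmetric] mult.commute[of _ 2]) (simp only: power_mult, simp)
    then show ?thesis by (simp only: q_def power_mult_distrib) simp
  qed
  define C where "C = 2 * 4 ^ ?N * q ^ (2 * CARD('n)) * K"
  have C: "C > 0" using K q by (simp add: C_def)
  define B where "B = 2 ^ (CARD('n) + 2) * (exp (4 ^ ?N) / c) + C"
  have B: "B > 0" using C c_pos by (simp add: B_def add_pos_pos)
  have "moment y (s\<^sup>2) \<le> B * s ^ (CARD('n) + 2)" if s: "s \<ge> 1 / 2" for s y
  proof -
    \<comment> \<open>Division by s contributes - moment / s^2 to the derivative, against at most +
      moment / (2 s^2) from the chain rule; what remains is at most C s^d, the reason for the
      subtracted power.\<close>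
    define h where "h = (\<lambda>s. moment y (s\<^sup>2) / s - C * s ^ Suc CARD('n))"
    have "h s \<le> h (1 / 2)"
    proof (rule DERIV_nonpos_imp_nonincreasing[of "1 / 2" s h])
      fix r :: real assume r: "1 / 2 \<le> r" "r \<le> s"
      then have rp: "r > 0" by linarith
      obtain D where D: "(moment y has_real_derivative D) (at (r\<^sup>2))"
        and Dle: "D \<le> 4 ^ ?N * (\<Sum>\<^sub>\<infinity>z. rho y z ^ (2 * CARD('n)) * (p (r\<^sup>2) z y)\<^sup>2 * m z)"
        using moment_deriv[of y "r\<^sup>2"] by auto
      have "D \<le> 4 ^ ?N * (moment y (r\<^sup>2) / (q * r)\<^sup>2 + (q * r) ^ (2 * CARD('n)) * energy y (r\<^sup>2))"
        using Dle moment_young[of "q * r" y "r\<^sup>2"] q rp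
        by (meson mult_left_mono mult_pos_pos order_trans zero_le_numeral zero_le_power)
      also have "\<dots> \<le> 4 ^ ?N * (moment y (r\<^sup>2) / (q * r)\<^sup>2 + (q * r) ^ (2 * CARD('n)) * (K / r ^ CARD('n)))"
        using KD[OF rp] q rp by (intro mult_left_mono add_left_mono) auto
      also have "\<dots> = moment y (r\<^sup>2) / (4 * r\<^sup>2) + C / 2 * r ^ CARD('n)"
      proof -
        have "r ^ (2 * CARD('n)) = r ^ CARD('n) * r ^ CARD('n)" by (simp add: mult_2 power_add)
        then have "(q * r) ^ (2 * CARD('n)) * (K / r ^ CARD('n)) = q ^ (2 * CARD('n)) * K * r ^ CARD('n)"
          using rp by (simp add: power_mult_distrib)
        moreover have "4 ^ ?N * (moment y (r\<^sup>2) / (q * r)\<^sup>2) = moment y (r\<^sup>2) / (4 * r\<^sup>2)"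
          unfolding power_mult_distrib q2 using rp by (simp add: field_simps)
        ultimately show ?thesis by (simp only: distrib_left) (simp add: C_def)
      qed
      finally have D': "D \<le> moment y (r\<^sup>2) / (4 * r\<^sup>2) + C / 2 * r ^ CARD('n)" .
      have "2 * D - moment y (r\<^sup>2) / r\<^sup>2 - C * (real ?N * r ^ CARD('n)) \<le> 0"
      proof -
        have "0 \<le> moment y (r\<^sup>2) / (4 * r\<^sup>2)" using moment_nonneg by simp
        moreover have "moment y (r\<^sup>2) / r\<^sup>2 = 4 * (moment y (r\<^sup>2) / (4 * r\<^sup>2))" by simp
        moreover have "1 * (C * r ^ CARD('n)) \<le> real ?N * (C * r ^ CARD('n))"
          using C rp by (intro mult_right_mono) auto
        moreover have "C * (real ?N * r ^ CARD('n)) = real ?N * (C * r ^ CARD('n))" by simp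
        ultimately show ?thesis using D' by linarith
      qed
      moreover have "(h has_real_derivative 2 * D - moment y (r\<^sup>2) / r\<^sup>2 - C * (real ?N * r ^ CARD('n))) (at r)"
      proof -
        have "((\<lambda>s. moment y (s\<^sup>2)) has_real_derivative D * (2 * r)) (at r)"
          by (rule DERIV_chain2[where f = "moment y" and g = "\<lambda>s. s\<^sup>2", OF D]) (auto intro!: derivative_eq_intros)
        from DERIV_diff[OF DERIV_divide[OF this DERIV_ident] DERIV_cmult[OF DERIV_pow[of ?N], of C]]
        have "(h has_real_derivative (D * (2 * r) * r - moment y (r\<^sup>2) * 1) / (r * r) - C * (real ?N * r ^ CARD('n))) (at r)"
          unfolding h_def using rp by simp
        moreover have "(D * (2 * r) * r - moment y (r\<^sup>2) * 1) / (r * r) = 2 * D - moment y (r\<^sup>2) / r\<^sup>2"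
          using rp by (simp add: diff_divide_distrib power2_eq_square)
        ultimately show ?thesis by (simp only:)
      qed
      ultimately show "\<exists>D. (h has_real_derivative D) (at r) \<and> D \<le> 0" by blast
    qed (rule s)
    then have "moment y (s\<^sup>2) / s \<le> 2 * moment y (1 / 4) + C * s ^ Suc CARD('n)"
      using C by (simp add: h_def power_divide) (smt (verit) zero_less_power mult_pos_pos divide_pos_pos)
    also have "2 * moment y (1 / 4) \<le> 2 * (exp (4 ^ ?N) / c)" using moment_initial[of y] by linarith
    also have "\<dots> \<le> 2 * (exp (4 ^ ?N) / c) * (2 * s) ^ Suc CARD('n)"
    proof -
      have "1 \<le> (2 * s) ^ Suc CARD('n)" using s by (intro one_le_power) auto
      then have "2 * (exp (4 ^ ?N) / c) * 1 \<le> 2 * (exp (4 ^ ?N) / c) * (2 * s) ^ Suc CARD('n)"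
        using c_pos by (intro mult_left_mono) auto
      then show ?thesis by simp
    qed
    also have "\<dots> + C * s ^ Suc CARD('n) = B * s ^ Suc CARD('n)"
      by (simp add: B_def power_mult_distrib algebra_simps)
    finally show ?thesis using s by (simp add: field_simps)
  qed
  then show ?thesis using B by blast
qed

section \<open>Pointwise upper bounds\<close>

lemma p_le_energy:
  assumes "0 \<le> s"
  shows "p (s + s) x y \<le> (energy x s + energy y s) / 2"
proof -
  have "((\<lambda>z. 1 / 2 * ((p s z x)\<^sup>2 * m z) + 1 / 2 * ((p s z y)\<^sup>2 * m z)) has_sum
      (1 / 2 * energy x s + 1 / 2 * energy y s)) UNIV"
    unfolding energy_def by (intro has_sum_add has_sum_cmult_right has_sum_infsum energy_summable)
  moreover have "p s z x * p s z y * m z \<le> 1 / 2 * ((p s z x)\<^sup>2 * m z) + 1 / 2 * ((p s z y)\<^sup>2 * m z)" for z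
  proof -
    have "p s z x * p s z y \<le> ((p s z x)\<^sup>2 + (p s z y)\<^sup>2) / 2"
      using zero_le_power2[of "p s z x - p s z y"] by (simp add: power2_eq_square algebra_simps)
    from mult_right_mono[OF this, of "m z"] show ?thesis by (simp add: algebra_simps)
  qed
  ultimately have "p (s + s) x y \<le> 1 / 2 * energy x s + 1 / 2 * energy y s"
    using has_sum_mono[OF p_semigroup[OF assms assms]] by blast
  then show ?thesis by simp
qed

text \<open>By the triangle inequality every intermediate vertex is far from \<open>x\<close> or
  from \<open>y\<close>, and the weight goes to the kernel based at the far end. The parameter
  \<kappa> balances moment against energy.\<close>

lemma p_le_moment:
  assumes s: "0 \<le> s" and \<kappa>: "\<kappa> > 0"
  shows "rho y x ^ Suc CARD('n) * p (s + s) x y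
    \<le> 2 ^ Suc CARD('n) * ((moment x s + moment y s) / \<kappa> + \<kappa> * (energy x s + energy y s)) / 2"
proof -
  let ?N = "Suc CARD('n)"
  let ?G = "\<lambda>a b z. 1 / \<kappa> * (rho a z ^ (2 * ?N) * (p s z a)\<^sup>2 * m z) + \<kappa> * ((p s z b)\<^sup>2 * m z)"
  have G: "(?G a b has_sum (1 / \<kappa> * moment a s + \<kappa> * energy b s)) UNIV" for a b
    unfolding moment_def energy_def
    by (intro has_sum_add has_sum_cmult_right has_sum_infsum energy_summable moment_summable)
  have amgm: "rho a z ^ ?N * (p s z a * p s z b * m z) \<le> 1 / 2 * ?G a b z" for a b z
  proof -
    let ?r = "rho a z ^ ?N * p s z a" and ?v = "p s z b"
    have "0 \<le> (?r - \<kappa> * ?v)\<^sup>2 / \<kappa>" using \<kappa> by simp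
    also have "\<dots> = ?r\<^sup>2 / \<kappa> - 2 * ?r * ?v + \<kappa> * ?v\<^sup>2"
      using \<kappa> by (simp add: power2_eq_square field_simps)
    finally have "?r * ?v \<le> 1 / 2 * (?r\<^sup>2 / \<kappa> + \<kappa> * ?v\<^sup>2)" by simp
    moreover have "?r\<^sup>2 = rho a z ^ (2 * ?N) * (p s z a)\<^sup>2"
      by (simp only: power_mult_distrib power_mult[symmetric] mult.commute[of _ 2])
    ultimately have "?r * ?v \<le> 1 / 2 * (rho a z ^ (2 * ?N) * (p s z a)\<^sup>2 / \<kappa> + \<kappa> * ?v\<^sup>2)" by simp
    from mult_right_mono[OF this, of "m z"] show ?thesis by (simp add: algebra_simps)
  qed
  have "rho y x ^ ?N * p (s + s) x y
      \<le> 2 ^ ?N * (1 / 2) * ((1 / \<kappa> * moment x s + \<kappa> * energy y s) + (1 / \<kappa> * moment y s + \<kappa> * energy x s))"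
  proof (rule has_sum_mono[OF has_sum_cmult_right[OF p_semigroup[OF s s]] has_sum_cmult_right[OF has_sum_add[OF G G]]])
    fix z
    have r: "rho y x ^ ?N \<le> 2 ^ ?N * (rho x z ^ ?N + rho y z ^ ?N)"
    proof -
      have "rho y x \<le> rho x z + rho y z"
        using l1_triangle[of x y z] by (simp add: rho_def l1_minus_commute[of z x])
      also have "\<dots> \<le> 2 * max (rho x z) (rho y z)" by simp
      finally have "rho y x ^ ?N \<le> (2 * max (rho x z) (rho y z)) ^ ?N"
        using rho_ge_1[of y x] by (intro power_mono) auto
      also have "\<dots> = 2 ^ ?N * max (rho x z) (rho y z) ^ ?N" by (rule power_mult_distrib)
      also have "max (rho x z) (rho y z) ^ ?N \<le> rho x z ^ ?N + rho y z ^ ?N"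
        using rho_ge_1[of x z] rho_ge_1[of y z] by (cases "rho x z \<le> rho y z") (simp_all add: max_def)
      finally show ?thesis by simp
    qed
    have "rho y x ^ ?N * (p s z x * p s z y * m z) \<le> 2 ^ ?N * (rho x z ^ ?N + rho y z ^ ?N) * (p s z x * p s z y * m z)"
      using r p_nonneg[OF s] by (intro mult_right_mono) auto
    also have "\<dots> = 2 ^ ?N * (rho x z ^ ?N * (p s z x * p s z y * m z) + rho y z ^ ?N * (p s z y * p s z x * m z))"
      by (simp only: mult.commute[of "p s z y"] distrib_left distrib_right mult.assoc)
    also have "\<dots> \<le> 2 ^ ?N * (1 / 2 * ?G x y z + 1 / 2 * ?G y x z)"
      by (intro mult_left_mono add_mono amgm) auto
    finally show "rho y x ^ ?N * (p s z x * p s z y * m z) \<le> 2 ^ ?N * (1 / 2) * (?G x y z + ?G y x z)"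
      by (simp only: distrib_left mult.assoc)
  qed
  also have "\<dots> = 2 ^ ?N * ((moment x s + moment y s) / \<kappa> + \<kappa> * (energy x s + energy y s)) / 2"
    using \<kappa> by (simp add: field_simps)
  finally show ?thesis .
qed

lemma p_upper:
  "\<exists>K>0. \<forall>s\<ge>1/2. \<forall>x y. p (2 * s\<^sup>2) x y \<le> K / s ^ CARD('n) \<and> (1 + l1 (x - y)) ^ Suc CARD('n) * p (2 * s\<^sup>2) x y \<le> K * s"
proof -
  obtain K where K: "K > 0" and KD: "\<And>s y. s > 0 \<Longrightarrow> energy y (s\<^sup>2) \<le> K / s ^ CARD('n)"
    using energy_upper by blast
  obtain B where B: "B > 0" and BF: "\<And>s y. s \<ge> 1/2 \<Longrightarrow> moment y (s\<^sup>2) \<le> B * s ^ (CARD('n) + 2)"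
    using moment_upper by blast
  let ?C = "2 ^ Suc CARD('n) * (B + K)"
  have C: "K \<le> ?C"
  proof -
    have "1 * K \<le> 2 ^ Suc CARD('n) * (B + K)"
      using B K one_le_power[of "2 :: real" "Suc CARD('n)"] by (intro mult_mono) auto
    then show ?thesis by simp
  qed
  have "p (2 * s\<^sup>2) x y \<le> ?C / s ^ CARD('n) \<and> (1 + l1 (x - y)) ^ Suc CARD('n) * p (2 * s\<^sup>2) x y \<le> ?C * s"
    if s: "s \<ge> 1/2" for s x y
  proof
    have sp: "s > 0" using s by linarith
    have "p (2 * s\<^sup>2) x y \<le> (K / s ^ CARD('n) + K / s ^ CARD('n)) / 2"
      using p_le_energy[of "s\<^sup>2" x y, folded mult_2] KD[OF sp, of x] KD[OF sp, of y] by simp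
    also have "\<dots> \<le> ?C / s ^ CARD('n)" using C sp by (simp add: divide_right_mono)
    finally show "p (2 * s\<^sup>2) x y \<le> ?C / s ^ CARD('n)" .
    \<comment> \<open>\<kappa> = s^(d+1): the moments of order s^(d+2) and the energies of order
      s^(-d) then both contribute a multiple of s.\<close>
    have "rho y x ^ Suc CARD('n) * p (2 * s\<^sup>2) x y
      \<le> 2 ^ Suc CARD('n) * ((moment x (s\<^sup>2) + moment y (s\<^sup>2)) / s ^ Suc CARD('n) + s ^ Suc CARD('n) * (energy x (s\<^sup>2) + energy y (s\<^sup>2))) / 2"
      using p_le_moment[of "s\<^sup>2" "s ^ Suc CARD('n)" y x, folded mult_2] sp by simp
    also have "\<dots> \<le> 2 ^ Suc CARD('n) * ((B * s ^ (CARD('n) + 2) + B * s ^ (CARD('n) + 2)) / s ^ Suc CARD('n)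
        + s ^ Suc CARD('n) * (K / s ^ CARD('n) + K / s ^ CARD('n))) / 2"
      using BF[OF s] KD[OF sp] sp by (intro divide_right_mono mult_left_mono add_mono) auto
    also have "\<dots> = ?C * s" using sp by (simp add: field_simps)
    finally show "(1 + l1 (x - y)) ^ Suc CARD('n) * p (2 * s\<^sup>2) x y \<le> ?C * s" by (simp add: rho_def)
  qed
  moreover have "?C > 0" using B K by simp
  ultimately show ?thesis by blast
qed

end

section \<open>The logarithm of the heat kernel\<close>

text \<open>Lets the quadratic quantities controlled by the moments bound the mass itself;
  \<open>l\<close> is the free balancing parameter.\<close>

lemma weighted_amgm:
  fixes l r u :: real
  assumes "l > 0" "r > 0"
  shows "u \<le> l / 2 * (r\<^sup>2 * u\<^sup>2) + 1 / (2 * l * r\<^sup>2)"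
proof -
  have "0 \<le> (l * r * u - 1 / r)\<^sup>2 / (2 * l)" using assms by simp
  also have "\<dots> = l / 2 * (r\<^sup>2 * u\<^sup>2) - u + 1 / (2 * l * r\<^sup>2)"
    using assms by (simp add: power2_eq_square field_simps)
  finally show ?thesis by simp
qed

lemma has_sum_finite_support:
  fixes g :: "'a \<Rightarrow> real"
  assumes "finite A" and "\<And>x. x \<notin> A \<Longrightarrow> g x = 0"
  shows "(g has_sum sum g A) UNIV"
  using has_sum_finite[OF assms(1), of g] assms(2) has_sum_cong_neutral[of UNIV A g g "sum g A"] by auto

text \<open>Jensen's inequality, from the tangent of exp at the weighted mean.\<close>

lemma exp_mean_le:
  fixes W F :: "'a \<Rightarrow> real"
  assumes W: "\<And>x. x \<in> A \<Longrightarrow> 0 \<le> W x" and S: "sum W A > 0"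
  shows "sum W A * exp ((\<Sum>x\<in>A. W x * F x) / sum W A) \<le> (\<Sum>x\<in>A. W x * exp (F x))"
proof -
  define b where "b = (\<Sum>x\<in>A. W x * F x) / sum W A"
  have b: "(\<Sum>x\<in>A. W x * F x) = b * sum W A" using S by (simp add: b_def)
  have "(\<Sum>x\<in>A. exp b * (W x * (1 - b) + W x * F x)) \<le> (\<Sum>x\<in>A. W x * exp (F x))"
  proof (rule sum_mono)
    fix x assume x: "x \<in> A"
    have "exp b * (1 + (F x - b)) \<le> exp b * exp (F x - b)"
      by (rule mult_left_mono[OF exp_ge_add_one_self]) simp
    also have "\<dots> = exp (F x)" by (simp add: exp_diff)
    finally have "W x * (exp b * (1 + (F x - b))) \<le> W x * exp (F x)" using W[OF x] by (rule mult_left_mono)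
    then show "exp b * (W x * (1 - b) + W x * F x) \<le> W x * exp (F x)" by (simp add: algebra_simps)
  qed
  also have "(\<Sum>x\<in>A. exp b * (W x * (1 - b) + W x * F x)) = sum W A * exp b"
    by (simp only: sum_distrib_left[symmetric] sum.distrib sum_distrib_right[symmetric] b) (simp add: algebra_simps)
  finally show ?thesis by (simp add: b_def)
qed

lemma mean_minimises:
  fixes W f :: "'a \<Rightarrow> real"
  assumes g: "(\<Sum>x\<in>A. W x * f x) = g * sum W A" and W: "0 \<le> sum W A"
  shows "(\<Sum>x\<in>A. W x * (f x - g)\<^sup>2) \<le> (\<Sum>x\<in>A. W x * (f x - b)\<^sup>2)"
proof -
  have "(\<Sum>x\<in>A. W x * (f x - b)\<^sup>2)
      = (\<Sum>x\<in>A. W x * (f x - g)\<^sup>2 + 2 * (g - b) * (W x * f x - g * W x) + (g - b)\<^sup>2 * W x)"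
    by (rule sum.cong) (auto simp: power2_eq_square algebra_simps)
  also have "\<dots> = (\<Sum>x\<in>A. W x * (f x - g)\<^sup>2) + (g - b)\<^sup>2 * sum W A"
    by (simp only: sum.distrib sum_distrib_left[symmetric] sum_subtractf g) simp
  finally show ?thesis using W by simp
qed

text \<open>The bound contains no value of \<open>h\<close> at \<open>T0\<close>: above the level
  \<open>sqrt (2 * A / B)\<close> the quadratic term wins, h' <= - (B/2) h^2, and 1/h grows at rate
  at least B/2 whatever the start.\<close>

lemma riccati:
  fixes h h' :: "real \<Rightarrow> real"
  assumes T: "T0 < T1" and A: "0 \<le> A" and B: "0 < B"
    and d: "\<And>t. T0 \<le> t \<Longrightarrow> t \<le> T1 \<Longrightarrow> (h has_real_derivative h' t) (at t)"
    and h': "\<And>t. T0 \<le> t \<Longrightarrow> t \<le> T1 \<Longrightarrow> 0 \<le> h t \<Longrightarrow> h' t \<le> A - B * (h t)\<^sup>2"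
  shows "h T1 \<le> sqrt (2 * A / B) + 2 / (B * (T1 - T0))"
proof (rule ccontr)
  define H where "H = sqrt (2 * A / B)"
  have H: "0 \<le> H" using A B by (simp add: H_def)
  have H2: "B * H\<^sup>2 = 2 * A" using A B by (simp add: H_def)
  assume neg: "\<not> h T1 \<le> sqrt (2 * A / B) + 2 / (B * (T1 - T0))"
  have pos: "2 / (B * (T1 - T0)) > 0" using B T by simp
  then have T1: "h T1 > H" using neg unfolding H_def by linarith
  have dec: "h' t \<le> - (B / 2) * (h t)\<^sup>2" if "T0 \<le> t" "t \<le> T1" "H < h t" for t
  proof -
    have "H\<^sup>2 \<le> (h t)\<^sup>2" using that H by (intro power_mono) auto
    then have "B * H\<^sup>2 \<le> B * (h t)\<^sup>2" using B by (intro mult_left_mono) auto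
    then show ?thesis using h'[of t] that H H2 by (simp add: field_simps)
  qed
  \<comment> \<open>After the last time at which \<open>h\<close> is at most \<open>H\<close> its
    derivative is nonpositive, so it could not reach \<open>h T1 > H\<close>.\<close>
  have big: "H < h t" if t: "T0 \<le> t" "t \<le> T1" for t
  proof (rule ccontr)
    assume nt: "\<not> H < h t"
    define S where "S = {t \<in> {T0..T1}. h t \<le> H}"
    have cont: "continuous_on {T0..T1} h"
      using d by (intro DERIV_continuous_on[where D = h']) (auto intro: has_field_derivative_at_within)
    then have "closed S"
      unfolding S_def by (intro continuous_on_closed_Collect_le continuous_on_const) auto
    moreover have "S \<noteq> {}" "bdd_above S" using nt t by (auto simp: S_def)
    ultimately have "Sup S \<in> S" by (intro closed_contains_Sup)
    moreover define r where "r = Sup S"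
    ultimately have r: "T0 \<le> r" "r \<le> T1" "h r \<le> H" by (auto simp: S_def)
    have rT: "r < T1" using r T1 by (cases "r = T1") auto
    obtain z where z: "r < z" "z < T1" "h T1 - h r = (T1 - r) * h' z"
      using MVT2[OF rT, of h h'] d r by (metis order_trans)
    have "z \<notin> S" using z(1) cSup_upper[OF _ \<open>bdd_above S\<close>, of z] by (auto simp: r_def)
    then have "H < h z" using z r by (auto simp: S_def)
    then have "h' z \<le> - (B / 2) * (h z)\<^sup>2" using z r by (intro dec) auto
    also have "\<dots> \<le> 0" using B by simp
    finally have "(T1 - r) * h' z \<le> 0" using rT by (simp add: mult_nonneg_nonpos)
    then show False using z(3) r(3) T1 by linarith
  qed
  have hp: "0 < h t" if "T0 \<le> t" "t \<le> T1" for t using big[OF that] H by linarith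
  have "- inverse (h T1) + B / 2 * T1 \<le> - inverse (h T0) + B / 2 * T0"
  proof (rule DERIV_nonpos_imp_nonincreasing[of T0 T1 "\<lambda>t. - inverse (h t) + B / 2 * t"])
    fix t assume t: "T0 \<le> t" "t \<le> T1"
    have "((\<lambda>t. - inverse (h t) + B / 2 * t) has_real_derivative
        - (- (inverse (h t) * h' t * inverse (h t))) + B / 2) (at t)"
      using hp[OF t] by (auto intro!: derivative_eq_intros d t)
    moreover have "- (- (inverse (h t) * h' t * inverse (h t))) + B / 2 \<le> 0"
    proof -
      have "inverse (h t) * h' t * inverse (h t) = h' t / (h t)\<^sup>2"
        by (simp add: power2_eq_square divide_inverse mult_ac)
      also have "\<dots> \<le> - (B / 2)"
        using dec[OF t big[OF t]] hp[OF t] by (simp add: divide_le_eq)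
      finally show ?thesis by simp
    qed
    ultimately show "\<exists>D. ((\<lambda>t. - inverse (h t) + B / 2 * t) has_real_derivative D) (at t) \<and> D \<le> 0" by blast
  qed (use T in simp)
  moreover have "inverse (h T0) > 0" using hp[of T0] T by simp
  ultimately have "B / 2 * (T1 - T0) < inverse (h T1)" unfolding right_diff_distrib by linarith
  then have "h T1 < 2 / (B * (T1 - T0))"
    using hp[of T1] B T by (simp add: field_simps)
  then show False using neg H unfolding H_def by linarith
qed

text \<open>In terms of \<open>\<tau> = ln v - ln u\<close> the right-hand side is
  \<open>a (e\<^sup>\<tau> + e\<^sup>-\<^sup>\<tau> - 2) + (b - a) (e\<^sup>-\<^sup>\<tau> - 1)\<close> if \<open>a \<le> b\<close>.\<close>

lemma log_edge:
  fixes u v a b e :: real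
  assumes u: "0 < u" and v: "0 < v" and a: "0 \<le> a" and b: "0 \<le> b" and e0: "0 \<le> e"
    and e: "(b - a)\<^sup>2 \<le> e * min a b \<or> min a b = 0 \<and> max a b \<le> e"
  shows "min a b * (ln v - ln u)\<^sup>2 / 4 - e \<le> - ((v - u) * (b / v - a / u))"
  using assms
proof (induction a b arbitrary: u v rule: linorder_wlog)
  case (sym a b u v)
  have "(u - v) * (a / u - b / v) = (v - u) * (b / v - a / u)"
    by (metis minus_diff_eq minus_mult_minus)
  moreover have "(b - a)\<^sup>2 \<le> e * min a b \<or> min a b = 0 \<and> max a b \<le> e"
    using sym.prems(6) by (simp add: min.commute max.commute power2_commute)
  ultimately show ?case
    using sym.IH[of v u] sym.prems(1-5)
    by (simp add: min.commute[of b] max.commute[of b] power2_commute[of "ln v"] power2_commute[of a])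
next
  case (le a b u v)
  define \<tau> where "\<tau> = ln v - ln u"
  have vu: "v / u = exp \<tau>" "u / v = exp (- \<tau>)" using le by (simp_all add: \<tau>_def exp_diff)
  have X: "- ((v - u) * (b / v - a / u)) = a * (exp \<tau> + exp (- \<tau>) - 2) + (b - a) * (exp (- \<tau>) - 1)"
    unfolding vu[symmetric] using le by (simp add: field_simps)
  have m: "min a b = a" "max a b = b" using le by auto
  have em: "1 - \<tau> \<le> exp (- \<tau>)" using exp_ge_add_one_self[of "- \<tau>"] by simp
  show ?case
  proof (cases "a = 0")
    \<comment> \<open>An edge leaving the support: there is no quadratic gain, and the loss is at
      most the outer weight b <= e.\<close>
    case True
    then have "b \<le> e" using le by (auto simp: m)
    moreover have "- b \<le> b * (exp (- \<tau>) - 1)" using le by (simp add: right_diff_distrib)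
    moreover have "min 0 b = 0" using le by simp
    ultimately show ?thesis unfolding X using True by simp
  next
    case False
    then have ap: "a > 0" using le by simp
    have ba: "(b - a)\<^sup>2 \<le> e * a" using le ap m by auto
    have ch: "\<tau>\<^sup>2 / 2 \<le> exp \<tau> + exp (- \<tau>) - 2"
    proof (cases "\<tau> \<ge> 0")
      case True
      then show ?thesis using exp_lower_Taylor_quadratic[of \<tau>] em by simp
    next
      case False
      then have "1 - \<tau> + \<tau>\<^sup>2 / 2 \<le> exp (- \<tau>)"
        using exp_lower_Taylor_quadratic[of "- \<tau>"] by simp
      moreover have "1 + \<tau> \<le> exp \<tau>" by (rule exp_ge_add_one_self)
      ultimately show ?thesis by linarith
    qed
    have 1: "a * (\<tau>\<^sup>2 / 2) \<le> a * (exp \<tau> + exp (- \<tau>) - 2)" using ch ap by (intro mult_left_mono) auto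
    have 2: "(b - a) * (- \<tau>) \<le> (b - a) * (exp (- \<tau>) - 1)" using em le by (intro mult_left_mono) auto
    \<comment> \<open>Half of the quadratic gain a \<tau>^2 / 2 absorbs the linear term (b - a)
      \<tau>, at the price (b - a)^2 / a <= e.\<close>
    have "0 \<le> (a * \<tau> / 2 - (b - a))\<^sup>2 / a" using ap by simp
    also have "\<dots> = a * \<tau>\<^sup>2 / 4 - (b - a) * \<tau> + (b - a)\<^sup>2 / a"
      using ap by (simp add: power2_eq_square field_simps)
    finally have 3: "0 \<le> a * \<tau>\<^sup>2 / 4 - (b - a) * \<tau> + (b - a)\<^sup>2 / a" .
    have 4: "(b - a)\<^sup>2 / a \<le> e" using ba ap by (simp add: divide_le_eq)
    show ?thesis unfolding X m \<tau>_def[symmetric] using 1 2 3 4 by simp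
  qed
qed

section \<open>The squared tent as a weight\<close>

definition tent :: "int \<Rightarrow> int \<Rightarrow> real" where
  "tent R k = (real_of_int (max 0 (R - \<bar>k\<bar>)))\<^sup>2"

text \<open>Squaring the tent keeps |gradient|^2 / weight bounded while the weight is of size R^2, a
  relative error of order R^(-2) as diffusion requires. For neighbouring roots p <= q with p >= 1
  one has q <= 2 p, so (q^2 - p^2)^2 <= (3 p)^2, hence 9; the exception is an edge where the tent
  vanishes at one end, and there it is at most 1 at the other.\<close>

lemma tent_step:
  "(tent R (k + 1) - tent R k)\<^sup>2 \<le> 9 * min (tent R k) (tent R (k + 1))
    \<or> min (tent R k) (tent R (k + 1)) = 0 \<and> max (tent R k) (tent R (k + 1)) \<le> 1"
proof -
  have *: "(q\<^sup>2 - p\<^sup>2)\<^sup>2 \<le> 9 * min (p\<^sup>2) (q\<^sup>2) \<or> min (p\<^sup>2) (q\<^sup>2) = 0 \<and> max (p\<^sup>2) (q\<^sup>2) \<le> 1"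
    if "0 \<le> p" "0 \<le> q" "\<bar>p - q\<bar> \<le> 1" "p = 0 \<or> 1 \<le> p" "q = 0 \<or> 1 \<le> q" for p q :: real
    using that
  proof (induction p q rule: linorder_wlog)
    case (le p q)
    show ?case
    proof (cases "p = 0")
      case True
      then have "q\<^sup>2 \<le> 1\<^sup>2" using le by (intro power_mono) auto
      then show ?thesis using True by simp
    next
      case False
      have "q\<^sup>2 - p\<^sup>2 = (q + p) * (q - p)" by (simp add: power2_eq_square algebra_simps)
      also have "\<dots> \<le> (3 * p) * 1" using le False by (intro mult_mono) auto
      finally have "(q\<^sup>2 - p\<^sup>2)\<^sup>2 \<le> (3 * p)\<^sup>2" using le by (intro power_mono) (auto simp: power_mono)
      moreover have "p\<^sup>2 \<le> q\<^sup>2" using le by (intro power_mono) auto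
      ultimately show ?thesis by (simp add: power_mult_distrib)
    qed
  next
    case (sym p q)
    then show ?case by (simp add: min.commute max.commute power2_commute abs_minus_commute)
  qed
  let ?n = "\<lambda>k. max 0 (R - \<bar>k\<bar>)"
  have "\<bar>?n k - ?n (k + 1)\<bar> \<le> 1" by (auto simp: max_def abs_if)
  then have "\<bar>real_of_int (?n k) - real_of_int (?n (k + 1))\<bar> \<le> 1"
    by (simp only: of_int_diff[symmetric] of_int_abs[symmetric] of_int_le_1_iff)
  moreover have "real_of_int (?n j) = 0 \<or> 1 \<le> real_of_int (?n j)" for j
  proof -
    have "?n j = 0 \<or> 1 \<le> ?n j" by linarith
    then show ?thesis by (metis of_int_0 of_int_1 of_int_le_iff)
  qed
  moreover have "0 \<le> real_of_int (?n j)" for j by simp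
  ultimately show ?thesis
    unfolding tent_def by (intro *) auto
qed

lemma tent_nonneg: "0 \<le> tent R k"
  by (simp add: tent_def)

lemma tent_le: "0 \<le> R \<Longrightarrow> tent R k \<le> (real_of_int R)\<^sup>2"
  unfolding tent_def by (intro power_mono) auto

lemma profile_tent:
  assumes R: "R \<ge> 1"
  shows "profile (tent R) R"
proof
  fix a k b :: int assume "a \<le> k" "k \<le> b"
  then have "\<bar>k\<bar> \<le> \<bar>a\<bar> \<or> \<bar>k\<bar> \<le> \<bar>b\<bar>" by linarith
  then have "tent R a \<le> tent R k \<or> tent R b \<le> tent R k"
    unfolding tent_def by (auto intro!: power_mono)
  then show "min (tent R a) (tent R b) \<le> tent R k" by auto
qed (use R in \<open>auto simp: tent_def\<close>)

locale tent_weight =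
  fixes R :: int assumes R_pos: "R \<ge> 1"

sublocale tent_weight \<subseteq> profile "tent R" R
  by (rule profile_tent[OF R_pos])

context tent_weight begin

lemma \<phi>_le: "\<phi> (v :: int ^ 'n::finite) \<le> (real_of_int R)\<^sup>2 ^ CARD('n)"
proof -
  have "\<phi> v \<le> (\<Prod>i\<in>(UNIV :: 'n set). (real_of_int R)\<^sup>2)"
    unfolding \<phi>_def using R_pos by (intro prod_mono) (auto simp: tent_nonneg tent_le)
  then show ?thesis by simp
qed

lemma \<phi>'_le: "\<phi>' i (v :: int ^ 'n::finite) \<le> (real_of_int R)\<^sup>2 ^ (CARD('n) - 1)"
proof -
  have "\<phi>' i v \<le> (\<Prod>j\<in>UNIV - {i}. (real_of_int R)\<^sup>2)"
    unfolding \<phi>'_def using R_pos by (intro prod_mono) (auto simp: tent_nonneg tent_le)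
  then show ?thesis by (simp add: card_Diff_singleton)
qed

text \<open>Only one factor of the product changes along an edge. The common factor \<phi>' is at
  most R^(2(d-1)), so the error Q is smaller than the bound R^(2d) for the weight by a factor of
  order R^2.\<close>

lemma \<phi>_step:
  fixes x :: "int ^ 'n::finite" and i :: 'n
  defines "y \<equiv> x + axis i 1" and "Q \<equiv> 9 * (real_of_int R)\<^sup>2 ^ (CARD('n) - 1)"
  shows "(\<phi> y - \<phi> x)\<^sup>2 \<le> Q * min (\<phi> x) (\<phi> y) \<or> min (\<phi> x) (\<phi> y) = 0 \<and> max (\<phi> x) (\<phi> y) \<le> Q"
proof -
  let ?P = "\<phi>' i x" and ?a = "tent R (x $ i)" and ?b = "tent R (x $ i + 1)"
  have y: "y = upd x i (x $ i + 1)" by (simp add: y_def vec_eq_iff axis_def)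
  have \<phi>x: "\<phi> x = ?P * ?a" using \<phi>_split[of x i] by (simp add: mult.commute)
  have \<phi>y: "\<phi> y = ?P * ?b" by (simp add: y \<phi>_upd mult.commute)
  have P: "0 \<le> ?P" "9 * ?P \<le> Q" using \<phi>'_nonneg \<phi>'_le[of i x] by (simp_all add: Q_def)
  have mm: "min (\<phi> x) (\<phi> y) = ?P * min ?a ?b" "max (\<phi> x) (\<phi> y) = ?P * max ?a ?b"
    unfolding \<phi>x \<phi>y using P by (simp_all add: min_mult_distrib_left max_mult_distrib_left)
  from tent_step[of R "x $ i"] show ?thesis
  proof
    assume "(?b - ?a)\<^sup>2 \<le> 9 * min ?a ?b"
    then have "?P\<^sup>2 * (?b - ?a)\<^sup>2 \<le> ?P\<^sup>2 * (9 * min ?a ?b)" by (rule mult_left_mono) simp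
    also have "\<dots> = 9 * ?P * (?P * min ?a ?b)" by (simp add: power2_eq_square)
    also have "\<dots> \<le> Q * (?P * min ?a ?b)"
      using P by (intro mult_right_mono) (auto simp: tent_nonneg)
    also have "?P\<^sup>2 * (?b - ?a)\<^sup>2 = (\<phi> y - \<phi> x)\<^sup>2"
      unfolding \<phi>x \<phi>y by (simp add: power_mult_distrib[symmetric] right_diff_distrib)
    finally show ?thesis unfolding mm by blast
  next
    assume "min ?a ?b = 0 \<and> max ?a ?b \<le> 1"
    then have "?P * min ?a ?b = 0" "?P * max ?a ?b \<le> ?P * 1"
      using mult_left_mono[of "max ?a ?b" 1 ?P] P by simp_all
    then show ?thesis unfolding mm using P by linarith
  qed
qed

lemma \<phi>_adj:
  fixes x :: "int ^ 'n::finite"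
  defines "Q \<equiv> 9 * (real_of_int R)\<^sup>2 ^ (CARD('n) - 1)"
  assumes "adj x y"
  shows "(\<phi> y - \<phi> x)\<^sup>2 \<le> Q * min (\<phi> x) (\<phi> y) \<or> min (\<phi> x) (\<phi> y) = 0 \<and> max (\<phi> x) (\<phi> y) \<le> Q"
proof -
  obtain i where "y = x + axis i 1 \<or> x = y + axis i 1" using adj_imp_axis[OF assms(2)] by blast
  then show ?thesis
    using \<phi>_step[of x i] \<phi>_step[of y i] unfolding Q_def[symmetric]
    by (auto simp: min.commute max.commute power2_commute)
qed

end

context lattice begin

text \<open>Differentiating ln p gives the Laplacian of p tested against weight / p, a function of
  finite support. After summation by parts \<open>log_edge\<close> bounds each edge. The constant c
  / 8 combines the 1/4 of that bound, the 1/2 of summation by parts and w >= c; the error is Q for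
  each edge that meets the cube, counted with its weight.\<close>

lemma log_mean_deriv:
  fixes x0 o' :: "int ^ 'n"
  assumes R: "R \<ge> 1" and t: "t > 0"
  defines "f \<equiv> profile.\<phi> (tent R) :: int ^ 'n \<Rightarrow> real"
  obtains D where "((\<lambda>t. \<Sum>v\<in>cube R. f v * m (x0 + v) * ln (p t (x0 + v) o')) has_real_derivative D) (at t)"
    and "c / 8 * (\<Sum>v\<in>cube R. \<Sum>i\<in>UNIV. profile.grad_energy (tent R) (\<lambda>v. ln (p t (x0 + v) o')) i v)
       - 9 * (real_of_int R)\<^sup>2 ^ (CARD('n) - 1) * M * (2 * real_of_int R) ^ CARD('n) \<le> D"
proof
  interpret tent_weight R by unfold_locales (rule R)
  have \<phi>_eq: "\<phi> = f" by (simp add: f_def)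
  define Q where "Q = 9 * (real_of_int R)\<^sup>2 ^ (CARD('n) - 1)"
  have Q: "Q \<ge> 0" by (simp add: Q_def)
  let ?u = "\<lambda>z. p t z o'" and ?A = "(\<lambda>v. x0 + v) ` cube R"
  define \<psi> where "\<psi> = (\<lambda>z. f (z - x0))"
  define g where "g = (\<lambda>z. \<psi> z / ?u z)"
  have u: "?u z > 0" for z using t by (rule p_pos)
  have A: "finite ?A" by simp
  have \<psi>0: "\<psi> z = 0" if "z \<notin> ?A" for z
  proof -
    have "z - x0 \<notin> cube R"
    proof
      assume "z - x0 \<in> cube R"
      then have "x0 + (z - x0) \<in> ?A" by blast
      then show False using that by simp
    qed
    then show ?thesis using \<phi>_supp by (simp add: \<psi>_def \<phi>_eq[symmetric])
  qed
  have \<psi>_nonneg: "0 \<le> \<psi> z" for z by (simp add: \<psi>_def \<phi>_eq[symmetric] \<phi>_nonneg)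
  define D where "D = (\<Sum>v\<in>cube R. f v * m (x0 + v) * (laplacian w ?u (x0 + v) / ?u (x0 + v)))"
  show "((\<lambda>t. \<Sum>v\<in>cube R. f v * m (x0 + v) * ln (p t (x0 + v) o')) has_real_derivative D) (at t)"
  proof -
    have "((\<lambda>t. ln (p t z o')) has_real_derivative laplacian w ?u z / ?u z) (at t)" for z
      using u[of z] by (auto intro!: derivative_eq_intros p_deriv)
    then show ?thesis unfolding D_def by (intro DERIV_sum DERIV_cmult)
  qed
  have g0: "g z = 0" if "z \<notin> ?A" for z using \<psi>0[OF that] by (simp add: g_def)
  obtain B where B: "\<And>z. \<bar>g z\<bar> \<le> B"
    using summable_on_imp_bounded[OF has_sum_imp_summable[OF has_sum_finite_support[OF A, of g, OF g0]]] by blast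
  let ?k = "\<lambda>x y. w x y * (?u y - ?u x) * (g y - g x)"
  have "D = (\<Sum>z\<in>?A. laplacian w ?u z * g z * m z)"
    unfolding D_def by (subst sum.reindex) (auto simp: g_def \<psi>_def intro!: sum.cong)
  moreover have "((\<lambda>z. laplacian w ?u z * g z * m z) has_sum (\<Sum>z\<in>?A. laplacian w ?u z * g z * m z)) UNIV"
    by (rule has_sum_finite_support[OF A]) (simp add: g0)
  moreover note summation_by_parts[OF p_summable, of g B t o', OF B]
  ultimately have Dk: "D = - (\<Sum>\<^sub>\<infinity>(x, y)\<in>edges. ?k x y) / 2" and sk: "(\<lambda>(x, y). ?k x y) summable_on edges"
    using has_sum_unique by fastforce+
  \<comment> \<open>The indicators record which ends of an edge lie in the cube; their weighted edge
    sum is a finite vertex sum, so the error Q is charged only to edges that meet the cube.\<close>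
  let ?I = "indicator ?A :: int ^ 'n \<Rightarrow> real"
  let ?h = "\<lambda>x y. w x y * (min (\<psi> x) (\<psi> y) * (ln (?u y) - ln (?u x))\<^sup>2)"
  have sI: "?I summable_on UNIV" and iI: "(\<Sum>\<^sub>\<infinity>x. m x * ?I x) = (\<Sum>x\<in>?A. m x)"
  proof -
    show "?I summable_on UNIV" by (rule has_sum_imp_summable[OF has_sum_finite_support[OF A]]) simp
    have "((\<lambda>x. m x * ?I x) has_sum (\<Sum>x\<in>?A. m x * ?I x)) UNIV" by (rule has_sum_finite_support[OF A]) simp
    then show "(\<Sum>\<^sub>\<infinity>x. m x * ?I x) = (\<Sum>x\<in>?A. m x)" by (simp add: infsumI)
  qed
  have s1: "(\<lambda>(x, y). w x y * ?I x) summable_on edges" by (rule edge_summable[OF sI])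
  have s2: "(\<lambda>(x, y). w x y * ?I y) summable_on edges" by (rule edge_summable'[OF sI])
  have s12: "(\<lambda>(x, y). w x y * ?I x + w x y * ?I y) summable_on edges"
    using summable_on_add[OF s1 s2] by (simp add: case_prod_unfold)
  have sh: "(\<lambda>(x, y). ?h x y) summable_on edges"
  proof -
    have "(\<lambda>(x, y). ?h x y) summable_on (Sigma ?A (\<lambda>x. {y. adj x y}))"
      using A finite_neighbours by (intro summable_on_finite finite_SigmaI) auto
    moreover have "(\<lambda>(x, y). ?h x y) summable_on edges \<longleftrightarrow> (\<lambda>(x, y). ?h x y) summable_on (Sigma ?A (\<lambda>x. {y. adj x y}))"
    proof (rule summable_on_cong_neutral)
      fix e assume "e \<in> edges - Sigma ?A (\<lambda>x. {y. adj x y})"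
      then obtain x y where e: "e = (x, y)" and x: "x \<notin> ?A" by (cases e) (auto simp: edges_def)
      have "?h x y = 0" using \<psi>0[OF x] \<psi>_nonneg[of y] by simp
      then show "(case e of (x, y) \<Rightarrow> ?h x y) = 0" by (simp add: e)
    qed (auto simp: edges_def)
    ultimately show ?thesis by simp
  qed
  have "(\<Sum>\<^sub>\<infinity>(x, y)\<in>edges. 1 / 4 * ?h x y + - Q * (w x y * ?I x + w x y * ?I y)) \<le> (\<Sum>\<^sub>\<infinity>(x, y)\<in>edges. - ?k x y)"
  proof (rule infsum_mono)
    show "(\<lambda>(x, y). 1 / 4 * ?h x y + - Q * (w x y * ?I x + w x y * ?I y)) summable_on edges"
      using summable_on_add[OF summable_on_cmult_right[OF sh, of "1 / 4"] summable_on_cmult_right[OF s12, of "- Q"]]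
      by (simp add: case_prod_unfold)
    show "(\<lambda>(x, y). - ?k x y) summable_on edges"
      using sk by (simp only: case_prod_unfold summable_on_uminus)
    fix e assume "e \<in> edges"
    then obtain x y where e: "e = (x, y)" and xy: "adj x y" by (auto simp: edges_def)
    have w: "0 \<le> w x y" using w_pos[OF xy] by simp
    have "1 / 4 * ?h x y + - Q * (w x y * ?I x + w x y * ?I y) \<le> - ?k x y"
    proof (cases "x \<in> ?A \<or> y \<in> ?A")
      case False
      then show ?thesis by (simp add: g0 \<psi>0)
    next
      case True
      have "adj (x - x0) (y - x0)" using xy by (simp add: adj_def)
      from \<phi>_adj[OF this]
      have "min (\<psi> x) (\<psi> y) * (ln (?u y) - ln (?u x))\<^sup>2 / 4 - Q \<le> - ((?u y - ?u x) * (\<psi> y / ?u y - \<psi> x / ?u x))"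
        unfolding \<phi>_eq Q_def[symmetric] \<psi>_def[symmetric] using \<psi>_nonneg u Q
        by (intro log_edge) (auto simp: \<psi>_def)
      moreover have "Q * 1 \<le> Q * (?I x + ?I y)"
        using True Q by (intro mult_left_mono) (auto simp: indicator_def)
      ultimately have "min (\<psi> x) (\<psi> y) * (ln (?u y) - ln (?u x))\<^sup>2 / 4 - Q * (?I x + ?I y)
          \<le> - ((?u y - ?u x) * (g y - g x))" by (simp add: g_def)
      from mult_left_mono[OF this w] show ?thesis by (simp add: algebra_simps)
    qed
    then show "(case e of (x, y) \<Rightarrow> 1 / 4 * ?h x y + - Q * (w x y * ?I x + w x y * ?I y)) \<le> (case e of (x, y) \<Rightarrow> - ?k x y)"
      by (simp add: e)
  qed
  also have "(\<Sum>\<^sub>\<infinity>(x, y)\<in>edges. - ?k x y) = 2 * D"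
    by (simp add: Dk case_prod_unfold infsum_uminus)
  also have "(\<Sum>\<^sub>\<infinity>(x, y)\<in>edges. 1 / 4 * ?h x y + - Q * (w x y * ?I x + w x y * ?I y))
      = 1 / 4 * (\<Sum>\<^sub>\<infinity>(x, y)\<in>edges. ?h x y) + - Q * (\<Sum>\<^sub>\<infinity>(x, y)\<in>edges. w x y * ?I x + w x y * ?I y)"
    using infsum_add[OF summable_on_cmult_right[OF sh, of "1 / 4"] summable_on_cmult_right[OF s12, of "- Q"]]
    by (simp only: case_prod_unfold infsum_cmult_right')
  also have "(\<Sum>\<^sub>\<infinity>(x, y)\<in>edges. w x y * ?I x + w x y * ?I y) = 2 * (\<Sum>x\<in>?A. m x)"
  proof -
    have "(\<Sum>\<^sub>\<infinity>(x, y)\<in>edges. w x y * ?I x + w x y * ?I y)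
        = (\<Sum>\<^sub>\<infinity>(x, y)\<in>edges. w x y * ?I x) + (\<Sum>\<^sub>\<infinity>(x, y)\<in>edges. w x y * ?I y)"
      using infsum_add[OF s1 s2] by (simp add: case_prod_unfold)
    moreover have "(\<Sum>\<^sub>\<infinity>(x, y)\<in>edges. w x y * ?I y) = (\<Sum>\<^sub>\<infinity>(x, y)\<in>edges. w x y * ?I x)"
      using edge_infsum_swap[of "\<lambda>x y. w x y * ?I x"] w_sym by simp
    ultimately show ?thesis using edge_infsum_vertex[OF sI] iI by simp
  qed
  also have "(\<Sum>\<^sub>\<infinity>(x, y)\<in>edges. ?h x y) = (\<Sum>x\<in>?A. \<Sum>y | adj x y. ?h x y)"
  proof (rule has_sum_unique[OF edge_infsum[OF sh] has_sum_finite_support[OF A]])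
    show "(\<Sum>y | adj x y. ?h x y) = 0" if "x \<notin> ?A" for x
      using \<psi>0[OF that] \<psi>_nonneg by (simp add: min_def)
  qed
  finally have D1: "1 / 8 * (\<Sum>x\<in>?A. \<Sum>y | adj x y. ?h x y) - Q * (\<Sum>x\<in>?A. m x) \<le> D" by simp
  \<comment> \<open>The forward edges alone give a lower bound, as all terms are nonnegative, and
    each carries weight at least \<open>c\<close>.\<close>
  have "c * (\<Sum>v\<in>cube R. \<Sum>i\<in>UNIV. grad_energy (\<lambda>v. ln (?u (x0 + v))) i v) \<le> (\<Sum>x\<in>?A. \<Sum>y | adj x y. ?h x y)"
  proof -
    have "(\<Sum>v\<in>cube R. \<Sum>i\<in>UNIV. grad_energy (\<lambda>v. ln (?u (x0 + v))) i v)
        = (\<Sum>x\<in>?A. \<Sum>i\<in>UNIV. min (\<psi> x) (\<psi> (x + axis i 1)) * (ln (?u (x + axis i 1)) - ln (?u x))\<^sup>2)"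
      by (subst sum.reindex) (auto simp: grad_energy_def \<psi>_def \<phi>_eq add.assoc intro!: sum.cong)
    also have "\<dots> \<le> (\<Sum>x\<in>?A. (\<Sum>y | adj x y. ?h x y) / c)"
    proof (rule sum_mono)
      fix x
      show "(\<Sum>i\<in>UNIV. min (\<psi> x) (\<psi> (x + axis i 1)) * (ln (?u (x + axis i 1)) - ln (?u x))\<^sup>2) \<le> (\<Sum>y | adj x y. ?h x y) / c"
        using axis_sum_le[of x "\<lambda>y. min (\<psi> x) (\<psi> y) * (ln (?u y) - ln (?u x))\<^sup>2"] \<psi>_nonneg by simp
    qed
    finally show ?thesis using c_pos by (simp add: sum_divide_distrib[symmetric] pos_le_divide_eq mult.commute)
  qed
  moreover have "Q * (\<Sum>x\<in>?A. m x) \<le> Q * (M * (2 * real_of_int R) ^ CARD('n))"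
  proof (rule mult_left_mono[OF _ Q])
    have "(\<Sum>x\<in>?A. m x) \<le> of_nat (card ?A) * M" using m_le by (intro sum_bounded_above) auto
    also have "card ?A = card (cube R :: (int ^ 'n) set)" by (rule card_image) simp
    also have "of_nat (card (cube R :: (int ^ 'n) set)) * M \<le> (2 * real_of_int R) ^ CARD('n) * M"
      unfolding card_cube[OF R] using R M_pos by (intro mult_right_mono power_mono) auto
    finally show "(\<Sum>x\<in>?A. m x) \<le> M * (2 * real_of_int R) ^ CARD('n)" by (simp add: mult.commute)
  qed
  ultimately show "c / 8 * (\<Sum>v\<in>cube R. \<Sum>i\<in>UNIV. grad_energy (\<lambda>v. ln (?u (x0 + v))) i v)
       - 9 * (real_of_int R)\<^sup>2 ^ (CARD('n) - 1) * M * (2 * real_of_int R) ^ CARD('n) \<le> D"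
    using D1 unfolding Q_def by linarith
qed

text \<open>The moments are square sums, so the mass far out is bounded by trading p for multiples
  of rho^(2d+2) p^2 and rho^(-2d-2). Two of the negative powers give L^(-2); the remaining 2d are
  spread over the coordinates and become summable. Any finite set containing the ball is allowed, so
  that cubes can be inserted.\<close>

lemma concentration:
  "\<exists>L\<ge>1. \<forall>s\<ge>1. \<forall>y B. finite B \<longrightarrow> (\<forall>z. rho y z \<le> L * s \<longrightarrow> z \<in> B) \<longrightarrow> 1 / 2 \<le> (\<Sum>z\<in>B. p (s\<^sup>2) z y * m z)"
proof -
  obtain B0 where B0: "B0 > 0" and B0F: "\<And>s y. s \<ge> 1/2 \<Longrightarrow> moment y (s\<^sup>2) \<le> B0 * s ^ (CARD('n) + 2)"
    using moment_upper by blast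
  \<comment> \<open>Large enough for the sum of the negative powers to contribute at most 1/4; the
    added 1 ensures L >= 1.\<close>
  define L where "L = sqrt (4 * M * B0 * 16 ^ CARD('n)) + 1"
  have L: "L \<ge> 1" using M_pos B0 by (simp add: L_def)
  have L2: "4 * M * B0 * 16 ^ CARD('n) \<le> L\<^sup>2"
  proof -
    have "4 * M * B0 * 16 ^ CARD('n) = (sqrt (4 * M * B0 * 16 ^ CARD('n)))\<^sup>2" using M_pos B0 by simp
    also have "\<dots> \<le> L\<^sup>2" unfolding L_def using M_pos B0 by (intro power_mono) auto
    finally show ?thesis .
  qed
  have "1 / 2 \<le> (\<Sum>z\<in>B. p (s\<^sup>2) z y * m z)"
    if s: "s \<ge> 1" and B: "finite B" and LB: "\<And>z. rho y z \<le> L * s \<Longrightarrow> z \<in> B" for s y B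
  proof -
    let ?u = "\<lambda>z. p (s\<^sup>2) z y" and ?d = "CARD('n)"
    let ?q = "\<lambda>z. \<Prod>i\<in>UNIV. 1 / (s + \<bar>real_of_int ((z - y) $ i)\<bar>)\<^sup>2"
    \<comment> \<open>Chosen so that the bound for the moment term is exactly 1/4.\<close>
    define l where "l = 1 / (2 * B0 * s ^ (?d + 2))"
    have sp: "s > 0" using s by linarith
    have l: "l > 0" using B0 sp by (simp add: l_def)
    have u: "0 \<le> ?u z" for z by (rule p_nonneg) simp
    have outer: "(\<Sum>z\<in>F. ?u z * m z) \<le> 1 / 2" if F: "finite F" "F \<inter> B = {}" for F
    proof -
      have "(\<Sum>z\<in>F. ?u z * m z) \<le> (\<Sum>z\<in>F. l / 2 * (rho y z ^ (2 * Suc ?d) * (?u z)\<^sup>2 * m z)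
          + M * B0 * s ^ ?d * 4 ^ ?d / L\<^sup>2 * ?q z)"
      proof (rule sum_mono)
        fix z assume z: "z \<in> F"
        let ?r = "rho y z ^ Suc ?d"
        have rz: "L * s < rho y z" using LB[of z] z F by force
        have rp: "rho y z > 0" using rho_ge_1[of y z] by linarith
        have r0: "?r > 0" using rp by simp
        have 1: "?u z \<le> l / 2 * (?r\<^sup>2 * (?u z)\<^sup>2) + 1 / (2 * l * ?r\<^sup>2)"
          by (rule weighted_amgm[OF l r0])
        have rr: "?r\<^sup>2 = rho y z ^ (2 * Suc ?d)" by (simp only: power_mult[symmetric] mult.commute[of _ 2])
        have "1 / (rho y z)\<^sup>2 \<le> 1 / (L * s)\<^sup>2"
          using rz L sp rp by (intro divide_left_mono power_mono) auto
        moreover have "(1 / (rho y z)\<^sup>2) ^ ?d \<le> 4 ^ ?d * ?q z"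
        proof -
          have "(1 / (rho y z)\<^sup>2) ^ ?d = (\<Prod>i\<in>(UNIV :: 'n set). 1 / (rho y z)\<^sup>2)" by simp
          also have "\<dots> \<le> (\<Prod>i\<in>UNIV. 4 * (1 / (s + \<bar>real_of_int ((z - y) $ i)\<bar>)\<^sup>2))"
          proof (intro prod_mono conjI)
            fix i
            have "s \<le> L * s" using L sp by simp
            then have "s + \<bar>real_of_int ((z - y) $ i)\<bar> \<le> 2 * rho y z"
              using component_le_l1[of "z - y" i] rz by (simp add: rho_def)
            then have "(s + \<bar>real_of_int ((z - y) $ i)\<bar>)\<^sup>2 \<le> (2 * rho y z)\<^sup>2"
              using sp by (intro power_mono) auto
            then have "1 / (2 * rho y z)\<^sup>2 \<le> 1 / (s + \<bar>real_of_int ((z - y) $ i)\<bar>)\<^sup>2"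
              using sp by (intro divide_left_mono mult_pos_pos zero_less_power) (auto simp: rp add_pos_nonneg)
            then show "1 / (rho y z)\<^sup>2 \<le> 4 * (1 / (s + \<bar>real_of_int ((z - y) $ i)\<bar>)\<^sup>2)"
              by (simp add: power_mult_distrib)
          qed simp
          also have "\<dots> = 4 ^ ?d * ?q z" by (simp only: prod.distrib prod_constant)
          finally show ?thesis .
        qed
        ultimately have "1 / (rho y z)\<^sup>2 * (1 / (rho y z)\<^sup>2) ^ ?d \<le> 1 / (L * s)\<^sup>2 * (4 ^ ?d * ?q z)"
          by (intro mult_mono) (auto intro!: prod_nonneg)
        moreover have "1 / ?r\<^sup>2 = 1 / (rho y z)\<^sup>2 * (1 / (rho y z)\<^sup>2) ^ ?d"
          by (simp add: power_divide power_mult_distrib power2_eq_square)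
        ultimately have "1 / ?r\<^sup>2 \<le> 1 / (L * s)\<^sup>2 * (4 ^ ?d * ?q z)" by simp
        then have "1 / (2 * l) * (1 / ?r\<^sup>2) \<le> 1 / (2 * l) * (1 / (L * s)\<^sup>2 * (4 ^ ?d * ?q z))"
          using l by (intro mult_left_mono) auto
        also have "\<dots> = B0 * s ^ ?d * 4 ^ ?d / L\<^sup>2 * ?q z"
          using sp L B0 by (simp add: l_def power_mult_distrib power2_eq_square field_simps del: prod_dividef)
        finally have 2: "1 / (2 * l * ?r\<^sup>2) \<le> B0 * s ^ ?d * 4 ^ ?d / L\<^sup>2 * ?q z" by simp
        have q0: "0 \<le> B0 * s ^ ?d * 4 ^ ?d / L\<^sup>2 * ?q z"
          using B0 sp by (intro mult_nonneg_nonneg prod_nonneg) auto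
        have "?u z * m z \<le> l / 2 * (?r\<^sup>2 * (?u z)\<^sup>2) * m z + B0 * s ^ ?d * 4 ^ ?d / L\<^sup>2 * ?q z * m z"
          using mult_right_mono[OF order_trans[OF 1 add_left_mono[OF 2]], of "m z"] by (simp only: distrib_right m_nonneg)
        also have "B0 * s ^ ?d * 4 ^ ?d / L\<^sup>2 * ?q z * m z \<le> B0 * s ^ ?d * 4 ^ ?d / L\<^sup>2 * ?q z * M"
          using q0 m_le by (intro mult_left_mono)
        finally show "?u z * m z \<le> l / 2 * (rho y z ^ (2 * Suc ?d) * (?u z)\<^sup>2 * m z)
            + M * B0 * s ^ ?d * 4 ^ ?d / L\<^sup>2 * ?q z"
          unfolding rr by (simp add: mult_ac)
      qed
      also have "\<dots> = l / 2 * (\<Sum>z\<in>F. rho y z ^ (2 * Suc ?d) * (?u z)\<^sup>2 * m z)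
          + M * B0 * s ^ ?d * 4 ^ ?d / L\<^sup>2 * (\<Sum>z\<in>F. ?q z)"
        by (simp only: sum.distrib sum_distrib_left)
      also have "\<dots> \<le> l / 2 * (B0 * s ^ (?d + 2)) + M * B0 * s ^ ?d * 4 ^ ?d / L\<^sup>2 * (4 / s) ^ ?d"
      proof (intro add_mono mult_left_mono)
        have "(\<Sum>z\<in>F. rho y z ^ (2 * Suc ?d) * (?u z)\<^sup>2 * m z) \<le> moment y (s\<^sup>2)"
          unfolding moment_def using F rho_power_nonneg
          by (intro finite_sum_le_infsum[OF moment_summable]) (auto intro!: mult_nonneg_nonneg simp del: power_Suc mult_Suc_right)
        then show "(\<Sum>z\<in>F. rho y z ^ (2 * Suc ?d) * (?u z)\<^sup>2 * m z) \<le> B0 * s ^ (?d + 2)"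
          using B0F[of s y] s by linarith
        have "(\<Sum>z\<in>F. ?q z) = (\<Sum>v\<in>(\<lambda>z. z - y) ` F. \<Prod>i\<in>UNIV. 1 / (s + \<bar>real_of_int (v $ i)\<bar>)\<^sup>2)"
          by (subst sum.reindex) auto
        also have "\<dots> \<le> (4 / s) ^ ?d" using s F by (intro sum_lattice_decay) auto
        finally show "(\<Sum>z\<in>F. ?q z) \<le> (4 / s) ^ ?d" .
      qed (use l M_pos B0 sp in auto)
      also have "l / 2 * (B0 * s ^ (?d + 2)) = 1 / 4" using B0 sp by (simp add: l_def)
      also have "M * B0 * s ^ ?d * 4 ^ ?d / L\<^sup>2 * (4 / s) ^ ?d = M * B0 * 16 ^ ?d / L\<^sup>2"
        using sp by (simp add: power_divide power_mult_distrib[symmetric])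
      also have "\<dots> \<le> 1 / 4" using L2 L by (simp add: divide_le_eq)
      finally show ?thesis by simp
    qed
    have "1 = (\<Sum>\<^sub>\<infinity>z. ?u z * m z)" using p_mass infsumI by metis
    also have "\<dots> \<le> (\<Sum>z\<in>B. ?u z * m z) + 1 / 2"
    proof (rule infsum_le_finite_sums[OF has_sum_imp_summable[OF p_mass]])
      fix F :: "(int ^ 'n) set" assume F: "finite F"
      have "(\<Sum>z\<in>F. ?u z * m z) = (\<Sum>z\<in>F \<inter> B. ?u z * m z) + (\<Sum>z\<in>F - B. ?u z * m z)"
        using F by (rule sum.Int_Diff)
      also have "(\<Sum>z\<in>F \<inter> B. ?u z * m z) \<le> (\<Sum>z\<in>B. ?u z * m z)"
        using B u by (intro sum_mono2) auto
      also have "(\<Sum>z\<in>F - B. ?u z * m z) \<le> 1 / 2" using F by (intro outer) auto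
      finally show "(\<Sum>z\<in>F. ?u z * m z) \<le> (\<Sum>z\<in>B. ?u z * m z) + 1 / 2" by simp
    qed
    finally show ?thesis by simp
  qed
  then show ?thesis using L by blast
qed

end

section \<open>A lower bound for the mean logarithm\<close>

context lattice begin

text \<open>A mass of at least 1/2 in a cube, with density O(s^(-d)) by the upper bound, must occupy
  at least of the order of s^d points, since points below the threshold carry at most 1/4 in total.
  The estimate is uniform over the time interval on which the Riccati inequality will run.\<close>

lemma superlevel_card:
  "\<exists>L\<ge>1. \<exists>\<kappa>>0. \<exists>\<epsilon>>0. \<forall>s\<ge>1. \<forall>t x0 o' r. s\<^sup>2 \<le> t \<longrightarrow> t \<le> 4 * s\<^sup>2 \<longrightarrow> l1 (o' - x0) \<le> s
    \<longrightarrow> (2 * L + 1) * s \<le> real_of_int r \<longrightarrow> real_of_int r \<le> (2 * L + 3) * s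
    \<longrightarrow> \<kappa> * s ^ CARD('n) \<le> real (card {v \<in> cube r. \<epsilon> / s ^ CARD('n) \<le> p t (x0 + v) o'})"
proof -
  let ?d = "CARD('n)"
  obtain L where L: "L \<ge> 1" and conc: "\<And>s y B. s \<ge> 1 \<Longrightarrow> finite B \<Longrightarrow> (\<And>z. rho y z \<le> L * s \<Longrightarrow> z \<in> B)
      \<Longrightarrow> 1 / 2 \<le> (\<Sum>z\<in>B. p (s\<^sup>2) z y * m z)"
    using concentration by metis
  obtain K where K: "K > 0" and pK: "\<And>s x y. s \<ge> 1/2 \<Longrightarrow> p (2 * s\<^sup>2) x y \<le> K / s ^ ?d"
    using p_upper by metis
  define a where "a = 2 * (2 * L + 3)"
  have a: "a > 0" using L by (simp add: a_def)
  \<comment> \<open>The cube has at most (a s)^d points of measure at most M, so those below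
    \<epsilon> / s^d carry at most 1/4.\<close>
  define \<epsilon> where "\<epsilon> = 1 / (4 * M * a ^ ?d)"
  have \<epsilon>: "\<epsilon> > 0" using M_pos a by (simp add: \<epsilon>_def)
  define \<kappa> where "\<kappa> = 1 / (4 * (K * 2 ^ ?d) * M)"
  have \<kappa>: "\<kappa> > 0" using M_pos K by (simp add: \<kappa>_def)
  have "\<kappa> * s ^ ?d \<le> real (card {v \<in> cube r. \<epsilon> / s ^ ?d \<le> p t (x0 + v) o'})"
    if s: "s \<ge> 1" and t: "s\<^sup>2 \<le> t" "t \<le> 4 * s\<^sup>2" and o': "l1 (o' - x0) \<le> s"
      and r: "(2 * L + 1) * s \<le> real_of_int r" "real_of_int r \<le> (2 * L + 3) * s" for s t x0 o' r
  proof -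
    define \<sigma> where "\<sigma> = sqrt t"
    have t0: "t \<ge> 1" using t s one_le_power[of s 2] by linarith
    have \<sigma>t: "\<sigma>\<^sup>2 = t" using t0 by (simp add: \<sigma>_def)
    have \<sigma>1: "s \<le> \<sigma>" using t s by (simp add: \<sigma>_def real_le_rsqrt)
    have \<sigma>2: "\<sigma> \<le> 2 * s" unfolding \<sigma>_def using t s by (intro real_le_lsqrt) (auto simp: power_mult_distrib)
    have sp: "s > 0" using s by linarith
    let ?u = "\<lambda>v. p t (x0 + v) o'" and ?U = "K * 2 ^ ?d / s ^ ?d"
    let ?A = "{v \<in> cube r. \<epsilon> / s ^ ?d \<le> p t (x0 + v) o'}"
    have u0: "0 \<le> ?u v" for v using t0 by (intro p_nonneg) simp
    have uU: "?u v \<le> ?U" for v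
    proof -
      have s2: "s / 2 \<le> \<sigma> / sqrt 2"
      proof -
        have "sqrt 2 \<le> 2" by (rule real_le_lsqrt) auto
        then have "s * sqrt 2 \<le> \<sigma> * 2" using \<sigma>1 sp by (intro mult_mono) auto
        then show ?thesis by (simp add: field_simps)
      qed
      \<comment> \<open>The upper bound is stated at times 2 s^2, hence the argument \<sigma> / sqrt
        2 for time t.\<close>
      then have "p (2 * (\<sigma> / sqrt 2)\<^sup>2) (x0 + v) o' \<le> K / (\<sigma> / sqrt 2) ^ ?d" using s s2 by (intro pK) linarith
      also have "\<dots> \<le> K / (s / 2) ^ ?d" using s2 K sp \<sigma>1 by (intro divide_left_mono power_mono mult_pos_pos zero_less_power) auto
      finally show ?thesis by (simp add: power_divide \<sigma>t)
    qed
    have "1 / 2 \<le> (\<Sum>z\<in>(\<lambda>v. x0 + v) ` cube r. p (\<sigma>\<^sup>2) z o' * m z)"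
    proof (rule conc)
      show "1 \<le> \<sigma>" using s \<sigma>1 by linarith
      fix z assume z: "rho o' z \<le> L * \<sigma>"
      have "L * \<sigma> \<le> L * (2 * s)" using \<sigma>2 L by (intro mult_left_mono) auto
      then have "l1 (z - x0) < (2 * L + 1) * s"
        using z l1_triangle[of z x0 o'] o' by (simp add: rho_def algebra_simps)
      then have "\<bar>real_of_int ((z - x0) $ i)\<bar> < real_of_int r" for i
        using component_le_l1[of "z - x0" i] r by linarith
      then have "\<bar>(z - x0) $ i\<bar> < r" for i by (metis of_int_abs of_int_less_iff)
      then have "- r < (z - x0) $ i \<and> (z - x0) $ i < r" for i by (metis abs_less_iff minus_less_iff)
      then have "z - x0 \<in> cube r" by (simp only: cube_def mem_Collect_eq) blast
      then have "x0 + (z - x0) \<in> (\<lambda>v. x0 + v) ` cube r" by (rule imageI)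
      then show "z \<in> (\<lambda>v. x0 + v) ` cube r" by simp
    qed simp
    also have "\<dots> = (\<Sum>v\<in>cube r. ?u v * m (x0 + v))"
      by (subst sum.reindex) (auto simp: \<sigma>t)
    also have "\<dots> \<le> (\<Sum>v\<in>cube r. (if v \<in> ?A then ?U * M else 0) + \<epsilon> / s ^ ?d * M)"
    proof (rule sum_mono)
      fix v :: "int ^ 'n" assume v: "v \<in> cube r"
      show "?u v * m (x0 + v) \<le> (if v \<in> ?A then ?U * M else 0) + \<epsilon> / s ^ ?d * M"
      proof (cases "v \<in> ?A")
        case True
        have "?u v * m (x0 + v) \<le> ?U * M"
          using uU[of v] m_le[of "x0 + v"] K sp by (intro mult_mono) auto
        moreover have "0 \<le> \<epsilon> / s ^ ?d * M" using \<epsilon> M_pos sp by simp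
        ultimately show ?thesis using True by (simp only: if_True)
      next
        case False
        then have "?u v \<le> \<epsilon> / s ^ ?d" using v by auto
        then have "?u v * m (x0 + v) \<le> \<epsilon> / s ^ ?d * M"
          using m_le[of "x0 + v"] u0[of v] by (intro mult_mono) (auto intro: order_trans)
        then show ?thesis using False by (simp only: if_False)
      qed
    qed
    also have "\<dots> = real (card ?A) * (?U * M) + real (card (cube r :: (int ^ 'n) set)) * (\<epsilon> / s ^ ?d * M)"
    proof -
      have "(\<Sum>v\<in>cube r. if v \<in> ?A then ?U * M else 0) = (\<Sum>v\<in>?A. ?U * M)"
        by (rule sum.mono_neutral_cong_right) auto
      then show ?thesis by (simp only: sum.distrib sum_constant)
    qed
    also have "real (card (cube r :: (int ^ 'n) set)) * (\<epsilon> / s ^ ?d * M) \<le> (a * s) ^ ?d * (\<epsilon> / s ^ ?d * M)"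
    proof (rule mult_right_mono)
      have "s \<le> (2 * L + 1) * s" using L sp by simp
      then have r1: "1 \<le> r" using r s by linarith
      have "2 * real_of_int r - 1 \<le> a * s" using r unfolding a_def mult.assoc by linarith
      then show "real (card (cube r :: (int ^ 'n) set)) \<le> (a * s) ^ ?d"
        unfolding card_cube[OF r1] using r1 by (intro power_mono) auto
    qed (use \<epsilon> M_pos sp in simp)
    also have "\<dots> = 1 / 4" using a M_pos sp by (simp add: \<epsilon>_def power_mult_distrib)
    finally have "1 / 4 \<le> real (card ?A) * (?U * M)" by linarith
    then show ?thesis using K M_pos sp by (simp add: \<kappa>_def field_simps)
  qed
  then show ?thesis using L \<kappa> \<epsilon> by blast
qed

text \<open>Taking the tent at twice the radius keeps the weight at least r^(2d) on the inner cube;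
  about r^d points of weight about r^(2d) account for the exponent 3d.\<close>

lemma tent_mass:
  fixes x0 :: "int ^ 'n"
  assumes r: "r \<ge> 1"
  defines "f \<equiv> profile.\<phi> (tent (2 * r)) :: int ^ 'n \<Rightarrow> real"
  shows "\<And>v. v \<in> cube r \<Longrightarrow> (real_of_int r)\<^sup>2 ^ CARD('n) \<le> f v"
    and "c * (real_of_int r) ^ (3 * CARD('n)) \<le> (\<Sum>v\<in>cube (2 * r). f v * m (x0 + v))"
    and "(\<Sum>v\<in>cube (2 * r). f v * m (x0 + v)) \<le> M * 2 ^ CARD('n) * (2 * real_of_int r) ^ (3 * CARD('n))"
proof -
  interpret tent_weight "2 * r" by unfold_locales (use r in simp)
  have \<phi>_eq: "\<phi> = f" by (simp add: f_def)
  let ?d = "CARD('n)"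
  show low: "(real_of_int r)\<^sup>2 ^ CARD('n) \<le> f v" if "v \<in> cube r" for v
  proof -
    have "(real_of_int r)\<^sup>2 ^ CARD('n) = (\<Prod>i\<in>(UNIV :: 'n set). (real_of_int r)\<^sup>2)" by simp
    also have "\<dots> \<le> \<phi> v"
      unfolding \<phi>_def
    proof (intro prod_mono conjI)
      fix i
      have "- r < v $ i" "v $ i < r" using that by (auto simp: cube_def)
      then have "r \<le> max 0 (2 * r - \<bar>v $ i\<bar>)" by linarith
      then have "real_of_int r \<le> real_of_int (max 0 (2 * r - \<bar>v $ i\<bar>))" by (simp only: of_int_le_iff)
      then show "(real_of_int r)\<^sup>2 \<le> tent (2 * r) (v $ i)" unfolding tent_def using r by (intro power_mono) auto
    qed simp
    finally show ?thesis by (simp add: \<phi>_eq)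
  qed
  have f0: "0 \<le> f v" for v using \<phi>_nonneg[of v] by (simp add: \<phi>_eq)
  have sub: "cube r \<subseteq> (cube (2 * r) :: (int ^ 'n) set)"
    using r by (auto simp: cube_def) (smt (verit))+
  have "c * (real_of_int r) ^ (3 * ?d) = (real_of_int r) ^ ?d * ((real_of_int r)\<^sup>2 ^ ?d * c)"
    by (simp add: power_mult[symmetric] power_add[symmetric])
  also have "\<dots> \<le> real (card (cube r :: (int ^ 'n) set)) * ((real_of_int r)\<^sup>2 ^ ?d * c)"
    unfolding card_cube[OF r] using r c_pos by (intro mult_right_mono power_mono) auto
  also have "\<dots> = (\<Sum>v\<in>(cube r :: (int ^ 'n) set). (real_of_int r)\<^sup>2 ^ ?d * c)" by simp
  also have "\<dots> \<le> (\<Sum>v\<in>cube r. f v * m (x0 + v))"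
    using low m_ge c_pos f0 by (intro sum_mono mult_mono) auto
  also have "\<dots> \<le> (\<Sum>v\<in>cube (2 * r). f v * m (x0 + v))"
    using sub f0 by (intro sum_mono2) auto
  finally show "c * (real_of_int r) ^ (3 * ?d) \<le> (\<Sum>v\<in>cube (2 * r). f v * m (x0 + v))" .
  have r2: "2 * r \<ge> 1" using r by simp
  have "(\<Sum>v\<in>cube (2 * r). f v * m (x0 + v)) \<le> (\<Sum>v\<in>(cube (2 * r) :: (int ^ 'n) set). (real_of_int (2 * r))\<^sup>2 ^ ?d * M)"
  proof (intro sum_mono mult_mono)
    show "f v \<le> (real_of_int (2 * r))\<^sup>2 ^ ?d" for v using \<phi>_le[of v] by (simp only: \<phi>_eq)
  qed (auto simp: m_le f0)
  also have "\<dots> = real (card (cube (2 * r) :: (int ^ 'n) set)) * ((real_of_int (2 * r))\<^sup>2 ^ ?d * M)" by simp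
  also have "\<dots> \<le> (2 * real_of_int (2 * r)) ^ ?d * ((real_of_int (2 * r))\<^sup>2 ^ ?d * M)"
    unfolding card_cube[OF r2] using r M_pos by (intro mult_right_mono power_mono) auto
  also have "\<dots> = M * 2 ^ ?d * ((2 * real_of_int r) ^ ?d * (2 * real_of_int r) ^ (2 * ?d))"
    by (simp only: power_mult_distrib power_mult[symmetric] of_int_mult of_int_numeral mult_ac)
  also have "(2 * real_of_int r) ^ ?d * (2 * real_of_int r) ^ (2 * ?d) = (2 * real_of_int r) ^ (3 * ?d)"
    by (simp only: power_add[symmetric]) simp
  finally show "(\<Sum>v\<in>cube (2 * r). f v * m (x0 + v)) \<le> M * 2 ^ ?d * (2 * real_of_int r) ^ (3 * ?d)" .
qed

text \<open>The mean \<open>g\<close> is taken with weight \<phi> m, as the time derivative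
  dictates, whereas the Poincare inequality concerns the mean \<open>b\<close> for \<phi> alone. The
  former minimises the quadratic deviation with weight \<phi> m, so replacing \<open>g\<close> by
  \<open>b\<close> only increases the sum.\<close>

lemma log_variance:
  fixes x0 :: "int ^ 'n" and F :: "int ^ 'n \<Rightarrow> real"
  assumes R: "R \<ge> 1" and S: "0 < (\<Sum>v\<in>cube R. profile.\<phi> (tent R) v * m (x0 + v))"
    and g: "(\<Sum>v\<in>cube R. profile.\<phi> (tent R) v * m (x0 + v) * F v) = g * (\<Sum>v\<in>cube R. profile.\<phi> (tent R) v * m (x0 + v))"
  shows "(\<Sum>v\<in>cube R. profile.\<phi> (tent R) v * m (x0 + v) * (F v - g)\<^sup>2)
    \<le> M * 2 ^ CARD('n) * 4 * (real_of_int R)\<^sup>2 * (\<Sum>v\<in>cube R. \<Sum>i\<in>UNIV. profile.grad_energy (tent R) F i v)"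
proof -
  interpret tent_weight R by unfold_locales (rule R)
  let ?c = "cube R :: (int ^ 'n) set"
  define P where "P = sum \<phi> ?c"
  define b where "b = (\<Sum>v\<in>?c. \<phi> v * F v) / P"
  define N where "N = (\<Sum>v\<in>?c. \<Sum>i\<in>UNIV. grad_energy F i v)"
  have P: "P > 0"
  proof (rule ccontr)
    assume "\<not> P > 0"
    then have "P = 0" using sum_nonneg[of ?c \<phi>] \<phi>_nonneg by (auto simp: P_def not_less intro: antisym)
    then have "\<forall>v\<in>?c. \<phi> v = 0"
      unfolding P_def by (subst (asm) sum_nonneg_eq_0_iff) (auto simp: \<phi>_nonneg)
    then show False using S by simp
  qed
  have b: "(\<Sum>v\<in>?c. \<phi> v * F v) = b * P" using P by (simp add: b_def)
  have "(\<Sum>v\<in>?c. \<phi> v * m (x0 + v) * (F v - g)\<^sup>2) \<le> (\<Sum>v\<in>?c. \<phi> v * m (x0 + v) * (F v - b)\<^sup>2)"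
    by (rule mean_minimises[OF g less_imp_le[OF S]])
  also have "\<dots> \<le> (\<Sum>v\<in>?c. M * (\<phi> v * (F v - b)\<^sup>2))"
  proof (rule sum_mono)
    show "\<phi> v * m (x0 + v) * (F v - b)\<^sup>2 \<le> M * (\<phi> v * (F v - b)\<^sup>2)" for v
      using mult_right_mono[OF m_le[of "x0 + v"], of "\<phi> v * (F v - b)\<^sup>2"] \<phi>_nonneg[of v] by (simp add: mult_ac)
  qed
  also have "\<dots> = M * (\<Sum>v\<in>?c. \<phi> v * (F v - b)\<^sup>2)" by (simp add: sum_distrib_left)
  also have "(\<Sum>v\<in>?c. \<phi> v * (F v - b)\<^sup>2) \<le> 2 ^ CARD('n) * 4 * (real_of_int R)\<^sup>2 * N"
  proof -
    have "(\<Sum>v\<in>?c. \<phi> v * (F v - b)\<^sup>2) = (\<Sum>v\<in>?c. \<phi> v * (F v)\<^sup>2 - 2 * b * (\<phi> v * F v) + b\<^sup>2 * \<phi> v)"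
      by (rule sum.cong) (auto simp: power2_eq_square algebra_simps)
    also have "\<dots> = (\<Sum>v\<in>?c. \<phi> v * (F v)\<^sup>2) - 2 * b * (\<Sum>v\<in>?c. \<phi> v * F v) + b\<^sup>2 * P"
      by (simp only: sum.distrib sum_subtractf sum_distrib_left P_def)
    also have "\<dots> = (\<Sum>v\<in>?c. \<phi> v * (F v)\<^sup>2) - b\<^sup>2 * P"
      unfolding b by (simp add: power2_eq_square)
    finally have e: "(\<Sum>v\<in>?c. \<phi> v * (F v - b)\<^sup>2) = (\<Sum>v\<in>?c. \<phi> v * (F v)\<^sup>2) - b\<^sup>2 * P" .
    have "P * (\<Sum>v\<in>?c. \<phi> v * (F v - b)\<^sup>2) = P * (\<Sum>v\<in>?c. \<phi> v * (F v)\<^sup>2) - (\<Sum>v\<in>?c. \<phi> v * F v)\<^sup>2"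
      unfolding e b by (simp add: power2_eq_square algebra_simps)
    also have "\<dots> \<le> P * (2 ^ CARD('n) * 4 * (real_of_int R)\<^sup>2 * N)"
      using weighted_poincare[of F] by (simp add: P_def N_def mult_ac)
    finally show ?thesis using P by (simp only: mult_le_cancel_left_pos)
  qed
  finally show ?thesis using M_pos by (simp add: N_def mult.assoc)
qed

text \<open>In the proof \<open>h\<close> measures how far the mean logarithm lies below
  ln(\<epsilon> / s^d). While it is nonnegative, every superlevel point deviates from the mean by at
  least \<open>h\<close>, so the variance, and with it the Dirichlet energy, is bounded below by a
  multiple of h^2. The resulting inequality has rates A / s^2 and B / s^2 on an interval of length 3
  s^2, so the bound \<open>H\<close> is free of s.\<close>

lemma log_mean_lower:
  "\<exists>L\<ge>1. \<exists>b>0. \<forall>s\<ge>1. \<forall>x0 o' r. l1 (o' - x0) \<le> s \<longrightarrow> (2 * L + 1) * s \<le> real_of_int r \<longrightarrow> real_of_int r \<le> (2 * L + 3) * s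
    \<longrightarrow> (\<Sum>v\<in>cube (2 * r). profile.\<phi> (tent (2 * r)) v * m (x0 + v)) * ln (b / s ^ CARD('n))
      \<le> (\<Sum>v\<in>cube (2 * r). profile.\<phi> (tent (2 * r)) v * m (x0 + v) * ln (p (4 * s\<^sup>2) (x0 + v) o'))"
proof -
  let ?d = "CARD('n)"
  obtain L \<kappa> \<epsilon> where L: "L \<ge> 1" and \<kappa>: "\<kappa> > 0" and \<epsilon>: "\<epsilon> > 0"
    and sup: "\<forall>s\<ge>1. \<forall>t x0 o' r. s\<^sup>2 \<le> t \<longrightarrow> t \<le> 4 * s\<^sup>2 \<longrightarrow> l1 (o' - x0) \<le> s
      \<longrightarrow> (2 * L + 1) * s \<le> real_of_int r \<longrightarrow> real_of_int r \<le> (2 * L + 3) * s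
      \<longrightarrow> \<kappa> * s ^ ?d \<le> real (card {v \<in> cube r. \<epsilon> / s ^ ?d \<le> p t (x0 + v) o'})"
    using superlevel_card by blast
  define a where "a = 2 * L + 3"
  have a: "a > 0" using L by (simp add: a_def)
  \<comment> \<open>\<open>A\<close> and \<open>B\<close> are read off the estimates
    \<open>ii\<close> and \<open>i\<close> below: the error term and the variance term relative to
    the total weight \<open>S\<close>.\<close>
  define A where "A = 9 * M * 16 ^ ?d / (4 * c)"
  define B where "B = c\<^sup>2 * \<kappa> / (128 * M\<^sup>2 * 32 ^ ?d * a ^ ?d * a\<^sup>2)"
  have A: "A \<ge> 0" using c_pos M_pos by (simp add: A_def)
  have B: "B > 0" using c_pos \<kappa> M_pos a by (simp add: B_def)
  define H where "H = sqrt (2 * A / B) + 2 / (3 * B)"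
  define b where "b = \<epsilon> * exp (- H)"
  have b: "b > 0" using \<epsilon> by (simp add: b_def)
  have "(\<Sum>v\<in>cube (2 * r). profile.\<phi> (tent (2 * r)) v * m (x0 + v)) * ln (b / s ^ CARD('n))
      \<le> (\<Sum>v\<in>cube (2 * r). profile.\<phi> (tent (2 * r)) v * m (x0 + v) * ln (p (4 * s\<^sup>2) (x0 + v) o'))"
    if s: "s \<ge> 1" and o': "l1 (o' - x0) \<le> s" and r: "(2 * L + 1) * s \<le> real_of_int r" "real_of_int r \<le> (2 * L + 3) * s"
    for s x0 o' r
  proof -
    have sp: "s > 0" using s by linarith
    have "s \<le> (2 * L + 1) * s" using L sp by simp
    then have rs: "s \<le> real_of_int r" using r by linarith
    then have r1: "1 \<le> r" using s by linarith
    have ra: "real_of_int r \<le> a * s" using r by (simp add: a_def)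
    interpret tent_weight "2 * r" by unfold_locales (use r1 in simp)
    define R where "R = real_of_int r"
    have R: "R > 0" "s \<le> R" "R \<le> a * s" using sp rs ra by (simp_all add: R_def)
    define W where "W = (\<lambda>v. \<phi> v * m (x0 + v))"
    define S where "S = (\<Sum>v\<in>cube (2 * r). W v)"
    define G where "G = (\<lambda>t. \<Sum>v\<in>cube (2 * r). W v * ln (p t (x0 + v) o'))"
    define lv where "lv = ln (\<epsilon> / s ^ ?d)"
    define h where "h = (\<lambda>t. lv - G t / S)"
    have W0: "0 \<le> W v" for v by (simp add: W_def \<phi>_nonneg)
    have S1: "c * R ^ (3 * ?d) \<le> S" and S2: "S \<le> M * 2 ^ ?d * (2 * R) ^ (3 * ?d)"
      using tent_mass(2,3)[OF r1, of x0] by (simp_all add: S_def W_def R_def)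
    have "0 < c * R ^ (3 * ?d)" using c_pos R by simp
    then have S: "S > 0" using S1 by linarith
    let ?N = "\<lambda>t. \<Sum>v\<in>cube (2 * r). \<Sum>i\<in>UNIV. grad_energy (\<lambda>v. ln (p t (x0 + v) o')) i v"
    have "\<exists>D. (G has_real_derivative D) (at t) \<and>
        c / 8 * ?N t - 9 * (2 * R)\<^sup>2 ^ (?d - 1) * M * (4 * R) ^ ?d \<le> D" if t: "t > 0" for t
    proof -
      have r2: "2 * r \<ge> 1" using r1 by simp
      have R2: "real_of_int (2 * r) = 2 * R" "2 * (2 * R) = 4 * R" by (simp_all add: R_def)
      show ?thesis
        using log_mean_deriv[OF r2 t, of x0 o'] unfolding R2 G_def W_def by blast
    qed
    then obtain D where D: "\<And>t. t > 0 \<Longrightarrow> (G has_real_derivative D t) (at t)"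
      and DN: "\<And>t. t > 0 \<Longrightarrow> c / 8 * ?N t - 9 * (2 * R)\<^sup>2 ^ (?d - 1) * M * (4 * R) ^ ?d \<le> D t"
      by metis
    have "h (4 * s\<^sup>2) \<le> sqrt (2 * (A / s\<^sup>2) / (B / s\<^sup>2)) + 2 / (B / s\<^sup>2 * (4 * s\<^sup>2 - s\<^sup>2))"
    proof (rule riccati[where h' = "\<lambda>t. - (D t / S)"])
      fix t assume t: "s\<^sup>2 \<le> t" "t \<le> 4 * s\<^sup>2"
      have tp: "t > 0" using t sp by (meson less_le_trans zero_less_power)
      show "(h has_real_derivative - (D t / S)) (at t)"
        unfolding h_def using DERIV_diff[OF DERIV_const DERIV_cdivide[OF D[OF tp]]] by simp
      assume ht: "0 \<le> h t"
      let ?F = "\<lambda>v. ln (p t (x0 + v) o')" and ?g = "G t / S"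
      let ?V = "\<Sum>v\<in>cube (2 * r). W v * (?F v - ?g)\<^sup>2"
      let ?A1 = "{v \<in> cube r. \<epsilon> / s ^ ?d \<le> p t (x0 + v) o'}"
      have V_le: "?V \<le> M * 2 ^ ?d * 4 * (2 * R)\<^sup>2 * ?N t"
        using log_variance[of "2 * r" x0 ?F ?g] r1 S by (simp add: W_def S_def G_def R_def)
      have "R\<^sup>2 ^ ?d * c * (h t)\<^sup>2 * (\<kappa> * s ^ ?d) \<le> ?V"
      proof -
        have sub: "?A1 \<subseteq> cube (2 * r)" using r1 by (auto simp: cube_def) (smt (verit))+
        have "R\<^sup>2 ^ ?d * c * (h t)\<^sup>2 * (\<kappa> * s ^ ?d) \<le> R\<^sup>2 ^ ?d * c * (h t)\<^sup>2 * real (card ?A1)"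
          using sup s t o' r c_pos by (intro mult_left_mono) auto
        also have "\<dots> = (\<Sum>v\<in>?A1. R\<^sup>2 ^ ?d * c * (h t)\<^sup>2)" by simp
        also have "\<dots> \<le> (\<Sum>v\<in>?A1. W v * (?F v - ?g)\<^sup>2)"
        proof (rule sum_mono)
          fix v assume v: "v \<in> ?A1"
          have "R\<^sup>2 ^ ?d * c \<le> W v"
            unfolding W_def R_def using tent_mass(1)[OF r1, of v] v m_ge c_pos \<phi>_nonneg by (intro mult_mono) auto
          moreover have "lv \<le> ?F v" unfolding lv_def using v \<epsilon> sp by (intro ln_mono) auto
          then have "(h t)\<^sup>2 \<le> (?F v - ?g)\<^sup>2" using ht unfolding h_def by (intro power_mono) auto
          ultimately show "R\<^sup>2 ^ ?d * c * (h t)\<^sup>2 \<le> W v * (?F v - ?g)\<^sup>2" using W0 by (intro mult_mono) auto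
        qed
        also have "\<dots> \<le> ?V" using sub W0 by (intro sum_mono2) auto
        finally show ?thesis .
      qed
      then have "R\<^sup>2 ^ ?d * c * (h t)\<^sup>2 * (\<kappa> * s ^ ?d) \<le> M * 2 ^ ?d * 4 * (2 * R)\<^sup>2 * ?N t"
        using V_le by linarith
      then have N: "R\<^sup>2 ^ ?d * c * (h t)\<^sup>2 * (\<kappa> * s ^ ?d) / (M * 2 ^ ?d * 16 * R\<^sup>2) \<le> ?N t"
        using M_pos R by (simp add: field_simps)
      \<comment> \<open>Power count: \<open>S\<close> is at most of order R^(3d), while the energy
        bound \<open>N\<close> carries R^(2d) s^d / R^2; since R <= a s these agree up to the factor
        s^(-2).\<close>
      have i: "B / s\<^sup>2 * (h t)\<^sup>2 * S \<le> c / 8 * ?N t"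
      proof -
        have "B / s\<^sup>2 * (h t)\<^sup>2 * S \<le> B / s\<^sup>2 * (h t)\<^sup>2 * (M * 2 ^ ?d * (2 * R) ^ (3 * ?d))"
          using S2 B by (intro mult_left_mono) auto
        also have "\<dots> = B * M * 16 ^ ?d * (R\<^sup>2 ^ ?d) * (R ^ ?d * R\<^sup>2) * ((h t)\<^sup>2 / (s\<^sup>2 * R\<^sup>2))"
        proof -
          have "(2 * R) ^ (3 * ?d) = (2 ^ 3) ^ ?d * (R\<^sup>2 ^ ?d * R ^ ?d)"
            by (simp only: power_mult_distrib power_mult[symmetric] power_add[symmetric]) simp
          moreover have "2 ^ ?d * (2 ^ 3) ^ ?d = (16 :: real) ^ ?d" by (simp add: power_mult_distrib[symmetric])
          ultimately have "2 ^ ?d * (2 * R) ^ (3 * ?d) = 16 ^ ?d * (R\<^sup>2 ^ ?d * R ^ ?d)" by (simp only: mult.assoc[symmetric])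
          then have "B / s\<^sup>2 * (h t)\<^sup>2 * (M * 2 ^ ?d * (2 * R) ^ (3 * ?d)) = B / s\<^sup>2 * (h t)\<^sup>2 * (M * (16 ^ ?d * (R\<^sup>2 ^ ?d * R ^ ?d)))"
            by (simp only: mult.assoc)
          also have "\<dots> = B * M * 16 ^ ?d * (R\<^sup>2 ^ ?d) * (R ^ ?d * R\<^sup>2) * ((h t)\<^sup>2 / (s\<^sup>2 * R\<^sup>2))"
            using R sp by (simp add: field_simps)
          finally show ?thesis .
        qed
        also have "\<dots> \<le> B * M * 16 ^ ?d * (R\<^sup>2 ^ ?d) * ((a * s) ^ ?d * (a * s)\<^sup>2) * ((h t)\<^sup>2 / (s\<^sup>2 * R\<^sup>2))"
          using R B M_pos a sp by (intro mult_right_mono mult_left_mono mult_mono power_mono) auto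
        also have "\<dots> = c / 8 * (R\<^sup>2 ^ ?d * c * (h t)\<^sup>2 * (\<kappa> * s ^ ?d) / (M * 2 ^ ?d * 16 * R\<^sup>2))"
        proof -
          have "(32 :: real) ^ ?d = 2 ^ ?d * 16 ^ ?d" by (simp add: power_mult_distrib[symmetric])
          then show ?thesis
            unfolding B_def using a sp M_pos R c_pos by (simp add: power_mult_distrib field_simps power2_eq_square)
        qed
        also have "\<dots> \<le> c / 8 * ?N t" using N c_pos by (intro mult_left_mono) auto
        finally show ?thesis .
      qed
      have ii: "9 * (2 * R)\<^sup>2 ^ (?d - 1) * M * (4 * R) ^ ?d \<le> A / s\<^sup>2 * S"
      proof -
        have sq: "(2 * R)\<^sup>2 ^ (?d - 1) * (2 * R)\<^sup>2 = (2 * R)\<^sup>2 ^ ?d"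
          by (rule power_minus_mult) simp
        have "(2 * R)\<^sup>2 ^ ?d * (4 * R) ^ ?d = (16 * R ^ 3) ^ ?d"
          by (simp only: power_mult_distrib[symmetric]) (simp add: power2_eq_square power3_eq_cube mult_ac)
        also have "\<dots> = 16 ^ ?d * R ^ (3 * ?d)" by (simp only: power_mult_distrib power_mult)
        finally have "9 * (2 * R)\<^sup>2 ^ (?d - 1) * M * (4 * R) ^ ?d * (2 * R)\<^sup>2 = 9 * M * (16 ^ ?d * R ^ (3 * ?d))"
          unfolding sq[symmetric] by (simp only: mult_ac)
        then have "9 * (2 * R)\<^sup>2 ^ (?d - 1) * M * (4 * R) ^ ?d = 9 * M * (16 ^ ?d * R ^ (3 * ?d)) / (2 * R)\<^sup>2"
          using R by (simp add: eq_divide_eq)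
        also have "\<dots> = A / R\<^sup>2 * (c * R ^ (3 * ?d))"
          using c_pos R by (simp add: A_def power_mult_distrib)
        also have "\<dots> \<le> A / s\<^sup>2 * S"
          using R S1 A c_pos sp by (intro mult_mono divide_left_mono power_mono) auto
        finally show ?thesis .
      qed
      have "A / s\<^sup>2 * S - B / s\<^sup>2 * (h t)\<^sup>2 * S \<ge> - D t"
        using DN[OF tp] i ii by linarith
      then have "- D t \<le> (A / s\<^sup>2 - B / s\<^sup>2 * (h t)\<^sup>2) * S" by (simp add: left_diff_distrib)
      then have "- D t / S \<le> A / s\<^sup>2 - B / s\<^sup>2 * (h t)\<^sup>2" using S by (simp only: pos_divide_le_eq)
      then show "- (D t / S) \<le> A / s\<^sup>2 - B / s\<^sup>2 * (h t)\<^sup>2" by simp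
    qed (use sp A B in auto)
    also have "\<dots> = H" using sp B by (simp add: H_def field_simps)
    finally have "lv - H \<le> G (4 * s\<^sup>2) / S" by (simp add: h_def)
    moreover have "ln (b / s ^ ?d) = lv - H"
    proof -
      have "b / s ^ ?d = \<epsilon> / s ^ ?d * exp (- H)" by (simp add: b_def)
      moreover have "0 < \<epsilon> / s ^ ?d" using \<epsilon> sp by simp
      ultimately show ?thesis unfolding lv_def by (simp only: ln_mult_pos exp_gt_zero ln_exp)
    qed
    ultimately have "S * ln (b / s ^ ?d) \<le> G (4 * s\<^sup>2)" using S by (simp add: pos_le_divide_eq mult.commute)
    then show ?thesis by (simp add: S_def G_def W_def)
  qed
  then show ?thesis using L b by blast
qed

end

section \<open>Integration over time\<close>

context lattice begin

text \<open>The weight is centred at \<open>x\<close>, and both \<open>x\<close> and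
  \<open>y\<close> lie within s of it, so the bound for the mean logarithm applies to ln p(.,x) and
  ln p(.,y) with the same weight. Jensen's inequality turns the sum of the two into a lower bound
  for the semigroup sum, up to the maximum of \<phi>.\<close>

lemma p_lower: "\<exists>a>0. \<forall>s\<ge>1. \<forall>x y. l1 (x - y) \<le> s \<longrightarrow> a / s ^ CARD('n) \<le> p (8 * s\<^sup>2) x y"
proof -
  let ?d = "CARD('n)"
  obtain L b where L: "L \<ge> 1" and b: "b > 0" and low: "\<forall>s\<ge>1. \<forall>x0 o' r. l1 (o' - x0) \<le> s
    \<longrightarrow> (2 * L + 1) * s \<le> real_of_int r \<longrightarrow> real_of_int r \<le> (2 * L + 3) * s
    \<longrightarrow> (\<Sum>v\<in>cube (2 * r). profile.\<phi> (tent (2 * r)) v * m (x0 + v)) * ln (b / s ^ ?d)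
      \<le> (\<Sum>v\<in>cube (2 * r). profile.\<phi> (tent (2 * r)) v * m (x0 + v) * ln (p (4 * s\<^sup>2) (x0 + v) o'))"
    using log_mean_lower by blast
  define a where "a = c * b\<^sup>2 / 4 ^ ?d"
  have a: "a > 0" using c_pos b by (simp add: a_def)
  have "a / s ^ ?d \<le> p (8 * s\<^sup>2) x y" if s: "s \<ge> 1" and xy: "l1 (x - y) \<le> s" for s x y
  proof -
    have sp: "s > 0" using s by linarith
    define r where "r = \<lceil>(2 * L + 1) * s\<rceil>"
    have "real_of_int r \<le> (2 * L + 1) * s + 1" unfolding r_def by linarith
    then have r2: "real_of_int r \<le> (2 * L + 3) * s" using s by (simp add: algebra_simps)
    have r1: "(2 * L + 1) * s \<le> real_of_int r" by (simp add: r_def)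
    have "s \<le> (2 * L + 1) * s" using L sp by simp
    then have rs: "s \<le> real_of_int r" using r1 by linarith
    then have r_ge: "r \<ge> 1" using s by linarith
    interpret tent_weight "2 * r" by unfold_locales (use r_ge in simp)
    define R where "R = real_of_int r"
    have R: "R > 0" "s \<le> R" using sp rs by (simp_all add: R_def)
    define W where "W = (\<lambda>v. \<phi> v * m (x + v))"
    define S where "S = sum W (cube (2 * r))"
    let ?P = "\<lambda>v o'. p (4 * s\<^sup>2) (x + v) o'"
    have W0: "0 \<le> W v" for v by (simp add: W_def \<phi>_nonneg)
    have P0: "0 < ?P v o'" for v o' using sp by (intro p_pos) simp
    have S1: "c * R ^ (3 * ?d) \<le> S"
      using tent_mass(2)[OF r_ge, of x] by (simp add: S_def W_def R_def)
    have "0 < c * R ^ (3 * ?d)" using c_pos R by simp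
    then have S: "S > 0" using S1 by linarith
    have q: "0 < b / s ^ ?d" using b sp by simp
    have lw: "S * ln (b / s ^ ?d) \<le> (\<Sum>v\<in>cube (2 * r). W v * ln (?P v o'))" if "l1 (o' - x) \<le> s" for o'
      unfolding S_def W_def using low s that r1 r2 by blast
    have lx: "S * ln (b / s ^ ?d) \<le> (\<Sum>v\<in>cube (2 * r). W v * ln (?P v x))" using sp by (intro lw) simp
    have ly: "S * ln (b / s ^ ?d) \<le> (\<Sum>v\<in>cube (2 * r). W v * ln (?P v y))"
      using xy by (intro lw) (simp add: l1_minus_commute[of y])
    have mean: "2 * ln (b / s ^ ?d) \<le> (\<Sum>v\<in>cube (2 * r). W v * (ln (?P v x) + ln (?P v y))) / S"
    proof -
      have "2 * ln (b / s ^ ?d) * S \<le> (\<Sum>v\<in>cube (2 * r). W v * (ln (?P v x) + ln (?P v y)))"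
        unfolding distrib_left sum.distrib using lx ly by (simp add: mult.commute)
      then show ?thesis using S by (simp only: pos_le_divide_eq)
    qed
    have "(b / s ^ ?d)\<^sup>2 = exp (2 * ln (b / s ^ ?d))"
      using q by (simp add: exp_double)
    also have "\<dots> \<le> exp ((\<Sum>v\<in>cube (2 * r). W v * (ln (?P v x) + ln (?P v y))) / S)"
      using mean by simp
    finally have "S * (b / s ^ ?d)\<^sup>2 \<le> S * exp ((\<Sum>v\<in>cube (2 * r). W v * (ln (?P v x) + ln (?P v y))) / S)"
      using S by (intro mult_left_mono) auto
    also have "\<dots> \<le> (\<Sum>v\<in>cube (2 * r). W v * exp (ln (?P v x) + ln (?P v y)))"
      unfolding S_def using W0 S by (intro exp_mean_le) (auto simp: S_def)
    also have "\<dots> = (\<Sum>v\<in>cube (2 * r). \<phi> v * (?P v x * ?P v y * m (x + v)))"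
      using P0 by (simp add: exp_add W_def mult_ac)
    also have "\<dots> \<le> (\<Sum>v\<in>cube (2 * r). (real_of_int (2 * r))\<^sup>2 ^ ?d * (?P v x * ?P v y * m (x + v)))"
      using P0 by (intro sum_mono mult_right_mono \<phi>_le mult_nonneg_nonneg) (auto intro: less_imp_le)
    also have "\<dots> = (real_of_int (2 * r))\<^sup>2 ^ ?d * (\<Sum>z\<in>(\<lambda>v. x + v) ` cube (2 * r). p (4 * s\<^sup>2) z x * p (4 * s\<^sup>2) z y * m z)"
      by (subst sum.reindex) (auto simp: sum_distrib_left)
    also have "\<dots> \<le> (real_of_int (2 * r))\<^sup>2 ^ ?d * p (8 * s\<^sup>2) x y"
    proof (rule mult_left_mono)
      have "((\<lambda>z. p (4 * s\<^sup>2) z x * p (4 * s\<^sup>2) z y * m z) has_sum p (8 * s\<^sup>2) x y) UNIV"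
        using p_semigroup[of "4 * s\<^sup>2" "4 * s\<^sup>2" x y] by simp
      then show "(\<Sum>z\<in>(\<lambda>v. x + v) ` cube (2 * r). p (4 * s\<^sup>2) z x * p (4 * s\<^sup>2) z y * m z) \<le> p (8 * s\<^sup>2) x y"
        by (rule finite_sum_le_has_sum) (auto simp: p_nonneg)
    qed simp
    also have "(real_of_int (2 * r))\<^sup>2 ^ ?d = 4 ^ ?d * (R ^ ?d * R ^ ?d)"
    proof -
      have "(real_of_int (2 * r))\<^sup>2 = 4 * (R * R)" by (simp add: R_def power2_eq_square)
      then show ?thesis by (simp only: power_mult_distrib)
    qed
    finally have 1: "S * (b / s ^ ?d)\<^sup>2 \<le> 4 ^ ?d * (R ^ ?d * R ^ ?d) * p (8 * s\<^sup>2) x y" .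
    \<comment> \<open>Power count: total weight R^(3d) over maximal weight of order R^(2d) leaves
      R^d, which times s^(-2d) is at least s^(-d) because s <= R.\<close>
    have "a / s ^ ?d * (4 ^ ?d * (R ^ ?d * R ^ ?d)) = c * b\<^sup>2 * (R ^ ?d * R ^ ?d) * (s ^ ?d / (s ^ ?d)\<^sup>2)"
      using sp by (simp add: a_def power2_eq_square)
    also have "\<dots> \<le> c * b\<^sup>2 * (R ^ ?d * R ^ ?d) * (R ^ ?d / (s ^ ?d)\<^sup>2)"
      using R c_pos sp by (intro mult_left_mono divide_right_mono power_mono) auto
    also have "\<dots> = c * R ^ (3 * ?d) * (b / s ^ ?d)\<^sup>2"
    proof -
      have "3 * ?d = ?d + ?d + ?d" by simp
      then have "R ^ (3 * ?d) = R ^ ?d * R ^ ?d * R ^ ?d" by (simp only: power_add)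
      then show ?thesis by (simp add: power_divide)
    qed
    also have "\<dots> \<le> S * (b / s ^ ?d)\<^sup>2" using S1 by (intro mult_right_mono) auto
    also note 1
    finally have "(4 ^ ?d * (R ^ ?d * R ^ ?d)) * (a / s ^ ?d) \<le> (4 ^ ?d * (R ^ ?d * R ^ ?d)) * p (8 * s\<^sup>2) x y"
      by (simp only: mult.commute)
    moreover have "0 < 4 ^ ?d * (R ^ ?d * R ^ ?d)" using R by simp
    ultimately show ?thesis by (simp only: mult_le_cancel_left_pos)
  qed
  then show ?thesis using a by blast
qed

text \<open>The integral is estimated in \<open>ennreal\<close>, where no integrability has to be
  checked; the passage to the real Bochner integral is made once, in
  \<open>W_kernel_eq\<close>.\<close>

definition logint :: "int ^ 'n \<Rightarrow> int ^ 'n \<Rightarrow> ennreal" where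
  "logint x y = (\<integral>\<^sup>+t. ennreal (p t x y / t) * indicator {1..} t \<partial>lborel)"

lemma p_measurable: "(\<lambda>t. p t x y) \<in> borel_measurable borel"
  by (intro borel_measurable_continuous_onI DERIV_continuous_on) (rule has_field_derivative_at_within[OF p_deriv])

lemma W_kernel_eq: "W_kernel w x y = m x * m y * enn2real (logint x y)"
proof -
  have "(LINT t:{1..}|lborel. heat_kernel w t x y / t) = (\<integral>t. indicator {1..} t * (p t x y / t) \<partial>lborel)"
    by (simp add: set_lebesgue_integral_def heat_kernel_eq_p)
  also have "\<dots> = enn2real (\<integral>\<^sup>+t. ennreal (indicator {1..} t * (p t x y / t)) \<partial>lborel)"
  proof (rule integral_eq_nn_integral)
    show "(\<lambda>t. indicator {1..} t * (p t x y / t)) \<in> borel_measurable lborel"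
      using p_measurable[of x y] by simp
  qed (auto simp: indicator_def p_nonneg)
  also have "(\<integral>\<^sup>+t. ennreal (indicator {1..} t * (p t x y / t)) \<partial>lborel) = logint x y"
    unfolding logint_def by (intro nn_integral_cong) (simp add: indicator_def)
  finally show ?thesis by (simp add: W_kernel_def)
qed

lemma nn_integral_inverse_sqrt:
  assumes "b \<ge> 1" and k: "k \<ge> 0"
  shows "(\<integral>\<^sup>+t. ennreal (k / sqrt t) * indicator {1..b\<^sup>2} t \<partial>lborel) = ennreal (2 * k * (b - 1))"
proof -
  have "(\<integral>\<^sup>+t. ennreal (k / sqrt t) * indicator {1..b\<^sup>2} t \<partial>lborel) = ennreal (2 * k * sqrt (b\<^sup>2) - 2 * k * sqrt 1)"
  proof (rule nn_integral_FTC_Icc[where F = "\<lambda>t. 2 * k * sqrt t"])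
    fix t :: real assume t: "t \<in> {1..b\<^sup>2}"
    show "((\<lambda>t. 2 * k * sqrt t) has_real_derivative k / sqrt t) (at t)"
      using t by (auto intro!: derivative_eq_intros simp: field_simps)
  qed (use assms in \<open>auto simp: one_le_power\<close>)
  then show ?thesis using assms by (simp add: right_diff_distrib)
qed

lemma nn_integral_tail:
  assumes b: "b \<ge> 1" and k: "k \<ge> 0"
  shows "(\<integral>\<^sup>+t. ennreal (k / (t * sqrt t)) * indicator {b\<^sup>2..} t \<partial>lborel) = ennreal (2 * k / b)"
proof -
  have b2: "b\<^sup>2 \<ge> 1" using b by (simp add: one_le_power)
  have "(\<integral>\<^sup>+t. ennreal (k / (t * sqrt t)) * indicator {b\<^sup>2..} t \<partial>lborel) = ennreal (0 - (- (2 * k) / sqrt (b\<^sup>2)))"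
  proof (rule nn_integral_FTC_atLeast[where F = "\<lambda>t. - (2 * k) / sqrt t"])
    fix t :: real assume t: "b\<^sup>2 \<le> t"
    then have tp: "t > 0" using b2 by linarith
    have "((\<lambda>t. - (2 * k) / sqrt t) has_real_derivative
        (0 * sqrt t - - (2 * k) * (inverse (sqrt t) / 2)) / (sqrt t * sqrt t)) (at t)"
      using tp by (intro DERIV_divide DERIV_real_sqrt DERIV_const) auto
    moreover have "(0 * sqrt t - - (2 * k) * (inverse (sqrt t) / 2)) / (sqrt t * sqrt t) = k / (t * sqrt t)"
      using tp by (simp add: field_simps)
    ultimately show "((\<lambda>t. - (2 * k) / sqrt t) has_real_derivative k / (t * sqrt t)) (at t)" by simp
    show "0 \<le> k / (t * sqrt t)" using tp k by simp
  next
    show "((\<lambda>t. - (2 * k) / sqrt t) \<longlongrightarrow> 0) at_top"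
      by (intro tendsto_divide_0[OF tendsto_const] filterlim_at_top_imp_at_infinity sqrt_at_top)
  qed auto
  then show ?thesis using b by simp
qed

text \<open>The integral is cut at time (1 + |x - y|)^2: before it the off-diagonal bound is used,
  after it the on-diagonal bound, and both pieces are of order (1 + |x - y|)^(-d).\<close>

lemma logint_upper: "\<exists>C>0. \<forall>x y. logint x y \<le> ennreal (C / (1 + l1 (x - y)) ^ CARD('n))"
proof -
  let ?d = "CARD('n)"
  obtain K where K: "K > 0" and pK: "\<forall>s\<ge>1/2. \<forall>x y. p (2 * s\<^sup>2) x y \<le> K / s ^ ?d
      \<and> (1 + l1 (x - y)) ^ Suc ?d * p (2 * s\<^sup>2) x y \<le> K * s"
    using p_upper by blast
  define C where "C = 2 * K + 2 * (K * 2 ^ ?d)"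
  have C: "C > 0" using K by (simp add: C_def add_pos_pos)
  have "logint x y \<le> ennreal (C / (1 + l1 (x - y)) ^ ?d)" for x y
  proof -
    define b where "b = 1 + l1 (x - y)"
    have b: "b \<ge> 1" by (simp add: b_def)
    define k1 where "k1 = K / b ^ Suc ?d"
    \<comment> \<open>Of the decay t^(-d/2) only t^(-1/2) is kept for convergence at infinity; the
      other d - 1 powers of sqrt t >= b are frozen at b. One antiderivative then serves every
      dimension.\<close>
    define k2 where "k2 = K * 2 ^ ?d / b ^ (?d - 1)"
    have k: "k1 \<ge> 0" "k2 \<ge> 0" using K b by (simp_all add: k1_def k2_def)
    have p12: "p t x y / t \<le> k1 / sqrt t" "p t x y * sqrt t ^ ?d \<le> K * 2 ^ ?d" if t: "t \<ge> 1" for t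
    proof -
      define s where "s = sqrt t / sqrt 2"
      have ts: "2 * s\<^sup>2 = t" using t by (simp add: s_def power_divide)
      have sq2: "1 \<le> sqrt 2" "sqrt 2 \<le> 2" by (auto intro: real_le_lsqrt)
      have st: "s \<le> sqrt t" using sq2 t unfolding s_def by (simp add: divide_le_eq mult_left_le_one_le)
      have ts2: "sqrt t / 2 \<le> s" unfolding s_def using sq2 t by (intro divide_left_mono) auto
      have s: "1 / 2 \<le> s" using ts2 real_sqrt_ge_one[OF t] by linarith
      have pp: "p t x y \<le> K / s ^ ?d" "b ^ Suc ?d * p t x y \<le> K * s"
        using pK s unfolding b_def ts[symmetric] by blast+
      have "b ^ Suc ?d * p t x y \<le> K * sqrt t" using pp(2) mult_left_mono[OF st, of K] K by linarith
      then have "p t x y \<le> k1 * sqrt t" using b by (simp add: k1_def pos_le_divide_eq mult.commute)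
      then have "p t x y / t \<le> k1 * sqrt t / t" using t by (intro divide_right_mono) auto
      also have "\<dots> = k1 / sqrt t" using t by (simp add: field_simps)
      finally show "p t x y / t \<le> k1 / sqrt t" .
      have "K / s ^ ?d \<le> K / (sqrt t / 2) ^ ?d"
        using ts2 t K s by (intro divide_left_mono power_mono mult_pos_pos zero_less_power) auto
      then have "p t x y \<le> K * 2 ^ ?d / sqrt t ^ ?d" using pp(1) by (simp add: power_divide)
      then show "p t x y * sqrt t ^ ?d \<le> K * 2 ^ ?d" using t by (simp add: pos_le_divide_eq)
    qed
    have p2: "p t x y / t \<le> k2 / (t * sqrt t)" if t: "t \<ge> b\<^sup>2" for t
    proof -
      have t1: "t \<ge> 1" using t b one_le_power[OF b, of 2] by linarith
      have bt: "b \<le> sqrt t" using t by (rule real_le_rsqrt)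
      have "sqrt t ^ ?d = sqrt t ^ (?d - 1) * sqrt t" by (rule power_minus_mult[symmetric]) simp
      moreover have "b ^ (?d - 1) * sqrt t \<le> sqrt t ^ (?d - 1) * sqrt t"
        using bt b t1 by (intro mult_right_mono power_mono) auto
      ultimately have "p t x y * (b ^ (?d - 1) * sqrt t) \<le> p t x y * sqrt t ^ ?d"
        using t1 p_nonneg[of t x y] by (intro mult_left_mono) auto
      then have "p t x y * (b ^ (?d - 1) * sqrt t) \<le> K * 2 ^ ?d" using p12(2)[OF t1] by linarith
      moreover have "0 < b ^ (?d - 1) * sqrt t" using b t1 by simp
      ultimately have "p t x y \<le> K * 2 ^ ?d / (b ^ (?d - 1) * sqrt t)" by (simp only: pos_le_divide_eq)
      then have "p t x y / t \<le> K * 2 ^ ?d / (b ^ (?d - 1) * sqrt t) / t" using t1 by (intro divide_right_mono) auto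
      then show ?thesis by (simp add: k2_def mult.commute)
    qed
    have "logint x y \<le> (\<integral>\<^sup>+t. ennreal (k1 / sqrt t) * indicator {1..b\<^sup>2} t + ennreal (k2 / (t * sqrt t)) * indicator {b\<^sup>2..} t \<partial>lborel)"
      unfolding logint_def
    proof (rule nn_integral_mono)
      fix t :: real
      show "ennreal (p t x y / t) * indicator {1..} t
          \<le> ennreal (k1 / sqrt t) * indicator {1..b\<^sup>2} t + ennreal (k2 / (t * sqrt t)) * indicator {b\<^sup>2..} t"
      proof (cases "t \<ge> 1")
        case True
        show ?thesis
        proof (cases "t \<le> b\<^sup>2")
          case le: True
          have "ennreal (p t x y / t) * indicator {1..} t \<le> ennreal (k1 / sqrt t) * indicator {1..b\<^sup>2} t"
            using True le p12(1) by (simp add: ennreal_leI)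
          then show ?thesis by (rule order_trans) simp
        next
          case False
          then have "ennreal (p t x y / t) * indicator {1..} t \<le> ennreal (k2 / (t * sqrt t)) * indicator {b\<^sup>2..} t"
            using True p2 by (simp add: ennreal_leI)
          then show ?thesis by (rule order_trans) simp
        qed
      qed simp
    qed
    also have "\<dots> = (\<integral>\<^sup>+t. ennreal (k1 / sqrt t) * indicator {1..b\<^sup>2} t \<partial>lborel)
        + (\<integral>\<^sup>+t. ennreal (k2 / (t * sqrt t)) * indicator {b\<^sup>2..} t \<partial>lborel)"
      by (rule nn_integral_add) auto
    also have "\<dots> = ennreal (2 * k1 * (b - 1) + 2 * k2 / b)"
      unfolding nn_integral_inverse_sqrt[OF b k(1)] nn_integral_tail[OF b k(2)]
      using k b by (simp add: ennreal_plus)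
    also have "\<dots> \<le> ennreal (C / b ^ ?d)"
    proof (rule ennreal_leI)
      have "2 * k1 * (b - 1) \<le> 2 * k1 * b" using k b by (intro mult_left_mono) auto
      also have "\<dots> = 2 * K / b ^ ?d" using b by (simp add: k1_def)
      finally have "2 * k1 * (b - 1) \<le> 2 * K / b ^ ?d" .
      moreover have "2 * k2 / b = 2 * (K * 2 ^ ?d) / b ^ ?d"
      proof -
        have "b ^ ?d = b ^ (?d - 1) * b" by (rule power_minus_mult[symmetric]) simp
        then show ?thesis by (simp add: k2_def)
      qed
      ultimately show "2 * k1 * (b - 1) + 2 * k2 / b \<le> C / b ^ ?d"
        unfolding C_def add_divide_distrib by linarith
    qed
    finally show ?thesis by (simp add: b_def)
  qed
  then show ?thesis using C by blast
qed

lemma logint_lower: "\<exists>a>0. \<forall>x y. ennreal (a / (max 1 (l1 (x - y))) ^ CARD('n)) \<le> logint x y"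
proof -
  let ?d = "CARD('n)"
  obtain a where a: "a > 0" and pa: "\<forall>s\<ge>1. \<forall>x y. l1 (x - y) \<le> s \<longrightarrow> a / s ^ ?d \<le> p (8 * s\<^sup>2) x y"
    using p_lower by blast
  have "ennreal (3 / 4 * a / 2 ^ ?d / (max 1 (l1 (x - y))) ^ ?d) \<le> logint x y" for x y
  proof -
    define r where "r = max 1 (l1 (x - y))"
    have r: "r \<ge> 1" "l1 (x - y) \<le> r" by (simp_all add: r_def)
    \<comment> \<open>The smallest value of the lower bound for p t x y / t on 8 r^2 <= t <= 32 r^2,
      that is for r <= s <= 2 r; the window has length 24 r^2, whence 24/32 = 3/4.\<close>
    define k where "k = a / (2 * r) ^ ?d / (32 * r\<^sup>2)"
    have k: "k \<ge> 0" using a r by (simp add: k_def)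
    have r2: "1 \<le> r\<^sup>2" using r by (simp add: one_le_power)
    have pk: "k \<le> p t x y / t" if t: "8 * r\<^sup>2 \<le> t" "t \<le> 32 * r\<^sup>2" for t
    proof -
      have t1: "t \<ge> 1" using t r2 by linarith
      define s where "s = sqrt (t / 8)"
      have ts: "8 * s\<^sup>2 = t" using t1 by (simp add: s_def)
      have rs: "r \<le> s" unfolding s_def using t by (intro real_le_rsqrt) simp
      have sr: "s \<le> 2 * r" unfolding s_def using t r by (intro real_le_lsqrt) (auto simp: power_mult_distrib)
      have "a / (2 * r) ^ ?d \<le> a / s ^ ?d"
        using a sr rs r by (intro divide_left_mono power_mono mult_pos_pos zero_less_power) auto
      also have "\<dots> \<le> p t x y" unfolding ts[symmetric] using pa rs r by (meson order_trans)
      finally have "a / (2 * r) ^ ?d \<le> p t x y" .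
      then show ?thesis unfolding k_def using t t1 a r p_nonneg[of t x y] by (intro frac_le) auto
    qed
    have "ennreal (3 / 4 * a / 2 ^ ?d / r ^ ?d) = ennreal (k * (24 * r\<^sup>2))"
      using r by (simp add: k_def power_mult_distrib field_simps)
    also have "\<dots> = (\<integral>\<^sup>+t. ennreal k * indicator {8 * r\<^sup>2..32 * r\<^sup>2} t \<partial>lborel)"
      using k by (simp add: nn_integral_cmult ennreal_mult')
    also have "\<dots> \<le> logint x y"
      unfolding logint_def
    proof (rule nn_integral_mono)
      fix t :: real
      show "ennreal k * indicator {8 * r\<^sup>2..32 * r\<^sup>2} t \<le> ennreal (p t x y / t) * indicator {1..} t"
        using pk[of t] r2 by (auto simp: indicator_def ennreal_leI)
    qed
    finally show ?thesis by (simp add: r_def)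
  qed
  moreover have "3 / 4 * a / 2 ^ ?d > 0" using a by simp
  ultimately show ?thesis by blast
qed

text \<open>Both \<open>1 + l1 (x - y)\<close> and \<open>max 1 (l1 (x - y))\<close> equal 1 on the
  diagonal and are comparable to the distance off it, so one pair of inequalities contains both
  claims of the theorem.\<close>

lemma W_kernel_bounds:
  "\<exists>C\<ge>1. \<forall>x y. W_kernel w x y \<le> C / (1 + l1 (x - y)) ^ CARD('n)
     \<and> 1 / (C * (max 1 (l1 (x - y))) ^ CARD('n)) \<le> W_kernel w x y"
proof -
  let ?d = "CARD('n)"
  obtain C where C: "C > 0" and up: "\<And>x y. logint x y \<le> ennreal (C / (1 + l1 (x - y)) ^ ?d)"
    using logint_upper by blast
  obtain a where a: "a > 0" and low: "\<And>x y. ennreal (a / (max 1 (l1 (x - y))) ^ ?d) \<le> logint x y"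
    using logint_lower by blast
  define C' where "C' = max 1 (max (M\<^sup>2 * C) (1 / (c\<^sup>2 * a)))"
  have C': "1 \<le> C'" "M\<^sup>2 * C \<le> C'" "1 / (c\<^sup>2 * a) \<le> C'" by (simp_all add: C'_def)
  have "W_kernel w x y \<le> C' / (1 + l1 (x - y)) ^ ?d
     \<and> 1 / (C' * (max 1 (l1 (x - y))) ^ ?d) \<le> W_kernel w x y" for x y
  proof
    let ?b = "1 + l1 (x - y)" and ?r = "max 1 (l1 (x - y))"
    have b: "?b > 0" using l1_nonneg[of "x - y"] by linarith
    have r: "?r > 0" by simp
    have J1: "enn2real (logint x y) \<le> C / ?b ^ ?d"
      using up[of x y] C b by (intro enn2real_leI) auto
    have J2: "a / ?r ^ ?d \<le> enn2real (logint x y)"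
    proof -
      \<comment> \<open>\<open>enn2real\<close> sends infinity to 0, so the lower bound passes to
        the reals only once finiteness is known from the upper one.\<close>
      have "logint x y < top" using up[of x y] ennreal_less_top by (rule le_less_trans)
      then have "enn2real (ennreal (a / ?r ^ ?d)) \<le> enn2real (logint x y)"
        using low[of x y] by (intro enn2real_mono)
      then show ?thesis using a r by simp
    qed
    have "W_kernel w x y \<le> M * M * (C / ?b ^ ?d)"
      unfolding W_kernel_eq using J1 m_le M_pos C b by (intro mult_mono) auto
    also have "\<dots> = M\<^sup>2 * C / ?b ^ ?d" by (simp add: power2_eq_square)
    also have "\<dots> \<le> C' / ?b ^ ?d" using C' b by (intro divide_right_mono) auto
    finally show "W_kernel w x y \<le> C' / ?b ^ ?d" .
    have "1 / (C' * ?r ^ ?d) = 1 / C' / ?r ^ ?d" by simp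
    also have "\<dots> \<le> c\<^sup>2 * a / ?r ^ ?d"
    proof (rule divide_right_mono)
      have "1 \<le> C' * (c\<^sup>2 * a)" using C'(3) c_pos a by (simp add: pos_divide_le_eq)
      then show "1 / C' \<le> c\<^sup>2 * a" using C'(1) by (simp add: pos_divide_le_eq mult.commute)
    qed (use r in simp)
    also have "\<dots> = c * c * (a / ?r ^ ?d)" by (simp add: power2_eq_square)
    also have "\<dots> \<le> W_kernel w x y"
      unfolding W_kernel_eq using J2 m_ge c_pos a by (intro mult_mono) auto
    finally show "1 / (C' * ?r ^ ?d) \<le> W_kernel w x y" .
  qed
  then show ?thesis using C'(1) by blast
qed

end

theorem proposition1p3:
  fixes w :: "int ^ 'n::finite \<Rightarrow> int ^ 'n \<Rightarrow> real"
  assumes w_sym: "\<And>x y. w x y = w y x"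
    and w_pos: "\<And>x y. adj x y \<Longrightarrow> w x y > 0"
    and w_zero: "\<And>x y. \<not> adj x y \<Longrightarrow> w x y = 0"
    and mu_min_pos: "0 < (INF x. ereal (vertex_measure w x))"
    and mu_max_finite: "(SUP x. ereal (vertex_measure w x)) < \<infinity>"
    and w_inf_pos: "0 < (INF (x, y)\<in>{(x, y). adj x y}. ereal (w x y))"
  shows "\<exists>C\<ge>1.
     (\<forall>x y. x \<noteq> y \<longrightarrow>
        inverse C * real (graph_dist x y) powi (- int CARD('n)) \<le> W_kernel w x y \<and>
        W_kernel w x y \<le> C * real (graph_dist x y) powi (- int CARD('n))) \<and>
     (\<forall>x. inverse C \<le> W_kernel w x x \<and> W_kernel w x x \<le> C)"
proof -
  \<comment> \<open>Density of the reals gives constants strictly inside the extended-real bounds,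
    as the locale works with real numbers.\<close>
  obtain c where c: "0 < c" "ereal c < (INF (x, y)\<in>{(x, y). adj x y}. ereal (w x y))"
    using ereal_dense2[OF w_inf_pos] by auto
  obtain M where M: "(SUP x. ereal (vertex_measure w x)) < ereal M"
    using ereal_dense2[OF mu_max_finite] by auto
  interpret lattice w c M
  proof
    show "c \<le> w x y" if "adj x y" for x y
    proof -
      have "(INF (x, y)\<in>{(x, y). adj x y}. ereal (w x y)) \<le> ereal (w x y)"
        using INF_lower[of "(x, y)" "{(x, y). adj x y}" "\<lambda>(x, y). ereal (w x y)"] that by simp
      then have "ereal c < ereal (w x y)" using c(2) by (rule less_le_trans[rotated])
      then show ?thesis by simp
    qed
    show "vertex_measure w x \<le> M" for x
    proof -
      have "ereal (vertex_measure w x) \<le> (SUP x. ereal (vertex_measure w x))" by (rule SUP_upper) simp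
      then have "ereal (vertex_measure w x) < ereal M" using M by (rule le_less_trans)
      then show ?thesis by simp
    qed
  qed (use w_sym c in auto)
  let ?d = "CARD('n)"
  obtain C where C: "C \<ge> 1" and up: "\<And>x y. W_kernel w x y \<le> C / (1 + l1 (x - y)) ^ ?d"
    and low: "\<And>x y. 1 / (C * (max 1 (l1 (x - y))) ^ ?d) \<le> W_kernel w x y"
    using W_kernel_bounds by blast
  show ?thesis
  proof (intro exI[of _ C] conjI allI impI)
    fix x y :: "int ^ 'n" assume xy: "x \<noteq> y"
    obtain k where k: "l1 (x - y) = real k" using l1_nat by blast
    then have k0: "k \<noteq> 0" using xy l1_eq_0_iff[of x y] by auto
    then have l: "1 \<le> l1 (x - y)" using k by simp
    have pw: "real (graph_dist x y) powi (- int ?d) = 1 / l1 (x - y) ^ ?d"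
      by (simp add: graph_dist_l1 power_int_minus divide_inverse)
    have "max 1 (l1 (x - y)) = l1 (x - y)" using l by simp
    then show "inverse C * real (graph_dist x y) powi (- int ?d) \<le> W_kernel w x y"
      using low[of x y] unfolding pw by (simp add: divide_inverse)
    have "C / (1 + l1 (x - y)) ^ ?d \<le> C / l1 (x - y) ^ ?d"
      using l C by (intro divide_left_mono power_mono mult_pos_pos zero_less_power) auto
    then show "W_kernel w x y \<le> C * real (graph_dist x y) powi (- int ?d)"
      using up[of x y] unfolding pw by simp
  next
    show "inverse C \<le> W_kernel w x x" for x using low[of x x] by (simp add: divide_inverse)
    show "W_kernel w x x \<le> C" for x using up[of x x] by simp
  qed (rule C)
qed

end
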